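(* Let $(\widetilde M^{4n},Q,\widetilde g)$ be a para-quaternionic Kähler manifold with $\nu\neq0$, let $\epsilon\in\{-1,1\}$, and let $(M^{4k},\mathcal J^\epsilon,g)$ be an almost $\epsilon$-Hermitian submanifold of dimension $4k$ of $\widetilde M^{4n}$. Assume that the set $U$ of points $x\in M$ where the Nijenhuis tensor of $\mathcal J^\epsilon$ is not zero is open and dense in $M$ and that, for all $x\in U$, the subspace $\overline{T_xM}$ is non-degenerate. Then $M$ is a totally geodesic para-quaternionic Kähler submanifold.
   Context: An almost para-quaternionic structure on $\widetilde M$ is a rank 3 subbundle $Q\subset \mathrm{End}\,T\widetilde M$ locally generated by three anticommuting fields of endomorphisms $J_1,J_2,J_3=J_1J_2$ with $J_\alpha^2=\epsilon_\alpha Id$, where $(\epsilon_1,\epsilon_2,\epsilon_3)$ is a permutation of $(-1,1,1)$. A para-quaternionic Kähler manifold $(\widetilde M^{4n},Q,\widetilde g)$ is a pseudo-Riemannian manifold (of dimension $4n$, neutral signature) with such a $Q$ consisting of $\widetilde g$-skew-symmetric endomorphisms and preserved by the Levi-Civita connection; in dimension 4 ($n=1$) one requires in addition that the curvature tensor decomposes as $\widetilde R=\nu R_0+W$, with $R_0(X,Y)=\frac12\sum_\alpha\epsilon_\alpha\widetilde g(J_\alpha X,Y)J_\alpha+\frac14(X\wedge Y-\sum_\alpha\epsilon_\alpha J_\alpha X\wedge J_\alpha Y)$, $(X\wedge Y)Z=\widetilde g(Y,Z)X-\widetilde g(X,Z)Y$, and $W$ a trace-free $Q$-invariant algebraic curvature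 tensor ($Q$ acting by derivations). $\nu=scal/(4n(n+2))$ is the reduced scalar curvature. A $\widetilde g$-non-degenerate submanifold $M\subset\widetilde M$ is an almost $\epsilon$-Hermitian submanifold if there is a section $J^\epsilon:M\to Q|_M$ with $J^\epsilon TM=TM$ and $(J^\epsilon)^2=\epsilon Id$; put $g=\widetilde g|_M$, $\mathcal J^\epsilon=J^\epsilon|_{TM}$. The Nijenhuis tensor of $\mathcal J^\epsilon$ is $N(X,Y)=[\mathcal J^\epsilon X,\mathcal J^\epsilon Y]-\mathcal J^\epsilon[\mathcal J^\epsilon X,Y]-\mathcal J^\epsilon[X,\mathcal J^\epsilon Y]+\epsilon[X,Y]$. For $x\in M$, $\overline{T_xM}$ denotes the maximal $Q_x$-invariant subspace of $T_xM$; it is non-degenerate if $\widetilde g$ restricted to it is non-degenerate. A para-quaternionic Kähler submanifold is a non-degenerate submanifold whose tangent bundle is $Q$-invariant and which is para-quaternionic Kähler with the induced structure $(Q|_{TM},\widetilde g|_M)$. *)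

theory Defs
  imports "HOL-Analysis.Analysis"
begin

section \<open>Smooth manifolds\<close>

text \<open>
  For open S this is the usual notion of C^k: directional derivatives in every direction are
  again C^(k-1).
\<close>

primrec Ck_on :: "nat \<Rightarrow> 'e::euclidean_space set \<Rightarrow> ('e \<Rightarrow> 'f::real_normed_vector) \<Rightarrow> bool" where
  "Ck_on 0 S f \<longleftrightarrow> continuous_on S f"
| "Ck_on (Suc k) S f \<longleftrightarrow>
     (\<forall>y\<in>S. f differentiable (at y)) \<and> (\<forall>v. Ck_on k S (\<lambda>y. frechet_derivative f (at y) v))"

definition smooth_on :: "'e::euclidean_space set \<Rightarrow> ('e \<Rightarrow> 'f::real_normed_vector) \<Rightarrow> bool" where
  "smooth_on S f \<longleftrightarrow> (\<forall>k. Ck_on k S f)"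

text \<open>A chart is its domain together with its coordinate map (irrelevant outside the domain).\<close>

type_synonym ('a, 'e) chart = "'a set \<times> ('a \<Rightarrow> 'e)"

definition chart_dom :: "('a, 'e) chart \<Rightarrow> 'a set" where
  "chart_dom c = fst c"

definition chart_map :: "('a, 'e) chart \<Rightarrow> 'a \<Rightarrow> 'e" where
  "chart_map c = snd c"

definition chart_inv :: "('a, 'e) chart \<Rightarrow> 'e \<Rightarrow> 'a" where
  "chart_inv c = inv_into (chart_dom c) (chart_map c)"

record ('a, 'e) manifold =
  mtop :: "'a topology"
  atlas :: "('a, 'e) chart set"

definition smooth_in_chart ::
    "('a, 'e::euclidean_space) chart \<Rightarrow> 'a set \<Rightarrow> ('a \<Rightarrow> 'f::real_normed_vector) \<Rightarrow> bool" where
  "smooth_in_chart c V F \<longleftrightarrow> smooth_on (chart_map c ` V) (F \<circ> chart_inv c)"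

definition second_countable_top :: "'a topology \<Rightarrow> bool" where
  "second_countable_top T \<longleftrightarrow>
     (\<exists>B. countable B \<and> (\<forall>V\<in>B. openin T V) \<and>
          (\<forall>W p. openin T W \<longrightarrow> p \<in> W \<longrightarrow> (\<exists>V\<in>B. p \<in> V \<and> V \<subseteq> W)))"

definition smooth_manifold :: "('a, 'e::euclidean_space) manifold \<Rightarrow> bool" where
  "smooth_manifold M \<longleftrightarrow>
     Hausdorff_space (mtop M) \<and> second_countable_top (mtop M) \<and>
     (\<Union>c\<in>atlas M. chart_dom c) = topspace (mtop M) \<and>
     (\<forall>c\<in>atlas M. openin (mtop M) (chart_dom c) \<and> open (chart_map c ` chart_dom c) \<and>
        homeomorphic_map (subtopology (mtop M) (chart_dom c))
          (top_of_set (chart_map c ` chart_dom c)) (chart_map c)) \<and>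
     (\<forall>c\<in>atlas M. \<forall>c'\<in>atlas M. smooth_in_chart c (chart_dom c \<inter> chart_dom c') (chart_map c'))"

text \<open>
  A chart c around p identifies the tangent space at p with the model space 'e. Accordingly, a
  tensor (or a tensor field) is given by its expressions T c p in all charts c around p, subject
  to the transformation law of its type. coord_deriv c F p is the differential at p of a map F
  written in the coordinates c. For two charts c, c' around p, dcoord c c' p is the Jacobian of
  the transition map; for c a chart of a submanifold and c' a chart of the ambient manifold it
  is the coordinate expression of the differential of the inclusion.
\<close>

definition coord_deriv ::
    "('a, 'e::euclidean_space) chart \<Rightarrow> ('a \<Rightarrow> 'f::real_normed_vector) \<Rightarrow> 'a \<Rightarrow> 'e \<Rightarrow> 'f" where
  "coord_deriv c F p = frechet_derivative (F \<circ> chart_inv c) (at (chart_map c p))"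

definition dcoord ::
    "('a, 'e::euclidean_space) chart \<Rightarrow> ('a, 'f::euclidean_space) chart \<Rightarrow> 'a \<Rightarrow> 'e \<Rightarrow> 'f" where
  "dcoord c c' p = coord_deriv c (chart_map c') p"


section \<open>Pseudo-Riemannian metrics, Levi-Civita connection, curvature\<close>

type_synonym ('a, 'e) metric = "('a, 'e) chart \<Rightarrow> 'a \<Rightarrow> 'e \<Rightarrow>\<^sub>L 'e \<Rightarrow>\<^sub>L real"

definition nondegenerate_on :: "('e::euclidean_space \<Rightarrow>\<^sub>L 'e \<Rightarrow>\<^sub>L real) \<Rightarrow> 'e set \<Rightarrow> bool" where
  "nondegenerate_on B S \<longleftrightarrow> (\<forall>u\<in>S. (\<forall>v\<in>S. B u v = 0) \<longrightarrow> u = 0)"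

definition pseudo_riemannian :: "('a, 'e::euclidean_space) manifold \<Rightarrow> ('a, 'e) metric \<Rightarrow> bool" where
  "pseudo_riemannian M g \<longleftrightarrow>
     smooth_manifold M \<and>
     (\<forall>c\<in>atlas M. smooth_in_chart c (chart_dom c) (g c)) \<and>
     (\<forall>c\<in>atlas M. \<forall>p\<in>chart_dom c.
        (\<forall>u v. g c p u v = g c p v u) \<and> nondegenerate_on (g c p) UNIV) \<and>
     (\<forall>c\<in>atlas M. \<forall>c'\<in>atlas M. \<forall>p\<in>chart_dom c \<inter> chart_dom c'. \<forall>u v.
        g c p u v = g c' p (dcoord c c' p u) (dcoord c c' p v))"

definition has_signature :: "('e::euclidean_space \<Rightarrow>\<^sub>L 'e \<Rightarrow>\<^sub>L real) \<Rightarrow> nat \<Rightarrow> nat \<Rightarrow> bool" where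
  "has_signature B r s \<longleftrightarrow>
     r + s = DIM('e) \<and>
     (\<exists>P. subspace P \<and> dim P = r \<and> (\<forall>u\<in>P. u \<noteq> 0 \<longrightarrow> B u u > 0)) \<and>
     (\<exists>N. subspace N \<and> dim N = s \<and> (\<forall>u\<in>N. u \<noteq> 0 \<longrightarrow> B u u < 0))"

text \<open>
  In the coordinates c the Levi-Civita connection is nabla_X Y = dY(X) + Gamma(X, Y), where
  Gamma = levi_civita g c p is the unique torsion-free (i.e. symmetric) Christoffel form for which
  the metric is parallel.
\<close>

definition levi_civita ::
    "('a, 'e::euclidean_space) metric \<Rightarrow> ('a, 'e) chart \<Rightarrow> 'a \<Rightarrow> 'e \<Rightarrow>\<^sub>L 'e \<Rightarrow>\<^sub>L 'e" where
  "levi_civita g c p = (THE \<Gamma> :: 'e \<Rightarrow>\<^sub>L 'e \<Rightarrow>\<^sub>L 'e.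
     (\<forall>X Y. \<Gamma> X Y = \<Gamma> Y X) \<and>
     (\<forall>X Y Z. coord_deriv c (g c) p X Y Z = g c p (\<Gamma> X Y) Z + g c p Y (\<Gamma> X Z)))"

text \<open>
  The covariant derivative (nabla_X A) Z = nabla_X (A Z) - A (nabla_X Z) of a field A of
  endomorphisms.
\<close>

definition cov_deriv_endo ::
    "('a, 'e::euclidean_space) metric \<Rightarrow> ('a, 'e) chart \<Rightarrow> ('a \<Rightarrow> 'e \<Rightarrow>\<^sub>L 'e) \<Rightarrow> 'a \<Rightarrow> 'e \<Rightarrow> 'e \<Rightarrow>\<^sub>L 'e" where
  "cov_deriv_endo g c A p X =
     coord_deriv c A p X + (levi_civita g c p X o\<^sub>L A p) - (A p o\<^sub>L levi_civita g c p X)"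

text \<open>R(X, Y) = [nabla_X, nabla_Y] - nabla_[X, Y], evaluated on constant coordinate fields.\<close>

definition curvature ::
    "('a, 'e::euclidean_space) metric \<Rightarrow> ('a, 'e) chart \<Rightarrow> 'a \<Rightarrow> 'e \<Rightarrow> 'e \<Rightarrow> 'e \<Rightarrow>\<^sub>L 'e" where
  "curvature g c p X Y =
     blinfun_apply (coord_deriv c (levi_civita g c) p X) Y
     - blinfun_apply (coord_deriv c (levi_civita g c) p Y) X
     + (levi_civita g c p X o\<^sub>L levi_civita g c p Y) - (levi_civita g c p Y o\<^sub>L levi_civita g c p X)"

definition endo_trace :: "('e::euclidean_space \<Rightarrow> 'e) \<Rightarrow> real" where
  "endo_trace f = (\<Sum>b\<in>Basis. f b \<bullet> b)"

definition ricci :: "('a, 'e::euclidean_space) metric \<Rightarrow> ('a, 'e) chart \<Rightarrow> 'a \<Rightarrow> 'e \<Rightarrow> 'e \<Rightarrow> real" where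
  "ricci g c p Y Z = endo_trace (\<lambda>X. curvature g c p X Y Z)"

text \<open>The metric trace of the Ricci tensor: the trace of the Ricci operator.\<close>

definition scal :: "('a, 'e::euclidean_space) metric \<Rightarrow> ('a, 'e) chart \<Rightarrow> 'a \<Rightarrow> real" where
  "scal g c p = endo_trace (blinfun_apply (THE A :: 'e \<Rightarrow>\<^sub>L 'e. \<forall>Y Z. g c p (A Y) Z = ricci g c p Y Z))"

definition reduced_scal ::
    "nat \<Rightarrow> ('a, 'e::euclidean_space) metric \<Rightarrow> ('a, 'e) chart \<Rightarrow> 'a \<Rightarrow> real" where
  "reduced_scal n g c p = scal g c p / (4 * real n * (real n + 2))"


section \<open>Para-quaternionic Kaehler manifolds\<close>

type_synonym ('a, 'e) endo_bundle = "('a, 'e) chart \<Rightarrow> 'a \<Rightarrow> ('e \<Rightarrow>\<^sub>L 'e) set"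

definition para_quaternionic_signs :: "(real \<times> real \<times> real) set" where
  "para_quaternionic_signs = {(-1, 1, 1), (1, -1, 1), (1, 1, -1)}"

definition para_hypercomplex_triple ::
    "real \<Rightarrow> real \<Rightarrow> real \<Rightarrow> ('e::euclidean_space \<Rightarrow>\<^sub>L 'e) \<Rightarrow> ('e \<Rightarrow>\<^sub>L 'e) \<Rightarrow> ('e \<Rightarrow>\<^sub>L 'e) \<Rightarrow> bool" where
  "para_hypercomplex_triple e1 e2 e3 J1 J2 J3 \<longleftrightarrow>
     (e1, e2, e3) \<in> para_quaternionic_signs \<and>
     J1 o\<^sub>L J1 = e1 *\<^sub>R id_blinfun \<and> J2 o\<^sub>L J2 = e2 *\<^sub>R id_blinfun \<and> J3 o\<^sub>L J3 = e3 *\<^sub>R id_blinfun \<and>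
     J1 o\<^sub>L J2 = - (J2 o\<^sub>L J1) \<and> J1 o\<^sub>L J3 = - (J3 o\<^sub>L J1) \<and> J2 o\<^sub>L J3 = - (J3 o\<^sub>L J2) \<and>
     J3 = J1 o\<^sub>L J2"

text \<open>
  The relations of a para-hypercomplex triple make it linearly independent, so that the local
  frames below exhibit Q as a bundle of rank 3.
\<close>

definition almost_para_quaternionic ::
    "('a, 'e::euclidean_space) manifold \<Rightarrow> ('a, 'e) endo_bundle \<Rightarrow> bool" where
  "almost_para_quaternionic M Q \<longleftrightarrow>
     (\<forall>c\<in>atlas M. \<forall>c'\<in>atlas M. \<forall>p\<in>chart_dom c \<inter> chart_dom c'. \<forall>B.
        B \<in> Q c' p \<longleftrightarrow> (\<exists>A\<in>Q c p. \<forall>u. B (dcoord c c' p u) = dcoord c c' p (A u))) \<and>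
     (\<forall>c\<in>atlas M. \<forall>p\<in>chart_dom c. \<exists>V e1 e2 e3 J1 J2 J3.
        openin (mtop M) V \<and> p \<in> V \<and> V \<subseteq> chart_dom c \<and>
        smooth_in_chart c V J1 \<and> smooth_in_chart c V J2 \<and> smooth_in_chart c V J3 \<and>
        (\<forall>q\<in>V. para_hypercomplex_triple e1 e2 e3 (J1 q) (J2 q) (J3 q) \<and>
               Q c q = span {J1 q, J2 q, J3 q}))"

definition levi_civita_preserves ::
    "('a, 'e::euclidean_space) manifold \<Rightarrow> ('a, 'e) metric \<Rightarrow> ('a, 'e) endo_bundle \<Rightarrow> bool" where
  "levi_civita_preserves M g Q \<longleftrightarrow>
     (\<forall>c\<in>atlas M. \<forall>V A.
        openin (mtop M) V \<longrightarrow> V \<subseteq> chart_dom c \<longrightarrow> smooth_in_chart c V A \<longrightarrow> (\<forall>q\<in>V. A q \<in> Q c q) \<longrightarrow>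
        (\<forall>p\<in>V. \<forall>X. cov_deriv_endo g c A p X \<in> Q c p))"

definition wedge_endo :: "('e::euclidean_space \<Rightarrow>\<^sub>L 'e \<Rightarrow>\<^sub>L real) \<Rightarrow> 'e \<Rightarrow> 'e \<Rightarrow> 'e \<Rightarrow> 'e" where
  "wedge_endo B X Y Z = B Y Z *\<^sub>R X - B X Z *\<^sub>R Y"

text \<open>The curvature tensor of the para-quaternionic projective space.\<close>

definition R0 ::
    "('e::euclidean_space \<Rightarrow>\<^sub>L 'e \<Rightarrow>\<^sub>L real) \<Rightarrow> real \<Rightarrow> real \<Rightarrow> real \<Rightarrow>
     ('e \<Rightarrow>\<^sub>L 'e) \<Rightarrow> ('e \<Rightarrow>\<^sub>L 'e) \<Rightarrow> ('e \<Rightarrow>\<^sub>L 'e) \<Rightarrow> 'e \<Rightarrow> 'e \<Rightarrow> 'e \<Rightarrow> 'e" where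
  "R0 B e1 e2 e3 J1 J2 J3 X Y Z =
     (1/2) *\<^sub>R ((e1 * B (J1 X) Y) *\<^sub>R J1 Z + (e2 * B (J2 X) Y) *\<^sub>R J2 Z + (e3 * B (J3 X) Y) *\<^sub>R J3 Z)
     + (1/4) *\<^sub>R (wedge_endo B X Y Z
         - (e1 *\<^sub>R wedge_endo B (J1 X) (J1 Y) Z
            + e2 *\<^sub>R wedge_endo B (J2 X) (J2 Y) Z
            + e3 *\<^sub>R wedge_endo B (J3 X) (J3 Y) Z))"

definition algebraic_curvature ::
    "('e::euclidean_space \<Rightarrow>\<^sub>L 'e \<Rightarrow>\<^sub>L real) \<Rightarrow> ('e \<Rightarrow> 'e \<Rightarrow> 'e \<Rightarrow> 'e) \<Rightarrow> bool" where
  "algebraic_curvature B W \<longleftrightarrow>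
     (\<forall>Y Z. linear (\<lambda>X. W X Y Z)) \<and> (\<forall>X Z. linear (\<lambda>Y. W X Y Z)) \<and> (\<forall>X Y. linear (\<lambda>Z. W X Y Z)) \<and>
     (\<forall>X Y Z. W X Y Z = - W Y X Z) \<and>
     (\<forall>X Y Z V. B (W X Y Z) V = - B Z (W X Y V)) \<and>
     (\<forall>X Y Z. W X Y Z + W Y Z X + W Z X Y = 0)"

definition trace_free :: "('e::euclidean_space \<Rightarrow> 'e \<Rightarrow> 'e \<Rightarrow> 'e) \<Rightarrow> bool" where
  "trace_free W \<longleftrightarrow> (\<forall>Y Z. endo_trace (\<lambda>X. W X Y Z) = 0)"

definition Q_invariant_curvature ::
    "('e::euclidean_space \<Rightarrow>\<^sub>L 'e) set \<Rightarrow> ('e \<Rightarrow> 'e \<Rightarrow> 'e \<Rightarrow> 'e) \<Rightarrow> bool" where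
  "Q_invariant_curvature S W \<longleftrightarrow>
     (\<forall>A\<in>S. \<forall>X Y Z. A (W X Y Z) - W (A X) Y Z - W X (A Y) Z - W X Y (A Z) = 0)"

text \<open>The tensor R0 does not depend on the choice of the triple generating Q.\<close>

definition curvature_decomposes ::
    "nat \<Rightarrow> ('a, 'e::euclidean_space) manifold \<Rightarrow> ('a, 'e) endo_bundle \<Rightarrow> ('a, 'e) metric \<Rightarrow> bool" where
  "curvature_decomposes n M Q g \<longleftrightarrow>
     (\<forall>c\<in>atlas M. \<forall>p\<in>chart_dom c. \<forall>e1 e2 e3 J1 J2 J3.
        para_hypercomplex_triple e1 e2 e3 J1 J2 J3 \<longrightarrow> Q c p = span {J1, J2, J3} \<longrightarrow>
        (\<exists>W. algebraic_curvature (g c p) W \<and> trace_free W \<and> Q_invariant_curvature (Q c p) W \<and>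
           (\<forall>X Y Z. curvature g c p X Y Z =
              reduced_scal n g c p *\<^sub>R R0 (g c p) e1 e2 e3 J1 J2 J3 X Y Z + W X Y Z)))"

definition para_quaternionic_kahler ::
    "nat \<Rightarrow> ('a, 'e::euclidean_space) manifold \<Rightarrow> ('a, 'e) endo_bundle \<Rightarrow> ('a, 'e) metric \<Rightarrow> bool" where
  "para_quaternionic_kahler n M Q g \<longleftrightarrow>
     DIM('e) = 4 * n \<and>
     pseudo_riemannian M g \<and>
     (\<forall>c\<in>atlas M. \<forall>p\<in>chart_dom c. has_signature (g c p) (2 * n) (2 * n)) \<and>
     almost_para_quaternionic M Q \<and>
     (\<forall>c\<in>atlas M. \<forall>p\<in>chart_dom c. \<forall>A\<in>Q c p. \<forall>X Y. g c p (A X) Y = - g c p X (A Y)) \<and>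
     levi_civita_preserves M g Q \<and>
     (n = 1 \<longrightarrow> curvature_decomposes n M Q g)"


section \<open>Submanifolds\<close>

text \<open>
  Immersed submanifolds: a subset with a manifold structure of its own for which the inclusion is
  an immersion. This includes embedded submanifolds.
\<close>

definition submanifold ::
    "('a, 'm::euclidean_space) manifold \<Rightarrow> ('a, 'e::euclidean_space) manifold \<Rightarrow> bool" where
  "submanifold M Mt \<longleftrightarrow>
     smooth_manifold M \<and> smooth_manifold Mt \<and>
     topspace (mtop M) \<subseteq> topspace (mtop Mt) \<and> continuous_map (mtop M) (mtop Mt) id \<and>
     (\<forall>c\<in>atlas M. \<forall>C\<in>atlas Mt.
        smooth_in_chart c (chart_dom c \<inter> chart_dom C) (chart_map C) \<and>
        (\<forall>p\<in>chart_dom c \<inter> chart_dom C. inj (dcoord c C p)))"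

text \<open>The tangent space of the submanifold at p, seen in an ambient chart C.\<close>

definition tangent_subspace ::
    "('a, 'm::euclidean_space) manifold \<Rightarrow> ('a, 'e::euclidean_space) chart \<Rightarrow> 'a \<Rightarrow> 'e set" where
  "tangent_subspace M C p = {dcoord c C p u |c u. c \<in> atlas M \<and> p \<in> chart_dom c}"

definition nondegenerate_submanifold ::
    "('a, 'e::euclidean_space) manifold \<Rightarrow> ('a, 'e) metric \<Rightarrow> ('a, 'm::euclidean_space) manifold \<Rightarrow> bool" where
  "nondegenerate_submanifold Mt gt M \<longleftrightarrow>
     submanifold M Mt \<and>
     (\<forall>C\<in>atlas Mt. \<forall>p\<in>topspace (mtop M) \<inter> chart_dom C.
        nondegenerate_on (gt C p) (tangent_subspace M C p))"

definition induced_metric ::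
    "('a, 'e::euclidean_space) manifold \<Rightarrow> ('a, 'e) metric \<Rightarrow>
     ('a, 'm::euclidean_space) manifold \<Rightarrow> ('a, 'm) metric \<Rightarrow> bool" where
  "induced_metric Mt gt M g \<longleftrightarrow>
     (\<forall>c\<in>atlas M. \<forall>C\<in>atlas Mt. \<forall>p\<in>chart_dom c \<inter> chart_dom C. \<forall>u v.
        g c p u v = gt C p (dcoord c C p u) (dcoord c C p v))"

text \<open>
  J is the restriction to TM of a smooth section Js of Q along M. As a field along M with values
  in endomorphisms of the ambient tangent spaces, Js is expressed in ambient charts C.
\<close>

definition almost_eps_hermitian_submanifold ::
    "real \<Rightarrow> ('a, 'e::euclidean_space) manifold \<Rightarrow> ('a, 'e) endo_bundle \<Rightarrow> ('a, 'e) metric \<Rightarrow>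
     ('a, 'm::euclidean_space) manifold \<Rightarrow> (('a, 'm) chart \<Rightarrow> 'a \<Rightarrow> 'm \<Rightarrow>\<^sub>L 'm) \<Rightarrow> ('a, 'm) metric \<Rightarrow> bool" where
  "almost_eps_hermitian_submanifold eps Mt Q gt M J g \<longleftrightarrow>
     nondegenerate_submanifold Mt gt M \<and> induced_metric Mt gt M g \<and>
     (\<exists>Js :: ('a, 'e) chart \<Rightarrow> 'a \<Rightarrow> 'e \<Rightarrow>\<^sub>L 'e.
        (\<forall>c\<in>atlas M. \<forall>C\<in>atlas Mt. smooth_in_chart c (chart_dom c \<inter> chart_dom C) (Js C)) \<and>
        (\<forall>C\<in>atlas Mt. \<forall>C'\<in>atlas Mt. \<forall>p\<in>topspace (mtop M) \<inter> chart_dom C \<inter> chart_dom C'. \<forall>u.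
           blinfun_apply (Js C' p) (dcoord C C' p u) = dcoord C C' p (blinfun_apply (Js C p) u)) \<and>
        (\<forall>C\<in>atlas Mt. \<forall>p\<in>topspace (mtop M) \<inter> chart_dom C.
           Js C p \<in> Q C p \<and> Js C p o\<^sub>L Js C p = eps *\<^sub>R id_blinfun \<and>
           blinfun_apply (Js C p) ` tangent_subspace M C p = tangent_subspace M C p) \<and>
        (\<forall>c\<in>atlas M. \<forall>C\<in>atlas Mt. \<forall>p\<in>chart_dom c \<inter> chart_dom C. \<forall>u.
           dcoord c C p (J c p u) = blinfun_apply (Js C p) (dcoord c C p u)))"

definition lie_bracket ::
    "('a, 'm::euclidean_space) chart \<Rightarrow> ('a \<Rightarrow> 'm) \<Rightarrow> ('a \<Rightarrow> 'm) \<Rightarrow> 'a \<Rightarrow> 'm" where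
  "lie_bracket c X Y p = coord_deriv c Y p (X p) - coord_deriv c X p (Y p)"

definition nijenhuis ::
    "real \<Rightarrow> ('a, 'm::euclidean_space) chart \<Rightarrow> ('a \<Rightarrow> 'm \<Rightarrow>\<^sub>L 'm) \<Rightarrow> ('a \<Rightarrow> 'm) \<Rightarrow> ('a \<Rightarrow> 'm) \<Rightarrow> 'a \<Rightarrow> 'm" where
  "nijenhuis eps c J X Y p =
     lie_bracket c (\<lambda>q. J q (X q)) (\<lambda>q. J q (Y q)) p
     - J p (lie_bracket c (\<lambda>q. J q (X q)) Y p)
     - J p (lie_bracket c X (\<lambda>q. J q (Y q)) p)
     + eps *\<^sub>R lie_bracket c X Y p"

definition nijenhuis_nonzero_set ::
    "real \<Rightarrow> ('a, 'm::euclidean_space) manifold \<Rightarrow> (('a, 'm) chart \<Rightarrow> 'a \<Rightarrow> 'm \<Rightarrow>\<^sub>L 'm) \<Rightarrow> 'a set" where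
  "nijenhuis_nonzero_set eps M J =
     {p \<in> topspace (mtop M). \<exists>c\<in>atlas M. \<exists>V X Y.
        openin (mtop M) V \<and> p \<in> V \<and> V \<subseteq> chart_dom c \<and>
        smooth_in_chart c V X \<and> smooth_in_chart c V Y \<and> nijenhuis eps c (J c) X Y p \<noteq> 0}"

definition maximal_invariant_subspace :: "('e::euclidean_space \<Rightarrow>\<^sub>L 'e) set \<Rightarrow> 'e set \<Rightarrow> 'e set" where
  "maximal_invariant_subspace S T =
     (GREATEST L. subspace L \<and> L \<subseteq> T \<and> (\<forall>A\<in>S. blinfun_apply A ` L \<subseteq> L))"

definition induced_endo_bundle ::
    "('a, 'e::euclidean_space) manifold \<Rightarrow> ('a, 'e) endo_bundle \<Rightarrow> ('a, 'm::euclidean_space) endo_bundle" where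
  "induced_endo_bundle Mt Q c p =
     {B. \<exists>C\<in>atlas Mt. p \<in> chart_dom C \<and> (\<exists>A\<in>Q C p. \<forall>u. dcoord c C p (blinfun_apply B u) = A (dcoord c C p u))}"

definition para_quaternionic_kahler_submanifold ::
    "nat \<Rightarrow> ('a, 'e::euclidean_space) manifold \<Rightarrow> ('a, 'e) endo_bundle \<Rightarrow> ('a, 'e) metric \<Rightarrow>
     ('a, 'm::euclidean_space) manifold \<Rightarrow> ('a, 'm) metric \<Rightarrow> bool" where
  "para_quaternionic_kahler_submanifold k Mt Q gt M g \<longleftrightarrow>
     nondegenerate_submanifold Mt gt M \<and> induced_metric Mt gt M g \<and>
     (\<forall>C\<in>atlas Mt. \<forall>p\<in>topspace (mtop M) \<inter> chart_dom C. \<forall>A\<in>Q C p.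
        blinfun_apply A ` tangent_subspace M C p \<subseteq> tangent_subspace M C p) \<and>
     para_quaternionic_kahler k M (induced_endo_bundle Mt Q) g"

text \<open>
  The ambient covariant derivative, in the direction X, of the field along M whose expression in
  the chart c of M is the tangent vector field Y.
\<close>

definition ambient_cov_deriv ::
    "('a, 'e::euclidean_space) metric \<Rightarrow> ('a, 'm::euclidean_space) chart \<Rightarrow> ('a, 'e) chart \<Rightarrow>
     ('a \<Rightarrow> 'm) \<Rightarrow> 'a \<Rightarrow> 'm \<Rightarrow> 'e" where
  "ambient_cov_deriv gt c C Y p X =
     coord_deriv c (\<lambda>q. dcoord c C q (Y q)) p X
     + levi_civita gt C p (dcoord c C p X) (dcoord c C p (Y p))"

text \<open>
  By the Gauss formula the second fundamental form vanishes exactly when ambient covariant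
  derivatives of tangent fields in tangent directions are tangent.
\<close>

definition totally_geodesic ::
    "('a, 'e::euclidean_space) manifold \<Rightarrow> ('a, 'e) metric \<Rightarrow> ('a, 'm::euclidean_space) manifold \<Rightarrow> bool" where
  "totally_geodesic Mt gt M \<longleftrightarrow>
     (\<forall>c\<in>atlas M. \<forall>C\<in>atlas Mt. \<forall>V Y.
        openin (mtop M) V \<longrightarrow> V \<subseteq> chart_dom c \<inter> chart_dom C \<longrightarrow> smooth_in_chart c V Y \<longrightarrow>
        (\<forall>p\<in>V. \<forall>X. ambient_cov_deriv gt c C Y p X \<in> tangent_subspace M C p))"

end

theory Submission
  imports Defs
begin

text \<open>
  The idea is to differentiate the relation J D = D j, where D is the differential of the inclusion of M, J the section of the
  bundle Q along M, and j its restriction to the tangent spaces. Because Q is parallel and J squares to a constant, the covariant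
  derivative E X of J is an element of Q that anticommutes with J. The relation then expresses the failure of the second
  fundamental form to be J-linear by E. In the combination that defines the Nijenhuis tensor N of j the second fundamental form
  cancels by symmetry, and one is left with

    F X (D Y) - F Y (D X) = D (N X Y),   where F X = E (j X) - J (E X).

  Thus F does not vanish where N does not vanish, and F X (D Y) - F Y (D X) is tangent for all X and Y. Since F takes values
  in the two-dimensional space of elements of Q that anticommute with J, and is J-equivariant up to sign, this is enough to see that the largest Q-invariant subspace of the tangent space has codimension at most 2 (lemma
  nijenhuis_tensor_forces_invariance). Being nondegenerate, it is an orthogonal sum of copies of the four-dimensional module, so
  its dimension is divisible by 4 (four_dvd_dim_invariant), as is the dimension of M. Hence the tangent space is Q-invariant at
  all points where N is not zero, and by density and continuity everywhere (invariant_by_density).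

  An immersion with Q-invariant tangent spaces is totally geodesic. The second fundamental form commutes with every element of a
  frame of Q, so that applying J1, J2 or J3 = J1 J2 to both arguments multiplies it by e1, e2 and e3; but e3 = - e1 e2
  (hessian_tangent). Consequently the ambient connection restricts to the Levi-Civita connection of M, the restriction of Q is
  parallel, and the ambient curvature restricts to the curvature of M (gauss). The signature is neutral because Q contains an
  involution that is skew for the metric (neutral_signature).

  In dimension 4 the definition of a para-quaternionic Kaehler manifold also demands that the curvature is a multiple of R0 plus
  a trace-free invariant tensor. If the ambient dimension is 4 too, the decomposition is transported by D. Otherwise the ambient
  dimension is at least 8, and there the decomposition is a theorem: a curvature tensor that normalizes Q differs from a multiple
  of R0 by one that commutes with Q (quaternionic_curvature_decomposition), and this difference stays trace-free and invariant
  when it is restricted to M (commuting_curvature).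

  All of this is done in coordinates, on the bare model spaces. A patch is an open set of the model space with the coordinate
  expressions of the metric and of a frame of Q; the passage from manifolds to patches and back occupies the last sections.
\<close>

section \<open>Smooth maps between Euclidean spaces\<close>

text \<open>
  The derivative is kept as an operator-valued map, so that it can itself be differentiated and composed.
\<close>

definition der :: "('e::euclidean_space \<Rightarrow> 'f::real_normed_vector) \<Rightarrow> 'e \<Rightarrow> 'e \<Rightarrow>\<^sub>L 'f" where
  "der f y = Blinfun (frechet_derivative f (at y))"

lemma der_apply:
  assumes "f differentiable (at y)"
  shows "blinfun_apply (der f y) = frechet_derivative f (at y)"
  unfolding der_def using assms
  by (intro bounded_linear_Blinfun_apply) (metis frechet_derivative_works has_derivative_bounded_linear)

lemma der_has_derivative:
  assumes "f differentiable (at y)"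
  shows "(f has_derivative blinfun_apply (der f y)) (at y)"
  using assms by (simp add: der_apply flip: frechet_derivative_works)

lemma frechet_derivative_eqI:
  "(f has_derivative f') (at y) \<Longrightarrow> frechet_derivative f (at y) = f'"
  by (metis frechet_derivative_at)

lemma Ck_on_Suc_imp: "Ck_on (Suc k) S f \<Longrightarrow> Ck_on k S f"
proof (induction k arbitrary: f)
  case 0
  then show ?case
    by (auto simp: continuous_on_eq_continuous_within intro!: continuous_at_imp_continuous_within
        differentiable_imp_continuous_within[where s = UNIV])
next
  case (Suc k)
  then show ?case
    by (metis Ck_on.simps(2))
qed

lemma has_derivative_cong_open:
  assumes "open S" "y \<in> S" "\<And>z. z \<in> S \<Longrightarrow> f z = g z"
  shows "(f has_derivative f') (at y) \<longleftrightarrow> (g has_derivative f') (at y)"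
  using has_derivative_transform_within_open[of _ _ y UNIV S] assms by metis

lemma frechet_derivative_cong_open:
  assumes "open S" "y \<in> S" "\<And>z. z \<in> S \<Longrightarrow> f z = g z"
  shows "frechet_derivative f (at y) = frechet_derivative g (at y)"
  unfolding frechet_derivative_def using has_derivative_cong_open[OF assms] by simp

lemma differentiable_cong_open:
  assumes "open S" "y \<in> S" "\<And>z. z \<in> S \<Longrightarrow> f z = g z"
  shows "f differentiable (at y) \<longleftrightarrow> g differentiable (at y)"
  unfolding differentiable_def using has_derivative_cong_open[OF assms] by simp

lemma der_cong_open:
  assumes "open S" "y \<in> S" "\<And>z. z \<in> S \<Longrightarrow> f z = g z"
  shows "der f y = der g y"
  unfolding der_def using frechet_derivative_cong_open[OF assms] by simp

lemma Ck_on_cong: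
  assumes "open S" "\<And>y. y \<in> S \<Longrightarrow> f y = g y"
  shows "Ck_on k S f \<longleftrightarrow> Ck_on k S g"
  using assms(2)
proof (induction k arbitrary: f g)
  case 0
  then show ?case by (simp cong: continuous_on_cong)
next
  case (Suc k)
  have "Ck_on k S (\<lambda>y. frechet_derivative f (at y) v) \<longleftrightarrow>
        Ck_on k S (\<lambda>y. frechet_derivative g (at y) v)" for v
    using frechet_derivative_cong_open[OF assms(1) _ Suc.prems]
    by (intro Suc.IH) simp
  moreover have "(\<forall>y\<in>S. f differentiable (at y)) \<longleftrightarrow> (\<forall>y\<in>S. g differentiable (at y))"
    using differentiable_cong_open[OF assms(1) _ Suc.prems] by simp
  ultimately show ?case by simp
qed

lemma Ck_on_local:
  assumes "\<And>y. y \<in> S \<Longrightarrow> \<exists>T. open T \<and> y \<in> T \<and> Ck_on k T f"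
  shows "Ck_on k S f"
  using assms
proof (induction k arbitrary: f)
  case 0
  have "isCont f y" if y: "y \<in> S" for y
  proof -
    obtain T where "open T" "y \<in> T" "continuous_on T f" using 0[OF y] by auto
    then show ?thesis by (simp add: continuous_on_eq_continuous_at)
  qed
  then show ?case by (simp add: continuous_at_imp_continuous_on)
next
  case (Suc k)
  have "f differentiable (at y)" if "y \<in> S" for y
    using Suc.prems[OF that] by auto
  moreover have "Ck_on k S (\<lambda>y. frechet_derivative f (at y) v)" for v
    by (rule Suc.IH) (use Suc.prems in fastforce)
  ultimately show ?case by simp
qed

lemma Ck_on_subset: "Ck_on k S f \<Longrightarrow> T \<subseteq> S \<Longrightarrow> Ck_on k T f"
  by (induction k arbitrary: f) (auto intro: continuous_on_subset)

lemma Ck_on_const: "Ck_on k S (\<lambda>y. c)"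
  by (induction k arbitrary: c) auto

lemma Ck_on_linear:
  assumes "bounded_linear L" "open S" "Ck_on k S f"
  shows "Ck_on k S (\<lambda>y. L (f y))"
  using assms(3)
proof (induction k arbitrary: f)
  case 0
  then show ?case using assms(1) by (simp add: bounded_linear.continuous_on)
next
  case (Suc k)
  have d: "((\<lambda>y. L (f y)) has_derivative (\<lambda>v. L (frechet_derivative f (at y) v))) (at y)"
    if "y \<in> S" for y
    using Suc.prems that
    by (intro bounded_linear.has_derivative[OF assms(1)]) (simp add: frechet_derivative_works[symmetric])
  have "Ck_on k S (\<lambda>y. frechet_derivative (\<lambda>y. L (f y)) (at y) v)" for v
    by (subst Ck_on_cong[OF assms(2), where g = "\<lambda>y. L (frechet_derivative f (at y) v)"])
       (use Suc frechet_derivative_eqI[OF d] in auto)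
  with d show ?case by (auto simp: differentiable_def)
qed

lemma Ck_on_add:
  assumes "open S" "Ck_on k S f" "Ck_on k S g"
  shows "Ck_on k S (\<lambda>y. f y + g y)"
  using assms(2,3)
proof (induction k arbitrary: f g)
  case 0
  then show ?case by (simp add: continuous_on_add)
next
  case (Suc k)
  have d: "((\<lambda>y. f y + g y) has_derivative
      (\<lambda>v. frechet_derivative f (at y) v + frechet_derivative g (at y) v)) (at y)"
    if "y \<in> S" for y
    using Suc.prems that
    by (intro has_derivative_add) (simp_all add: frechet_derivative_works[symmetric])
  have "Ck_on k S (\<lambda>y. frechet_derivative (\<lambda>y. f y + g y) (at y) v)" for v
    by (subst Ck_on_cong[OF assms(1),
          where g = "\<lambda>y. frechet_derivative f (at y) v + frechet_derivative g (at y) v"])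
       (use Suc frechet_derivative_eqI[OF d] in auto)
  with d show ?case by (auto simp: differentiable_def)
qed

lemma Ck_on_bilinear:
  assumes "bounded_bilinear p" "open S" "Ck_on k S f" "Ck_on k S g"
  shows "Ck_on k S (\<lambda>y. p (f y) (g y))"
  using assms(3,4)
proof (induction k arbitrary: f g)
  case 0
  then show ?case using bounded_bilinear.continuous_on[OF assms(1)] by auto
next
  case (Suc k)
  have d: "((\<lambda>y. p (f y) (g y)) has_derivative
      (\<lambda>v. p (f y) (frechet_derivative g (at y) v) + p (frechet_derivative f (at y) v) (g y))) (at y)"
    if "y \<in> S" for y
    using Suc.prems that
    by (intro bounded_bilinear.FDERIV[OF assms(1)]) (simp_all add: frechet_derivative_works[symmetric])
  have "Ck_on k S (\<lambda>y. p (f y) (frechet_derivative g (at y) v) + p (frechet_derivative f (at y) v) (g y))" for v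
    using Suc Ck_on_Suc_imp[OF Suc.prems(1)] Ck_on_Suc_imp[OF Suc.prems(2)]
    by (intro Ck_on_add assms(2)) auto
  then have "Ck_on k S (\<lambda>y. frechet_derivative (\<lambda>y. p (f y) (g y)) (at y) v)" for v
    by (subst Ck_on_cong[OF assms(2),
          where g = "\<lambda>y. p (f y) (frechet_derivative g (at y) v) + p (frechet_derivative f (at y) v) (g y)"])
       (use frechet_derivative_eqI[OF d] in auto)
  with d show ?case by (auto simp: differentiable_def)
qed

lemma Ck_on_sum:
  assumes "open S" "finite I" "\<And>i. i \<in> I \<Longrightarrow> Ck_on k S (f i)"
  shows "Ck_on k S (\<lambda>y. \<Sum>i\<in>I. f i y)"
  using assms(2,3) by (induction I) (auto intro: Ck_on_add assms(1) Ck_on_const)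

lift_definition rank_one :: "'a::real_inner \<Rightarrow> 'b::real_normed_vector \<Rightarrow> 'a \<Rightarrow>\<^sub>L 'b"
  is "\<lambda>b w x. (x \<bullet> b) *\<^sub>R w"
  by (intro bounded_linear_intros)

lemma bounded_linear_rank_one:
  fixes b :: "'a::real_inner"
  shows "bounded_linear (rank_one b :: 'b::real_normed_vector \<Rightarrow> 'a \<Rightarrow>\<^sub>L 'b)"
proof (rule bounded_linear_intro[where K = "norm b"])
  show "norm (rank_one b w) \<le> norm w * norm b" for w :: 'b
  proof (rule norm_blinfun_bound)
    fix x
    have "\<bar>x \<bullet> b\<bar> * norm w \<le> norm x * norm b * norm w"
      by (intro mult_right_mono Cauchy_Schwarz_ineq2) auto
    then show "norm (rank_one b w x) \<le> norm w * norm b * norm x"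
      by (simp add: rank_one.rep_eq ac_simps)
  qed auto
qed (auto simp: rank_one.rep_eq blinfun.bilinear_simps algebra_simps intro!: blinfun_eqI)

lemma blinfun_eq_sum_rank_one:
  fixes A :: "'a::euclidean_space \<Rightarrow>\<^sub>L 'b::real_normed_vector"
  shows "A = (\<Sum>b\<in>Basis. rank_one b (A b))"
proof (rule blinfun_eqI)
  fix x :: 'a
  have "A x = A (\<Sum>b\<in>Basis. (x \<bullet> b) *\<^sub>R b)" by (simp add: euclidean_representation)
  then show "A x = (\<Sum>b\<in>Basis. rank_one b (A b)) x"
    by (simp add: blinfun.bilinear_simps rank_one.rep_eq)
qed

text \<open>
  On a Euclidean domain an operator is the finite sum of its rank one parts, so that differentiability of
  operator-valued maps may be checked on constant vectors.
\<close>

lemma Ck_on_blinfunI: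
  fixes F :: "'e::euclidean_space \<Rightarrow> 'a::euclidean_space \<Rightarrow>\<^sub>L 'b::real_normed_vector"
  assumes "open S" "\<And>v. Ck_on k S (\<lambda>y. F y v)"
  shows "Ck_on k S F"
proof -
  have "Ck_on k S (\<lambda>y. \<Sum>b\<in>Basis. rank_one b (F y b))"
    by (intro Ck_on_sum Ck_on_linear[OF bounded_linear_rank_one] assms) auto
  then show ?thesis by (simp flip: blinfun_eq_sum_rank_one)
qed

lemma Ck_on_der:
  assumes "open S" "Ck_on (Suc k) S f"
  shows "Ck_on k S (der f)"
proof (rule Ck_on_blinfunI[OF assms(1)])
  fix v
  show "Ck_on k S (\<lambda>y. der f y v)"
    by (subst Ck_on_cong[OF assms(1), where g = "\<lambda>y. frechet_derivative f (at y) v"])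
       (use assms(2) in \<open>auto simp: der_apply\<close>)
qed

lemma Ck_on_SucI:
  assumes "open S" "\<And>y. y \<in> S \<Longrightarrow> (f has_derivative blinfun_apply (f' y)) (at y)" "Ck_on k S f'"
  shows "Ck_on (Suc k) S f"
proof -
  have "Ck_on k S (\<lambda>y. f' y v)" for v
    by (intro Ck_on_linear[OF blinfun.bounded_linear_left] assms)
  then have "Ck_on k S (\<lambda>y. frechet_derivative f (at y) v)" for v
    by (subst Ck_on_cong[OF assms(1), where g = "\<lambda>y. f' y v"])
       (use frechet_derivative_eqI[OF assms(2)] in auto)
  with assms(2) show ?thesis by (auto simp: differentiable_def)
qed

text \<open>
  Differentiability classes are defined by directional derivatives, so the chain rule is expanded in a basis:
  each coefficient of F' o f is a composition to which the induction hypothesis applies, with target space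
  unchanged.
\<close>

lemma Ck_on_compose:
  fixes f :: "'m::euclidean_space \<Rightarrow> 'e::euclidean_space" and F :: "'e \<Rightarrow> 'f::real_normed_vector"
  assumes "open S" "open T" "f ` S \<subseteq> T" "Ck_on k S f" "Ck_on k T F"
  shows "Ck_on k S (\<lambda>y. F (f y))"
  using assms(4,5)
proof (induction k arbitrary: F)
  case 0
  then show ?case using assms(3) continuous_on_compose2 by force
next
  case (Suc k)
  let ?f' = "\<lambda>y. frechet_derivative f (at y)" and ?F' = "\<lambda>z. frechet_derivative F (at z)"
  have d: "((\<lambda>y. F (f y)) has_derivative (\<lambda>v. ?F' (f y) (?f' y v))) (at y)" if "y \<in> S" for y
  proof -
    have "(f has_derivative ?f' y) (at y)" "(F has_derivative ?F' (f y)) (at (f y))"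
      using Suc.prems that assms(3) by (auto simp: frechet_derivative_works[symmetric])
    then show ?thesis using diff_chain_at[of f "?f' y" y F "?F' (f y)"] by (simp only: o_def)
  qed
  have e: "?F' (f y) (?f' y v) = (\<Sum>b\<in>Basis. (?f' y v \<bullet> b) *\<^sub>R ?F' (f y) b)" if "y \<in> S" for y v
  proof -
    have "linear (?F' (f y))"
      using Suc.prems that assms(3) by (auto intro!: linear_frechet_derivative)
    then have "?F' (f y) (\<Sum>b\<in>Basis. (?f' y v \<bullet> b) *\<^sub>R b) = (\<Sum>b\<in>Basis. (?f' y v \<bullet> b) *\<^sub>R ?F' (f y) b)"
      by (simp only: linear_sum linear_cmul)
    then show ?thesis by (simp only: euclidean_representation)
  qed
  have "Ck_on k S (\<lambda>y. \<Sum>b\<in>Basis. (?f' y v \<bullet> b) *\<^sub>R ?F' (f y) b)" for v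
  proof (intro Ck_on_sum Ck_on_bilinear[OF bounded_bilinear_scaleR] assms(1) finite_Basis)
    show "Ck_on k S (\<lambda>y. ?f' y v \<bullet> b)" for b
      using Suc.prems by (intro Ck_on_linear[OF bounded_linear_inner_left] assms) auto
    show "Ck_on k S (\<lambda>y. ?F' (f y) b)" for b
      using Suc.prems Ck_on_Suc_imp by (intro Suc.IH[of "\<lambda>z. ?F' z b"]) auto
  qed
  then have "Ck_on k S (\<lambda>y. frechet_derivative (\<lambda>y. F (f y)) (at y) v)" for v
    by (subst Ck_on_cong[OF assms(1),
          where g = "\<lambda>y. \<Sum>b\<in>Basis. (?f' y v \<bullet> b) *\<^sub>R ?F' (f y) b"])
       (auto simp: frechet_derivative_eqI[OF d] e)
  with d show ?case by (auto simp: differentiable_def)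
qed

lemma smooth_on_differentiable: "smooth_on S f \<Longrightarrow> y \<in> S \<Longrightarrow> f differentiable (at y)"
  by (auto simp: smooth_on_def dest: spec[of _ "Suc 0"])

lemma smooth_on_has_derivative:
  "smooth_on S f \<Longrightarrow> y \<in> S \<Longrightarrow> (f has_derivative blinfun_apply (der f y)) (at y)"
  by (intro der_has_derivative smooth_on_differentiable)

lemma smooth_on_continuous_on: "smooth_on S f \<Longrightarrow> continuous_on S f"
  by (auto simp: smooth_on_def dest: spec[of _ 0])

lemma smooth_on_cong:
  "open S \<Longrightarrow> (\<And>y. y \<in> S \<Longrightarrow> f y = g y) \<Longrightarrow> smooth_on S f \<longleftrightarrow> smooth_on S g"
  unfolding smooth_on_def using Ck_on_cong[of S f g] by simp

lemma smooth_on_local: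
  "(\<And>y. y \<in> S \<Longrightarrow> \<exists>T. open T \<and> y \<in> T \<and> smooth_on T f) \<Longrightarrow> smooth_on S f"
  unfolding smooth_on_def by (intro allI, rule Ck_on_local) blast

lemma smooth_on_subset: "smooth_on S f \<Longrightarrow> T \<subseteq> S \<Longrightarrow> smooth_on T f"
  unfolding smooth_on_def by (auto intro: Ck_on_subset)

lemma smooth_on_const: "smooth_on S (\<lambda>y. c)"
  by (simp add: smooth_on_def Ck_on_const)

lemma smooth_on_linear:
  "bounded_linear L \<Longrightarrow> open S \<Longrightarrow> smooth_on S f \<Longrightarrow> smooth_on S (\<lambda>y. L (f y))"
  by (simp add: smooth_on_def Ck_on_linear)

lemma smooth_on_add:
  "open S \<Longrightarrow> smooth_on S f \<Longrightarrow> smooth_on S g \<Longrightarrow> smooth_on S (\<lambda>y. f y + g y)"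
  by (simp add: smooth_on_def Ck_on_add)

lemma smooth_on_diff:
  "open S \<Longrightarrow> smooth_on S f \<Longrightarrow> smooth_on S g \<Longrightarrow> smooth_on S (\<lambda>y. f y - g y)"
  using smooth_on_add[of S f "\<lambda>y. - g y"] smooth_on_linear[OF bounded_linear_minus[OF bounded_linear_ident], of S g] by simp

lemma smooth_on_bilinear:
  "bounded_bilinear p \<Longrightarrow> open S \<Longrightarrow> smooth_on S f \<Longrightarrow> smooth_on S g \<Longrightarrow> smooth_on S (\<lambda>y. p (f y) (g y))"
  by (simp add: smooth_on_def Ck_on_bilinear)

lemmas smooth_on_apply = smooth_on_bilinear[OF bounded_bilinear_blinfun_apply]

lemmas smooth_on_blinfun_compose = smooth_on_bilinear[OF bounded_bilinear_blinfun_compose]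

lemma smooth_on_blinfunI:
  fixes F :: "'e::euclidean_space \<Rightarrow> 'a::euclidean_space \<Rightarrow>\<^sub>L 'b::real_normed_vector"
  shows "open S \<Longrightarrow> (\<And>v. smooth_on S (\<lambda>y. F y v)) \<Longrightarrow> smooth_on S F"
  by (simp add: smooth_on_def Ck_on_blinfunI)

lemma smooth_on_der: "open S \<Longrightarrow> smooth_on S f \<Longrightarrow> smooth_on S (der f)"
  unfolding smooth_on_def by (simp add: Ck_on_der del: Ck_on.simps)

lemma smooth_on_compose:
  fixes f :: "'m::euclidean_space \<Rightarrow> 'e::euclidean_space" and F :: "'e \<Rightarrow> 'f::real_normed_vector"
  shows "open S \<Longrightarrow> open T \<Longrightarrow> f ` S \<subseteq> T \<Longrightarrow> smooth_on S f \<Longrightarrow> smooth_on T F \<Longrightarrow>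
    smooth_on S (\<lambda>y. F (f y))"
  by (simp add: smooth_on_def Ck_on_compose)

text \<open>
  The identity H z - H y = - H z (A z - A y) H y first bounds H near y, then makes it continuous, and finally
  gives the derivative - H A' H. This expression is as often differentiable as H itself, so H gains one order
  of differentiability at a time.
\<close>

lemma smooth_on_inverse:
  fixes A :: "'e::euclidean_space \<Rightarrow> 'a::real_normed_vector \<Rightarrow>\<^sub>L 'b::real_normed_vector"
    and H :: "'e \<Rightarrow> 'b \<Rightarrow>\<^sub>L 'a"
  assumes S: "open S" and A: "smooth_on S A"
    and AH: "\<And>y. y \<in> S \<Longrightarrow> A y o\<^sub>L H y = id_blinfun"
    and HA: "\<And>y. y \<in> S \<Longrightarrow> H y o\<^sub>L A y = id_blinfun"
  shows "smooth_on S H"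
proof -
  have eq: "H z - H y = - (H z o\<^sub>L (A z - A y) o\<^sub>L H y)" if "z \<in> S" "y \<in> S" for y z
  proof (rule blinfun_eqI)
    fix v
    have "A y (H y v) = v" "H z (A z (H y v)) = H y v"
      using AH[OF that(2)] HA[OF that(1)] by (metis blinfun_apply_blinfun_compose blinfun_apply_id_blinfun)+
    then show "(H z - H y) v = (- (H z o\<^sub>L (A z - A y) o\<^sub>L H y)) v"
      by (simp add: blinfun.bilinear_simps)
  qed
  have Ac: "continuous_on S A" using A by (rule smooth_on_continuous_on)
  have lim: "(H \<longlongrightarrow> H y) (at y)" if y: "y \<in> S" for y
  proof -
    have At: "((\<lambda>z. norm (A z - A y)) \<longlongrightarrow> 0) (at y)"
      using Ac y S by (metis LIM_zero at_within_open continuous_on_def tendsto_norm_zero)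
    \<comment> \<open>The choice of e makes the factor in front of norm (H z) at most 1/2, so that it can be absorbed.\<close>
    define e where "e = 1 / (2 * (norm (H y) + 1))"
    have e: "e > 0" "e * norm (H y) \<le> 1 / 2"
      by (auto simp: e_def field_simps add_pos_nonneg)
    have S': "\<forall>\<^sub>F z in at y. z \<in> S" using S y by (simp add: eventually_at_in_open')
    have "\<forall>\<^sub>F z in at y. norm (A z - A y) < e"
      using At e(1) by (rule order_tendstoD)
    then have bd: "\<forall>\<^sub>F z in at y. norm (H z - H y) \<le> (2 * norm (H y)) * norm (A z - A y) * norm (H y)"
      using S'
    proof eventually_elim
      case (elim z)
      have h: "norm (H z - H y) \<le> norm (H z) * norm (A z - A y) * norm (H y)"
        unfolding eq[OF elim(2) y] norm_minus_cancel
        by (meson mult_right_mono norm_blinfun_compose norm_ge_zero order_trans)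
      also have "\<dots> \<le> norm (H z) * (e * norm (H y))"
        using elim(1) by (simp add: mult.assoc mult_left_mono mult_right_mono)
      also have "\<dots> \<le> norm (H z) * (1 / 2)"
        using e(2) by (intro mult_left_mono) auto
      finally have "norm (H z) \<le> 2 * norm (H y)"
        using norm_triangle_ineq2[of "H z" "H y"] by simp
      then show ?case using h by (meson mult_right_mono norm_ge_zero order_trans)
    qed
    have "((\<lambda>z. (2 * norm (H y)) * norm (A z - A y) * norm (H y)) \<longlongrightarrow> 0) (at y)"
      using tendsto_mult_left_zero[OF tendsto_mult_right_zero[OF At]] by blast
    then have "((\<lambda>z. norm (H z - H y)) \<longlongrightarrow> 0) (at y)"
      using bd by (auto intro: tendsto_sandwich[OF _ bd tendsto_const])
    then show ?thesis by (simp add: LIM_zero_cancel tendsto_norm_zero_iff)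
  qed
  define L where "L y = (\<lambda>B. - (H y o\<^sub>L B o\<^sub>L H y))" for y
  have blL: "bounded_linear (L y)" for y
    unfolding L_def
    by (intro bounded_linear_minus bounded_linear_compose[OF bounded_bilinear.bounded_linear_left[OF bounded_bilinear_blinfun_compose]]
        bounded_bilinear.bounded_linear_right[OF bounded_bilinear_blinfun_compose])
  define H' where "H' y = Blinfun (\<lambda>v. L y (der A y v))" for y
  have H'_apply: "blinfun_apply (H' y) = (\<lambda>v. L y (der A y v))" for y
    unfolding H'_def
    by (rule bounded_linear_Blinfun_apply, rule bounded_linear_compose[OF blL]) (rule blinfun.bounded_linear_right)
  have dH: "(H has_derivative blinfun_apply (H' y)) (at y)" if y: "y \<in> S" for y
  proof -
    \<comment> \<open>The remainder R is a product of two factors vanishing at y, one of which is differentiable; its derivative is 0.\<close>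
    define R where "R z = (H z - H y) o\<^sub>L (A z - A y) o\<^sub>L H y" for z
    have dA: "(A has_derivative blinfun_apply (der A y)) (at y)"
      by (rule smooth_on_has_derivative[OF A y])
    define q where "q z = norm (A z - A y - der A y (z - y)) / norm (z - y)" for z
    have q: "(q \<longlongrightarrow> 0) (at y)"
      using dA unfolding has_derivative_iff_norm q_def by simp
    have H0: "((\<lambda>z. norm (H z - H y)) \<longlongrightarrow> 0) (at y)"
      using lim[OF y] by (simp add: LIM_zero tendsto_norm_zero)
    have "((\<lambda>z. norm (H z - H y) * (q z + norm (der A y)) * norm (H y)) \<longlongrightarrow> 0 * (0 + norm (der A y)) * norm (H y)) (at y)"
      by (intro tendsto_intros H0 q)
    then have bd: "((\<lambda>z. norm (H z - H y) * (q z + norm (der A y)) * norm (H y)) \<longlongrightarrow> 0) (at y)"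
      by simp
    have Rq: "norm (R z) / norm (z - y) \<le> norm (H z - H y) * (q z + norm (der A y)) * norm (H y)"
      if "z \<noteq> y" for z
    proof -
      have "norm (A z - A y) \<le> norm (A z - A y - der A y (z - y)) + norm (der A y (z - y))"
        by (metis add.commute diff_add_cancel norm_triangle_ineq)
      also have "\<dots> \<le> (q z + norm (der A y)) * norm (z - y)"
        using that norm_blinfun[of "der A y" "z - y"] by (simp add: q_def distrib_right)
      finally have a: "norm (A z - A y) \<le> (q z + norm (der A y)) * norm (z - y)" .
      have "norm (R z) \<le> norm (H z - H y) * norm (A z - A y) * norm (H y)"
        unfolding R_def by (meson mult_right_mono norm_blinfun_compose norm_ge_zero order_trans)
      also have "\<dots> \<le> norm (H z - H y) * ((q z + norm (der A y)) * norm (z - y)) * norm (H y)"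
        using a by (intro mult_right_mono mult_left_mono) auto
      finally show ?thesis using that by (simp add: field_simps)
    qed
    have "((\<lambda>z. norm (R z) / norm (z - y)) \<longlongrightarrow> 0) (at y)"
    proof (rule tendsto_sandwich[OF _ _ tendsto_const bd])
      show "\<forall>\<^sub>F z in at y. 0 \<le> norm (R z) / norm (z - y)" by simp
      show "\<forall>\<^sub>F z in at y. norm (R z) / norm (z - y) \<le> norm (H z - H y) * (q z + norm (der A y)) * norm (H y)"
        using Rq by (auto simp: eventually_at_filter)
    qed
    then have dR: "(R has_derivative (\<lambda>_. 0)) (at y)"
      unfolding has_derivative_iff_norm by (simp add: R_def)
    have dL: "((\<lambda>z. L y (A z)) has_derivative (\<lambda>v. L y (der A y v))) (at y)"
      by (rule bounded_linear.has_derivative[OF blL dA])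
    have "((\<lambda>z. (H y + (L y (A z) - L y (A y))) - R z) has_derivative
        (\<lambda>v. (0 + (L y (der A y v) - 0)) - 0)) (at y)"
      by (intro has_derivative_diff has_derivative_add has_derivative_const dL dR)
    then have "((\<lambda>z. (H y + (L y (A z) - L y (A y))) - R z) has_derivative blinfun_apply (H' y)) (at y)"
      by (simp add: H'_apply)
    moreover have "(H y + (L y (A z) - L y (A y))) - R z = H z" if "z \<in> S" for z
    proof -
      have "H z = H y - (H z o\<^sub>L (A z - A y) o\<^sub>L H y)" using eq[OF that y] by (simp add: algebra_simps)
      also have "\<dots> = (H y + (L y (A z) - L y (A y))) - R z"
        by (rule blinfun_eqI) (simp add: L_def R_def blinfun.bilinear_simps algebra_simps)
      finally show ?thesis by simp
    qed
    ultimately show ?thesis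
      using has_derivative_cong_open[OF S y, of "\<lambda>z. (H y + (L y (A z) - L y (A y))) - R z" H] by blast
  qed
  have "Ck_on k S H" for k
  proof (induction k)
    case 0
    show ?case using lim S by (simp add: continuous_on_def at_within_open[OF _ S])
  next
    case (Suc k)
    show ?case
    proof (rule Ck_on_SucI[OF S dH])
      show "Ck_on k S H'"
      proof (rule Ck_on_blinfunI[OF S])
        fix v
        have "Ck_on k S (\<lambda>y. der A y v)"
          using smooth_on_der[OF S A]
          by (intro Ck_on_linear[OF blinfun.bounded_linear_left] S) (simp add: smooth_on_def)
        then have "Ck_on k S (\<lambda>y. H y o\<^sub>L der A y v o\<^sub>L H y)"
          by (intro Ck_on_bilinear[OF bounded_bilinear_blinfun_compose] S Suc)
        then show "Ck_on k S (\<lambda>y. H' y v)"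
          unfolding H'_apply L_def using Ck_on_linear[OF bounded_linear_minus[OF bounded_linear_ident] S] by blast
      qed
    qed
  qed
  then show ?thesis by (simp add: smooth_on_def)
qed

text \<open>
  The mean value inequality, applied to t |-> F (y + sX + tY) - F (y + tY) corrected by its expected linear
  growth, compares the second difference with the second derivative. The second difference is symmetric in X and
  Y, which gives the symmetry of second derivatives for values in an arbitrary normed space.
\<close>

lemma second_difference_approx:
  fixes F :: "'e::euclidean_space \<Rightarrow> 'f::real_normed_vector"
  assumes S: "open S" and F: "smooth_on S F" and y: "y \<in> S" and e: "e > 0"
  obtains s0 where "s0 > 0"
    "\<And>s. 0 < s \<Longrightarrow> s < s0 \<Longrightarrow>
       norm (F (y + s *\<^sub>R X + s *\<^sub>R Y) - F (y + s *\<^sub>R Y) - F (y + s *\<^sub>R X) + F y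
             - s\<^sup>2 *\<^sub>R der (der F) y X Y) \<le> e * s\<^sup>2"
proof -
  let ?A = "der (der F) y"
  \<comment> \<open>The summand 1 keeps K positive when X = Y = 0.\<close>
  define K where "K = norm X + norm Y + 1"
  have K: "K > 0" "norm X \<le> K" "norm Y \<le> K" "norm X + norm Y \<le> K" by (auto simp: K_def add_nonneg_pos)
  define d where "d = e / (2 * K\<^sup>2)"
  have d: "d > 0" using e K by (simp add: d_def)
  have "(der F has_derivative blinfun_apply ?A) (at y)"
    by (intro smooth_on_has_derivative[OF smooth_on_der[OF S F] y])
  then obtain r where r: "r > 0" "\<And>z. norm (z - y) < r \<Longrightarrow>
      norm (der F z - der F y - ?A (z - y)) \<le> d * norm (z - y)"
    using d unfolding has_derivative_at_alt by metis
  obtain r' where r': "r' > 0" "ball y r' \<subseteq> S" using S y openE by blast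
  define s0 where "s0 = min r r' / K"
  show thesis
  proof
    show "s0 > 0" using r r' K by (simp add: s0_def)
    fix s :: real assume s: "0 < s" "s < s0"
    have sK: "s * K < r" "s * K < r'" using s K by (auto simp: s0_def field_simps)
    have small: "norm (a *\<^sub>R X + b *\<^sub>R Y) \<le> s * K" if "\<bar>a\<bar> \<le> s" "\<bar>b\<bar> \<le> s" for a b
    proof -
      have "norm (a *\<^sub>R X + b *\<^sub>R Y) \<le> \<bar>a\<bar> * norm X + \<bar>b\<bar> * norm Y"
        by (metis norm_scaleR norm_triangle_ineq)
      also have "\<dots> \<le> s * norm X + s * norm Y" using that by (intro add_mono mult_right_mono) auto
      also have "\<dots> \<le> s * K" using K(4) s(1) by (simp flip: distrib_left)
      finally show ?thesis .
    qed
    define u where "u t = F (y + s *\<^sub>R X + t *\<^sub>R Y) - F (y + t *\<^sub>R Y) - (t * s) *\<^sub>R ?A X Y" for t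
    define u' where "u' t = der F (y + s *\<^sub>R X + t *\<^sub>R Y) Y - der F (y + t *\<^sub>R Y) Y - s *\<^sub>R ?A X Y" for t
    have inS: "y + a *\<^sub>R X + b *\<^sub>R Y \<in> S" if "\<bar>a\<bar> \<le> s" "\<bar>b\<bar> \<le> s" for a b
      using small[OF that] sK r' by (intro subsetD[OF r'(2)]) (simp add: dist_norm norm_minus_commute algebra_simps)
    have line: "((\<lambda>t. F (y + a *\<^sub>R X + t *\<^sub>R Y)) has_derivative (\<lambda>h. h *\<^sub>R der F (y + a *\<^sub>R X + t *\<^sub>R Y) Y)) (at t)"
      if "\<bar>a\<bar> \<le> s" "\<bar>t\<bar> \<le> s" for a t
    proof -
      have 1: "((\<lambda>t. y + a *\<^sub>R X + t *\<^sub>R Y) has_derivative (\<lambda>h. h *\<^sub>R Y)) (at t)"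
        by (auto intro!: derivative_eq_intros)
      show ?thesis
        using diff_chain_at[OF 1 smooth_on_has_derivative[OF F inS[OF that]]]
        by (simp add: o_def blinfun.scaleR_right)
    qed
    have du: "(u has_derivative (\<lambda>h. h *\<^sub>R u' t)) (at t within {0..s})" if "t \<in> {0..s}" for t
    proof -
      have t: "\<bar>t\<bar> \<le> s" using that by auto
      have "(u has_derivative (\<lambda>h. h *\<^sub>R der F (y + s *\<^sub>R X + t *\<^sub>R Y) Y
          - h *\<^sub>R der F (y + 0 *\<^sub>R X + t *\<^sub>R Y) Y - (h * s) *\<^sub>R ?A X Y)) (at t)"
        unfolding u_def
        using line[of 0 t] t s
        by (intro has_derivative_diff line) (auto intro!: derivative_eq_intros)
      then have "(u has_derivative (\<lambda>h. h *\<^sub>R u' t)) (at t)"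
        by (simp add: u'_def scaleR_diff_right)
      then show ?thesis by (rule has_derivative_at_withinI)
    qed
    have bd: "norm (u' t) \<le> e * s" if "t \<in> {0..s}" for t
    proof -
      let ?r = "\<lambda>a. der F (y + a *\<^sub>R X + t *\<^sub>R Y) - der F y - ?A (a *\<^sub>R X + t *\<^sub>R Y)"
      have n: "norm (?r a Y) \<le> d * (s * K) * K" if a: "\<bar>a\<bar> \<le> s" for a
      proof -
        have sm: "norm (a *\<^sub>R X + t *\<^sub>R Y) \<le> s * K" using \<open>t \<in> {0..s}\<close> a by (intro small) auto
        have "norm (?r a) \<le> d * norm (a *\<^sub>R X + t *\<^sub>R Y)"
          using r(2)[of "y + a *\<^sub>R X + t *\<^sub>R Y"] sm sK by (simp add: add.assoc)
        also have "\<dots> \<le> d * (s * K)" using sm d by simp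
        finally have "norm (?r a) * norm Y \<le> d * (s * K) * K"
          using K s d by (intro mult_mono) auto
        then show ?thesis using norm_blinfun[of "?r a" Y] by linarith
      qed
      have "u' t = ?r s Y - ?r 0 Y" by (simp add: u'_def blinfun.bilinear_simps)
      then have "norm (u' t) \<le> norm (?r s Y) + norm (?r 0 Y)" by (simp add: norm_triangle_ineq4)
      also have "\<dots> \<le> 2 * (d * (s * K) * K)" using n[of s] n[of 0] s by simp
      also have "\<dots> = e * s" using K by (simp add: d_def power2_eq_square field_simps)
      finally show ?thesis .
    qed
    have "norm (u s - u 0) \<le> (e * s) * norm (s - 0)"
    proof (rule differentiable_bound[OF _ du])
      show "onorm (\<lambda>h. h *\<^sub>R u' t) \<le> e * s" if "t \<in> {0..s}" for t
        using bd[OF that] by (intro onorm_le) (simp add: mult.commute mult_left_mono)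
    qed (use s in auto)
    moreover have "u s - u 0 = F (y + s *\<^sub>R X + s *\<^sub>R Y) - F (y + s *\<^sub>R Y) - F (y + s *\<^sub>R X) + F y
             - s\<^sup>2 *\<^sub>R ?A X Y"
      by (simp add: u_def power2_eq_square)
    ultimately show "norm (F (y + s *\<^sub>R X + s *\<^sub>R Y) - F (y + s *\<^sub>R Y) - F (y + s *\<^sub>R X) + F y
             - s\<^sup>2 *\<^sub>R ?A X Y) \<le> e * s\<^sup>2"
      using s by (simp add: power2_eq_square mult.assoc)
  qed
qed

lemma der_der_symmetric:
  fixes F :: "'e::euclidean_space \<Rightarrow> 'f::real_normed_vector"
  assumes S: "open S" and F: "smooth_on S F" and y: "y \<in> S"
  shows "der (der F) y X Y = der (der F) y Y X"
proof -
  let ?A = "der (der F) y"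
  have "norm (?A X Y - ?A Y X) \<le> 2 * e" if e: "e > 0" for e
  proof -
    let ?D = "\<lambda>s X Y. F (y + s *\<^sub>R X + s *\<^sub>R Y) - F (y + s *\<^sub>R Y) - F (y + s *\<^sub>R X) + F y"
    obtain s1 where s1: "s1 > 0" "\<And>s. 0 < s \<Longrightarrow> s < s1 \<Longrightarrow> norm (?D s X Y - s\<^sup>2 *\<^sub>R ?A X Y) \<le> e * s\<^sup>2"
      using second_difference_approx[OF S F y e, of X Y] by blast
    obtain s2 where s2: "s2 > 0" "\<And>s. 0 < s \<Longrightarrow> s < s2 \<Longrightarrow> norm (?D s Y X - s\<^sup>2 *\<^sub>R ?A Y X) \<le> e * s\<^sup>2"
      using second_difference_approx[OF S F y e, of Y X] by blast
    define s where "s = min s1 s2 / 2"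
    have s: "s > 0" "s < s1" "s < s2" using s1(1) s2(1) by (auto simp: s_def)
    have "?D s Y X = ?D s X Y" by (simp add: algebra_simps)
    then have "s\<^sup>2 *\<^sub>R (?A X Y - ?A Y X) = (?D s Y X - s\<^sup>2 *\<^sub>R ?A Y X) - (?D s X Y - s\<^sup>2 *\<^sub>R ?A X Y)"
      by (simp add: scaleR_diff_right)
    then have "norm (s\<^sup>2 *\<^sub>R (?A X Y - ?A Y X)) \<le> norm (?D s Y X - s\<^sup>2 *\<^sub>R ?A Y X) + norm (?D s X Y - s\<^sup>2 *\<^sub>R ?A X Y)"
      by (simp only: norm_triangle_ineq4)
    also have "\<dots> \<le> e * s\<^sup>2 + e * s\<^sup>2" using add_mono[OF s2(2)[OF s(1,3)] s1(2)[OF s(1,2)]] .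
    finally have "s\<^sup>2 * norm (?A X Y - ?A Y X) \<le> s\<^sup>2 * (2 * e)"
      by (simp only: norm_scaleR) (simp add: field_simps)
    then show ?thesis using s(1) by simp
  qed
  from this[of "r / 2" for r] have "norm (?A X Y - ?A Y X) \<le> 0"
    by - (rule field_le_epsilon, simp)
  then show ?thesis by simp
qed

section \<open>Traces and para-hypercomplex triples\<close>

lemma endo_trace_add: "endo_trace (\<lambda>x. f x + g x) = endo_trace f + endo_trace g"
  by (simp add: endo_trace_def inner_add_left sum.distrib)

lemma endo_trace_diff: "endo_trace (\<lambda>x. f x - g x) = endo_trace f - endo_trace g"
  by (simp add: endo_trace_def inner_diff_left sum_subtractf)

lemma endo_trace_minus: "endo_trace (\<lambda>x. - f x) = - endo_trace f"
  by (simp add: endo_trace_def sum_negf)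

lemma endo_trace_scaleR: "endo_trace (\<lambda>x. c *\<^sub>R f x) = c * endo_trace f"
  by (simp add: endo_trace_def sum_distrib_left)

lemma endo_trace_id: "endo_trace (\<lambda>x::'e::euclidean_space. x) = DIM('e)"
  by (simp add: endo_trace_def)

lemma linear_basis_sum:
  assumes "linear f"
  shows "f x = (\<Sum>b\<in>Basis. (x \<bullet> b) *\<^sub>R f b)"
proof -
  have "f (\<Sum>b\<in>Basis. (x \<bullet> b) *\<^sub>R b) = (\<Sum>b\<in>Basis. (x \<bullet> b) *\<^sub>R f b)"
    using assms by (simp only: linear_sum linear_cmul)
  then show ?thesis by (simp only: euclidean_representation)
qed

lemma endo_trace_rank_one:
  fixes v :: "'e::euclidean_space"
  assumes "linear \<phi>"
  shows "endo_trace (\<lambda>x. \<phi> x *\<^sub>R v) = \<phi> v"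
proof -
  have "endo_trace (\<lambda>x. \<phi> x *\<^sub>R v) = (\<Sum>b\<in>Basis. (v \<bullet> b) *\<^sub>R \<phi> b)"
    by (simp add: endo_trace_def mult.commute)
  then show ?thesis by (simp only: linear_basis_sum[OF assms, symmetric])
qed

text \<open>
  Both sides are the same double sum of matrix entries; the two spaces may have different dimensions.
\<close>

lemma endo_trace_commute:
  fixes f :: "'a::euclidean_space \<Rightarrow> 'b::euclidean_space" and h :: "'b \<Rightarrow> 'a"
  assumes "linear f" "linear h"
  shows "endo_trace (\<lambda>x. f (h x)) = endo_trace (\<lambda>x. h (f x))"
proof -
  have "endo_trace (\<lambda>x. f (h x)) = (\<Sum>b\<in>Basis. \<Sum>c\<in>Basis. (h b \<bullet> c) * (f c \<bullet> b))"
    unfolding endo_trace_def by (subst linear_basis_sum[OF assms(1)]) (simp add: inner_sum_left)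
  also have "\<dots> = (\<Sum>c\<in>Basis. \<Sum>b\<in>Basis. (f c \<bullet> b) * (h b \<bullet> c))"
    by (subst sum.swap) (simp add: mult.commute)
  also have "\<dots> = endo_trace (\<lambda>x. h (f x))"
    unfolding endo_trace_def by (subst linear_basis_sum[OF assms(2)]) (simp add: inner_sum_left)
  finally show ?thesis .
qed

text \<open>
  The operator representing the form B with respect to the Euclidean inner product.
\<close>

definition gram :: "('e::euclidean_space \<Rightarrow>\<^sub>L 'e \<Rightarrow>\<^sub>L real) \<Rightarrow> 'e \<Rightarrow> 'e" where
  "gram B u = (\<Sum>b\<in>Basis. B u b *\<^sub>R b)"

lemma linear_gram: "linear (gram B)"
  by (rule linearI) (simp_all add: gram_def blinfun.bilinear_simps scaleR_add_left sum.distrib scaleR_sum_right)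

lemma inner_gram: "gram B u \<bullet> v = B u v"
proof -
  have "linear (B u)" by (simp add: bounded_linear.linear blinfun.bounded_linear_right)
  note e = linear_basis_sum[OF this, of v]
  have "gram B u \<bullet> v = (\<Sum>b\<in>Basis. (v \<bullet> b) *\<^sub>R B u b)"
    by (simp add: gram_def inner_sum_left) (simp add: inner_commute mult.commute)
  then show ?thesis by (simp only: e)
qed

lemma bij_gram:
  assumes "nondegenerate_on B UNIV"
  shows "bij (gram B)"
proof -
  have "inj (gram B)"
    using assms unfolding linear_injective_0[OF linear_gram] nondegenerate_on_def
    by (metis UNIV_I inner_gram inner_zero_left)
  then show ?thesis
    using linear_injective_imp_surjective[OF linear_gram] by (simp add: bij_def)
qed

text \<open>
  Conjugation with the Gram operator turns the B-adjoint into the Euclidean adjoint, and neither step changes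
  the trace.
\<close>

lemma endo_trace_adjoint:
  assumes nd: "nondegenerate_on B UNIV" and sym: "\<And>u v. B u v = B v u"
    and lin: "linear M" and adj: "\<And>u v. B (M u) v = B u (M' v)"
  shows "endo_trace M = endo_trace M'"
proof -
  define H where "H = inv (gram B)"
  have GH: "gram B (H x) = x" and HG: "H (gram B x) = x" for x
    using bij_gram[OF nd] by (simp_all add: H_def surj_f_inv_f bij_is_surj bij_is_inj)
  have linH: "linear H"
    unfolding H_def by (rule inj_linear_imp_inv_linear[OF linear_gram bij_is_inj[OF bij_gram[OF nd]]])
  have *: "gram B (M (H u)) \<bullet> v = u \<bullet> M' v" for u v
    by (metis GH adj inner_gram)
  have "endo_trace M = endo_trace (\<lambda>x. (M \<circ> H) (gram B x))" by (simp add: HG)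
  also have "\<dots> = endo_trace (\<lambda>x. gram B ((M \<circ> H) x))"
    by (intro endo_trace_commute linear_gram linear_compose linH lin)
  also have "\<dots> = endo_trace M'"
    by (simp add: endo_trace_def *) (simp add: inner_commute)
  finally show ?thesis .
qed

lemma para_hypercomplex_triple_signs:
  assumes "para_hypercomplex_triple e1 e2 e3 J1 J2 J3"
  shows "e1 * e1 = 1" "e2 * e2 = 1" "e3 * e3 = 1" "e3 = - e1 * e2"
  using assms by (auto simp: para_hypercomplex_triple_def para_quaternionic_signs_def)

lemma para_hypercomplex_triple_table:
  assumes "para_hypercomplex_triple e1 e2 e3 J1 J2 J3"
  shows "J1 (J1 x) = e1 *\<^sub>R x" "J2 (J2 x) = e2 *\<^sub>R x" "J3 (J3 x) = e3 *\<^sub>R x"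
    "J1 (J2 x) = J3 x" "J2 (J1 x) = - J3 x"
    "J1 (J3 x) = e1 *\<^sub>R J2 x" "J3 (J1 x) = - (e1 *\<^sub>R J2 x)"
    "J2 (J3 x) = - (e2 *\<^sub>R J1 x)" "J3 (J2 x) = e2 *\<^sub>R J1 x"
proof -
  note * = assms[unfolded para_hypercomplex_triple_def]
  have ap: "A (B x) = C x" if "A o\<^sub>L B = C" for A B C :: "'a \<Rightarrow>\<^sub>L 'a" and x
    using that by (metis blinfun_apply_blinfun_compose)
  show 1: "J1 (J1 x) = e1 *\<^sub>R x" and 2: "J2 (J2 x) = e2 *\<^sub>R x" and 3: "J3 (J3 x) = e3 *\<^sub>R x" for x
    using ap[of J1 J1 "e1 *\<^sub>R id_blinfun" x] ap[of J2 J2 "e2 *\<^sub>R id_blinfun" x] ap[of J3 J3 "e3 *\<^sub>R id_blinfun" x] *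
    by (metis blinfun.scaleR_left blinfun_apply_id_blinfun)+
  show 4: "J1 (J2 x) = J3 x" for x
  proof -
    have "J1 o\<^sub>L J2 = J3" using * by metis
    from ap[OF this] show ?thesis .
  qed
  have 5: "J2 (J1 x) = - J3 x" for x
  proof -
    have "J1 o\<^sub>L J2 = - (J2 o\<^sub>L J1)" using * by blast
    from ap[OF this, of x] have "J1 (J2 x) = - J2 (J1 x)"
      by (simp only: blinfun.minus_left blinfun_apply_blinfun_compose)
    then show ?thesis using 4[of x] by (metis add.inverse_inverse)
  qed
  show "J2 (J1 x) = - J3 x" by (rule 5)
  show "J1 (J3 x) = e1 *\<^sub>R J2 x" by (metis 1 4)
  show "J3 (J1 x) = - (e1 *\<^sub>R J2 x)" by (metis 1 4 5 blinfun.minus_right)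
  show "J2 (J3 x) = - (e2 *\<^sub>R J1 x)" by (metis 2 5 4 blinfun.minus_right add.inverse_inverse)
  show "J3 (J2 x) = e2 *\<^sub>R J1 x" by (metis 2 4 blinfun.scaleR_right)
qed

lemma vector_eq_inner: "(\<And>b. x \<bullet> b = y \<bullet> b) \<Longrightarrow> x = (y :: 'e::real_inner)"
  by (metis vector_eq_ldot inner_commute)

text \<open>
  Averaging a linear combination over conjugation with 1, J, K and JK leaves only its scalar part. Multiplying
  by J, K or JK moves each coefficient into that position.
\<close>

lemma quaternion_independent:
  fixes J K :: "'e::euclidean_space \<Rightarrow>\<^sub>L 'e"
  assumes JJ: "\<And>x. J (J x) = e *\<^sub>R x" and KK: "\<And>x. K (K x) = d *\<^sub>R x"
    and KJ: "\<And>x. K (J x) = - J (K x)" and ed: "e \<noteq> 0" "d \<noteq> 0"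
    and 0: "\<And>x. a *\<^sub>R x + b *\<^sub>R J x + c *\<^sub>R K x + f *\<^sub>R J (K x) = 0"
  shows "a = 0 \<and> b = 0 \<and> c = 0 \<and> f = 0"
proof -
  obtain x :: 'e where x: "x \<noteq> 0" by (metis SOME_Basis nonzero_Basis)
  note s = JJ KK KJ blinfun.bilinear_simps
  have a0: "a = 0" if 0: "\<And>x. a *\<^sub>R x + b *\<^sub>R J x + c *\<^sub>R K x + f *\<^sub>R J (K x) = 0" for a b c f
  proof -
    let ?X = "\<lambda>x. a *\<^sub>R x + b *\<^sub>R J x + c *\<^sub>R K x + f *\<^sub>R J (K x)"
    let ?L = "(e * d) *\<^sub>R ?X x + d *\<^sub>R J (?X (J x)) + e *\<^sub>R K (?X (K x)) - J (K (?X (J (K x))))"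
    have "?L = 0"
      by (simp only: 0 blinfun.zero_right) simp
    moreover have "?L = (4 * (e * d) * a) *\<^sub>R x"
      by (rule vector_eq_inner) (simp add: s inner_simps algebra_simps)
    ultimately show "a = 0" using x ed by simp
  qed
  have 1: "(b * e) *\<^sub>R x + a *\<^sub>R J x + (- (f * e)) *\<^sub>R K x + (- c) *\<^sub>R J (K x) = 0" for x
    using 0[of "J x"] by (simp add: s algebra_simps)
  have 2: "(c * d) *\<^sub>R x + (f * d) *\<^sub>R J x + a *\<^sub>R K x + b *\<^sub>R J (K x) = 0" for x
    using 0[of "K x"] by (simp add: s algebra_simps)
  have 3: "(- (f * (e * d))) *\<^sub>R x + (- (c * d)) *\<^sub>R J x + (b * e) *\<^sub>R K x + a *\<^sub>R J (K x) = 0" for x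
    using 0[of "J (K x)"] by (simp add: s algebra_simps)
  show ?thesis
    using a0[OF 0] a0[OF 1] a0[OF 2] a0[OF 3] ed by auto
qed

lemma triple_linear_independent:
  fixes J1 J2 J3 :: "'e::euclidean_space \<Rightarrow>\<^sub>L 'e"
  assumes t: "para_hypercomplex_triple e1 e2 e3 J1 J2 J3"
    and 0: "\<And>x. a *\<^sub>R x + b *\<^sub>R J1 x + c *\<^sub>R J2 x + d *\<^sub>R J3 x = 0"
  shows "a = 0 \<and> b = 0 \<and> c = 0 \<and> d = 0"
proof (rule quaternion_independent)
  note T = para_hypercomplex_triple_table[OF t]
  show "J1 (J1 x) = e1 *\<^sub>R x" "J2 (J2 x) = e2 *\<^sub>R x" "J2 (J1 x) = - J1 (J2 x)" for x
    by (simp_all add: T)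
  show "e1 \<noteq> 0" "e2 \<noteq> 0" using para_hypercomplex_triple_signs[OF t] by auto
  show "a *\<^sub>R x + b *\<^sub>R J1 x + c *\<^sub>R J2 x + d *\<^sub>R J1 (J2 x) = 0" for x
    using 0[of x] by (simp add: T)
qed

section \<open>Curvature tensors that normalize a para-quaternionic structure\<close>

text \<open>
  The octahedron argument: the four cyclic sums that omit one of the arguments in turn.
\<close>

lemma algebraic_curvature_pair_symmetric:
  assumes R: "algebraic_curvature B R" and sym: "\<And>u v. B u v = B v u"
  shows "B (R X Y Z) V = B (R Z V X) Y"
proof -
  have a: "B (R X Y Z) V = - B (R Y X Z) V" for X Y Z V
    using R unfolding algebraic_curvature_def by (metis blinfun.minus_left blinfun.minus_right)
  have b: "B (R X Y Z) V = - B (R X Y V) Z" for X Y Z V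
    using R sym unfolding algebraic_curvature_def by metis
  have c: "B (R X Y Z) V + B (R Y Z X) V + B (R Z X Y) V = 0" for X Y Z V
    using R unfolding algebraic_curvature_def
    by (metis blinfun.add_left blinfun.add_right blinfun.zero_left blinfun.zero_right)
  show ?thesis
    using c[of X Y Z V] c[of Y Z V X] c[of Z V X Y] c[of V X Y Z]
      b[of Y Z V X] b[of Z V Y X] b[of X Y V Z] b[of V X Z Y]
      a[of X Z V Y] b[of Z X V Y] a[of V Y Z X] b[of Y V Z X]
    by linarith
qed

lemma diff_eq_add_imp_eq: "a - b = c + d \<Longrightarrow> b = a - c - (d :: 'a::ab_group_add)"
  by (metis add_diff_cancel_left' diff_add_cancel diff_diff_eq)

lemma add3_eq_0_imp_eq: "a + b + c = 0 \<Longrightarrow> a = - b - (c :: 'a::ab_group_add)"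
  by (simp add: eq_diff_eq eq_neg_iff_add_eq_0 ac_simps)

text \<open>
  The trace of J R(X,Y) is computed by the first Bianchi identity from G X Y, the trace of V |-> J R(V,X) Y. This G
  is skew because the adjoint of V |-> J R(V,X) Y is V |-> - R(JV,Y) X by pair symmetry; moving J through R
  expresses G by the Ricci tensor and the commutator.
\<close>

lemma trace_J_curvature:
  fixes B :: "'e::euclidean_space \<Rightarrow>\<^sub>L 'e \<Rightarrow>\<^sub>L real" and J :: "'e \<Rightarrow>\<^sub>L 'e"
  assumes nd: "nondegenerate_on B UNIV" and sym: "\<And>u v. B u v = B v u"
    and R: "algebraic_curvature B R" and skew: "\<And>u v. B (J u) v = - B u (J v)"
    and comm: "\<And>X Y Z. R X Y (J Z) - J (R X Y Z) = u X Y *\<^sub>R K Z + v X Y *\<^sub>R L Z"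
    and lin: "\<And>Y. linear (\<lambda>X. u X Y)" "\<And>Y. linear (\<lambda>X. v X Y)"
  shows "endo_trace (\<lambda>Z. J (R X Y Z))
     = - 2 * (endo_trace (\<lambda>V. R V X (J Y)) - u (K Y) X - v (L Y) X)"
proof -
  define G where "G X Y = endo_trace (\<lambda>V. J (R V X Y))" for X Y
  have Rlin: "linear (\<lambda>V. R V X Y)" for X Y using R unfolding algebraic_curvature_def by blast
  have linJ: "linear J" by (simp add: bounded_linear.linear blinfun.bounded_linear_right)
  have "J (R V X Y) = R V X (J Y) - u V X *\<^sub>R K Y - v V X *\<^sub>R L Y" for V X Y
    by (rule diff_eq_add_imp_eq[OF comm])
  then have 1: "G X Y = endo_trace (\<lambda>V. R V X (J Y)) - u (K Y) X - v (L Y) X" for X Y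
    by (simp add: G_def endo_trace_diff endo_trace_rank_one lin)
  have 2: "G X Y = - G Y X" for X Y
  proof -
    have "B (J (R V X Y)) V' = B V (- R (J V') Y X)" for V V'
    proof -
      have "B (J (R V X Y)) V' = - B (R V X Y) (J V')" by (rule skew)
      also have "B (R V X Y) (J V') = B (R Y (J V') V) X"
        by (rule algebraic_curvature_pair_symmetric[OF R sym])
      also have "\<dots> = - B V (R Y (J V') X)"
        using R unfolding algebraic_curvature_def by blast
      also have "R Y (J V') X = - R (J V') Y X"
        using R unfolding algebraic_curvature_def by blast
      finally show ?thesis by simp
    qed
    then have "G X Y = endo_trace (\<lambda>V. - R (J V) Y X)"
      unfolding G_def using linear_compose[OF Rlin linJ]
      by (intro endo_trace_adjoint[OF nd sym]) (simp_all add: o_def)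
    also have "\<dots> = - endo_trace (\<lambda>V. R (J V) Y X)" by (rule endo_trace_minus)
    also have "endo_trace (\<lambda>V. R (J V) Y X) = G Y X"
      unfolding G_def by (rule endo_trace_commute[OF Rlin linJ])
    finally show ?thesis .
  qed
  have "J (R X Y V) = J (R V Y X) - J (R V X Y)" for V
  proof -
    have "R X Y V = - R Y V X - R V X Y"
      by (rule add3_eq_0_imp_eq) (use R in \<open>unfold algebraic_curvature_def, blast\<close>)
    moreover have "R Y V X = - R V Y X" using R unfolding algebraic_curvature_def by blast
    ultimately show ?thesis by (simp add: blinfun.diff_right)
  qed
  then have "endo_trace (\<lambda>Z. J (R X Y Z)) = G Y X - G X Y"
    by (simp add: G_def endo_trace_diff)
  then show ?thesis using 1[of X Y] 2[of X Y] by simp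
qed

text \<open>
  The defect of J-invariance of R in its last two arguments is B (C X Y Z) (J V). Evaluating R on four arguments
  transformed by J in two ways, and comparing with the pair symmetry, exchanges the two pairs of arguments in the
  defect.
\<close>

lemma defect_symmetric:
  fixes B :: "'e::euclidean_space \<Rightarrow>\<^sub>L 'e \<Rightarrow>\<^sub>L real" and J :: "'e \<Rightarrow>\<^sub>L 'e"
  assumes sym: "\<And>u v. B u v = B v u" and R: "algebraic_curvature B R"
    and skew: "\<And>u v. B (J u) v = - B u (J v)" and JJ: "\<And>u. J (J u) = e *\<^sub>R u" and e: "e * e = 1"
    and comm: "\<And>X Y Z. R X Y (J Z) - J (R X Y Z) = C X Y Z"
    and inv: "\<And>X Y Z V. B (C (J X) (J Y) Z) (J V) = e * B (C X Y Z) (J V)"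
  shows "B (C X Y Z) (J V) = B (C Z V X) (J Y)"
proof -
  note ps = algebraic_curvature_pair_symmetric[OF R sym]
  have 1: "B (R X Y (J Z)) (J V) = B (C X Y Z) (J V) - e * B (R X Y Z) V" for X Y Z V
  proof -
    have "R X Y (J Z) = C X Y Z + J (R X Y Z)" using comm[of X Y Z, symmetric] by simp
    moreover have "B (J (R X Y Z)) (J V) = - e * B (R X Y Z) V"
      by (simp add: skew JJ blinfun.scaleR_right)
    ultimately show ?thesis by (simp add: blinfun.add_left blinfun.add_right)
  qed
  have 2: "B (R (J X) (J Y) (J Z)) (J V) = e * B (C X Y Z) (J V) - e * B (C Z V X) (J Y) + B (R Z V X) Y" for X Y Z V
  proof -
    have "B (R (J X) (J Y) Z) V = B (C Z V X) (J Y) - e * B (R Z V X) Y"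
      using ps[of "J X" "J Y" Z V] unfolding 1 .
    then have "B (R (J X) (J Y) (J Z)) (J V)
        = e * B (C X Y Z) (J V) - e * (B (C Z V X) (J Y) - e * B (R Z V X) Y)"
      using 1[of "J X" "J Y" Z V] inv[of X Y Z V] by (simp only:)
    also have "\<dots> = e * B (C X Y Z) (J V) - e * B (C Z V X) (J Y) + (e * e) * B (R Z V X) Y"
      by (simp only: right_diff_distrib mult.assoc)
    finally show ?thesis using e by (simp only: mult_1_left)
  qed
  have "e * B (C X Y Z) (J V) - e * B (C Z V X) (J Y) = e * B (C Z V X) (J Y) - e * B (C X Y Z) (J V)"
  proof -
    have "e * B (C X Y Z) (J V) - e * B (C Z V X) (J Y) + B (R Z V X) Y
      = e * B (C Z V X) (J Y) - e * B (C X Y Z) (J V) + B (R Z V X) Y"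
      using ps[of "J X" "J Y" "J Z" "J V"] unfolding 2 ps[of X Y Z V] .
    then show ?thesis by (rule add_right_imp_eq)
  qed
  then have "e * B (C X Y Z) (J V) = e * B (C Z V X) (J Y)" by simp
  then have "(e * e) * B (C X Y Z) (J V) = (e * e) * B (C Z V X) (J Y)" by (simp only: mult.assoc)
  then show ?thesis using e by (simp only: mult_1_left)
qed

text \<open>
  A tangent space of a para-quaternionic Kaehler manifold with an adapted frame of its bundle.
\<close>

locale skew_triple =
  fixes B :: "'e::euclidean_space \<Rightarrow>\<^sub>L 'e \<Rightarrow>\<^sub>L real"
    and e1 e2 e3 :: real and J1 J2 J3 :: "'e \<Rightarrow>\<^sub>L 'e"
  assumes sym: "\<And>u v. B u v = B v u" and nondeg: "nondegenerate_on B UNIV"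
    and triple: "para_hypercomplex_triple e1 e2 e3 J1 J2 J3"
    and skew: "\<And>u v. B (J1 u) v = - B u (J1 v)" "\<And>u v. B (J2 u) v = - B u (J2 v)"
      "\<And>u v. B (J3 u) v = - B u (J3 v)"
begin

abbreviation "R0' \<equiv> R0 B e1 e2 e3 J1 J2 J3"

lemmas table = para_hypercomplex_triple_table[OF triple]

lemmas signs = para_hypercomplex_triple_signs[OF triple]

lemma skew_right: "B u (J1 v) = - B (J1 u) v" "B u (J2 v) = - B (J2 u) v" "B u (J3 v) = - B (J3 u) v"
  by (simp_all add: skew)

lemma skew_swap: "B (J1 u) v = - B (J1 v) u" "B (J2 u) v = - B (J2 v) u" "B (J3 u) v = - B (J3 v) u"
  using skew sym by metis+

lemma sign_cases:
  obtains "e1 = -1" "e2 = 1" "e3 = 1" | "e1 = 1" "e2 = -1" "e3 = 1" | "e1 = 1" "e2 = 1" "e3 = -1"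
  using triple by (auto simp: para_hypercomplex_triple_def para_quaternionic_signs_def)

text \<open>
  The wedge part of R0 commutes with the triple; only the first part contributes.
\<close>

lemma R0_commutator:
  "R0' X Y (J1 Z) - J1 (R0' X Y Z)
     = (- e2 * B (J2 X) Y) *\<^sub>R J3 Z + (- e1 * e3 * B (J3 X) Y) *\<^sub>R J2 Z"
  "R0' X Y (J2 Z) - J2 (R0' X Y Z)
     = (e1 * B (J1 X) Y) *\<^sub>R J3 Z + (e2 * e3 * B (J3 X) Y) *\<^sub>R J1 Z"
  "R0' X Y (J3 Z) - J3 (R0' X Y Z)
     = B (J1 X) Y *\<^sub>R J2 Z + (- B (J2 X) Y) *\<^sub>R J1 Z"
proof -
  note s = R0_def wedge_endo_def table skew_right blinfun.bilinear_simps inner_simps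
  show "R0' X Y (J1 Z) - J1 (R0' X Y Z)
     = (- e2 * B (J2 X) Y) *\<^sub>R J3 Z + (- e1 * e3 * B (J3 X) Y) *\<^sub>R J2 Z"
    by (cases rule: sign_cases; rule vector_eq_inner; simp add: s field_simps)
  show "R0' X Y (J2 Z) - J2 (R0' X Y Z)
     = (e1 * B (J1 X) Y) *\<^sub>R J3 Z + (e2 * e3 * B (J3 X) Y) *\<^sub>R J1 Z"
    by (cases rule: sign_cases; rule vector_eq_inner; simp add: s field_simps)
  show "R0' X Y (J3 Z) - J3 (R0' X Y Z)
     = B (J1 X) Y *\<^sub>R J2 Z + (- B (J2 X) Y) *\<^sub>R J1 Z"
    by (cases rule: sign_cases; rule vector_eq_inner; simp add: s field_simps)
qed

lemma R0_linear: "linear (\<lambda>X. R0' X Y Z)" "linear (\<lambda>Y. R0' X Y Z)" "linear (\<lambda>Z. R0' X Y Z)"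
  by (rule linearI; rule vector_eq_inner; simp add: R0_def wedge_endo_def blinfun.bilinear_simps inner_simps field_simps)+

lemma R0_antisym: "R0' X Y Z = - R0' Y X Z"
  by (rule vector_eq_inner; simp add: R0_def wedge_endo_def blinfun.bilinear_simps inner_simps skew_swap[of Y X] field_simps)

lemma R0_skew: "B (R0' X Y Z) V = - B Z (R0' X Y V)"
proof -
  have "B Z (R0' X Y V) = B (R0' X Y V) Z" by (rule sym)
  moreover have "B (R0' X Y Z) V = - B (R0' X Y V) Z"
    using skew_swap[of V Z]
    by (simp add: R0_def wedge_endo_def blinfun.bilinear_simps field_simps)
  ultimately show ?thesis by simp
qed

lemma R0_bianchi: "R0' X Y Z + R0' Y Z X + R0' Z X Y = 0"
  by (rule vector_eq_inner)
     (simp add: R0_def wedge_endo_def blinfun.bilinear_simps inner_simps skew_swap[of Z X]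
        skew_swap[of Y X] skew_swap[of Z Y] sym[of Z X] sym[of Y X] sym[of Z Y] field_simps)

lemma R0_algebraic_curvature: "algebraic_curvature B R0'"
  unfolding algebraic_curvature_def
  using R0_linear R0_antisym R0_skew R0_bianchi by blast

lemma linear_J: "linear (blinfun_apply (J :: 'e \<Rightarrow>\<^sub>L 'e))"
  by (simp add: bounded_linear.linear blinfun.bounded_linear_right)

text \<open>
  Conjugation with C changes the sign of A and preserves the trace.
\<close>

lemma endo_trace_anticommuting:
  fixes A :: "'e \<Rightarrow> 'e" and C :: "'e \<Rightarrow>\<^sub>L 'e"
  assumes "linear A" "\<And>x. C (C x) = e *\<^sub>R x" "e \<noteq> 0" "\<And>x. A (C x) = - C (A x)"
  shows "endo_trace A = 0"
proof -
  have "endo_trace (\<lambda>x. C (A (C x))) = endo_trace (\<lambda>x. A (C (C x)))"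
    using endo_trace_commute[OF linear_J[of C] linear_compose[OF linear_J[of C] assms(1)]] by (simp only: o_def)
  moreover have "C (A (C x)) = (- e) *\<^sub>R A x" for x
    by (simp only: assms(4) blinfun.minus_right assms(2) scaleR_minus_left)
  moreover have "A (C (C x)) = e *\<^sub>R A x" for x
    by (simp only: assms(2) linear_cmul[OF assms(1)])
  ultimately have "- e * endo_trace A = e * endo_trace A" by (simp only: endo_trace_scaleR)
  with assms(3) show ?thesis by simp
qed

lemma endo_trace_frame:
  "endo_trace J1 = 0" "endo_trace J2 = 0" "endo_trace J3 = 0"
proof -
  have e: "e1 \<noteq> 0" "e2 \<noteq> 0" using signs by auto
  show "endo_trace J3 = 0" "endo_trace J2 = 0"
    by (rule endo_trace_anticommuting[OF linear_J table(1) e(1)]; simp add: table)+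
  show "endo_trace J1 = 0"
    by (rule endo_trace_anticommuting[OF linear_J table(2) e(2)]; simp add: table)
qed

text \<open>
  The triple is trace-free, so besides the identity only rank one endomorphisms contribute to the trace.
\<close>

lemma ricci_R0: "endo_trace (\<lambda>X. R0' X Y Z) = (real DIM('e) / 4 + 2) * B Y Z"
proof -
  have l: "linear (\<lambda>X. B (J X) Y)" for J :: "'e \<Rightarrow>\<^sub>L 'e" and Y
    by (rule linearI) (simp_all add: blinfun.bilinear_simps)
  have l': "linear (\<lambda>X. B X Y)" for Y
    by (rule linearI) (simp_all add: blinfun.bilinear_simps)
  have "endo_trace (\<lambda>X. R0' X Y Z)
    = (1/2) * (e1 * B (J1 (J1 Z)) Y + e2 * B (J2 (J2 Z)) Y + e3 * B (J3 (J3 Z)) Y)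
      + (1/4) * (B Y Z * real DIM('e) - B Y Z
         - (e1 * (B (J1 Y) Z * 0 - B (J1 (J1 Y)) Z) + e2 * (B (J2 Y) Z * 0 - B (J2 (J2 Y)) Z)
            + e3 * (B (J3 Y) Z * 0 - B (J3 (J3 Y)) Z)))"
    unfolding R0_def wedge_endo_def scaleR_scaleR[symmetric]
    by (simp only: endo_trace_add endo_trace_diff endo_trace_scaleR endo_trace_rank_one l l' endo_trace_id endo_trace_frame)
  then show ?thesis
    by (cases rule: sign_cases; simp add: table blinfun.bilinear_simps sym[of Z Y] field_simps)
qed

text \<open>
  Commuting with the triple makes both sides of the trace identity vanish, which kills the Ricci tensor. By pair
  symmetry, commuting in the last argument means invariance in the first two; this gives the invariance under
  derivations.
\<close>

lemma commuting_curvature: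
  assumes W: "algebraic_curvature B W"
    and comm: "\<And>X Y Z. W X Y (J1 Z) = J1 (W X Y Z)" "\<And>X Y Z. W X Y (J2 Z) = J2 (W X Y Z)"
      "\<And>X Y Z. W X Y (J3 Z) = J3 (W X Y Z)"
  shows "trace_free W" "Q_invariant_curvature (span {J1, J2, J3}) W"
proof -
  have l0: "linear (\<lambda>X::'e. 0::real)" by (rule linearI) simp_all
  have e2: "e2 \<noteq> 0" using signs by auto
  have tr0: "endo_trace (\<lambda>Z. J1 (W X Y Z)) = 0" for X Y
  proof (rule endo_trace_anticommuting[OF _ table(2) e2])
    have lW: "linear (W X Y)" using W unfolding algebraic_curvature_def by blast
    show "linear (\<lambda>Z. J1 (W X Y Z))"
      using linear_compose[OF lW linear_J[of J1]] by (simp only: o_def)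
    show "J1 (W X Y (J2 x)) = - J2 (J1 (W X Y x))" for x
      by (simp only: comm table minus_minus)
  qed
  have ric: "endo_trace (\<lambda>V. W V X (J1 Y)) = 0" for X Y
  proof -
    have "endo_trace (\<lambda>Z. J1 (W X Y Z)) = - 2 * (endo_trace (\<lambda>V. W V X (J1 Y)) - 0 - 0)"
      by (rule trace_J_curvature[OF nondeg sym W skew(1), where K = "\<lambda>x. 0" and L = "\<lambda>x. 0"])
         (simp_all add: comm l0)
    then show ?thesis by (simp add: tr0)
  qed
  have "endo_trace (\<lambda>V. W V X Y) = 0" for X Y
  proof -
    have "W V X (J1 (J1 Y)) = e1 *\<^sub>R W V X Y" for V
      by (simp only: comm) (simp add: table)
    then show ?thesis using ric[of X "J1 Y"] signs by (auto simp: endo_trace_scaleR)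
  qed
  then show "trace_free W" by (simp add: trace_free_def)
  have key: "W (J X) Y Z + W X (J Y) Z = 0"
    if sk: "\<And>u v. B (J u) v = - B u (J v)" and cm: "\<And>X Y Z. W X Y (J Z) = J (W X Y Z)"
    for J :: "'e \<Rightarrow>\<^sub>L 'e" and X Y Z
  proof -
    have "B (W (J X) Y Z + W X (J Y) Z) V = 0" for V
    proof -
      have "B (W (J X) Y Z) V = B (W Z V (J X)) Y"
        by (rule algebraic_curvature_pair_symmetric[OF W sym])
      also have "\<dots> = - B (W Z V X) (J Y)" by (simp only: cm sk)
      also have "B (W Z V X) (J Y) = B (W X (J Y) Z) V"
        by (rule algebraic_curvature_pair_symmetric[OF W sym])
      finally show ?thesis by (simp add: blinfun.add_left blinfun.add_right)
    qed
    then show ?thesis using nondeg by (auto simp: nondegenerate_on_def)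
  qed
  let ?S = "{A :: 'e \<Rightarrow>\<^sub>L 'e. (\<forall>X Y Z. W X Y (A Z) = A (W X Y Z)) \<and> (\<forall>u v. B (A u) v = - B u (A v))}"
  have lW: "linear (W X Y)" for X Y using W unfolding algebraic_curvature_def by blast
  have "subspace ?S"
    by (auto simp: subspace_def blinfun.bilinear_simps linear_add[OF lW] linear_cmul[OF lW] linear_0[OF lW])
  moreover have "{J1, J2, J3} \<subseteq> ?S" using comm skew by auto
  ultimately have "span {J1, J2, J3} \<subseteq> ?S" by (rule span_minimal[rotated])
  then have "A (W X Y Z) - W (A X) Y Z - W X (A Y) Z - W X Y (A Z) = 0"
    if "A \<in> span {J1, J2, J3}" for A X Y Z
    using that key[of A X Y Z] by (simp add: subset_iff algebra_simps)
  then show "Q_invariant_curvature (span {J1, J2, J3}) W"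
    unfolding Q_invariant_curvature_def by blast
qed

text \<open>
  Every derivation of the algebra spanned by the triple is inner. The part of T that commutes with the triple has
  zero trace after multiplication with each of its elements, so the coefficients of the inner derivation are
  traces, and hence depend linearly on T.
\<close>

lemma normalizer_eq:
  fixes T :: "'e \<Rightarrow> 'e"
  assumes T: "linear T"
    and n1: "\<And>Z. T (J1 Z) - J1 (T Z) = p1 *\<^sub>R J1 Z + p2 *\<^sub>R J2 Z + p3 *\<^sub>R J3 Z"
    and n2: "\<And>Z. T (J2 Z) - J2 (T Z) = q1 *\<^sub>R J1 Z + q2 *\<^sub>R J2 Z + q3 *\<^sub>R J3 Z"
    and n3: "\<And>Z. T (J3 Z) - J3 (T Z) = r1 *\<^sub>R J1 Z + r2 *\<^sub>R J2 Z + r3 *\<^sub>R J3 Z"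
  defines "w J e \<equiv> endo_trace (\<lambda>Z. blinfun_apply J (T Z)) / (e * real DIM('e))"
  shows "T (J1 Z) - J1 (T Z) = (- 2 * w J2 e2) *\<^sub>R J3 Z + (- 2 * e1 * w J3 e3) *\<^sub>R J2 Z"
    and "T (J2 Z) - J2 (T Z) = (2 * w J1 e1) *\<^sub>R J3 Z + (2 * e2 * w J3 e3) *\<^sub>R J1 Z"
    and "T (J3 Z) - J3 (T Z) = (2 * e1 * w J1 e1) *\<^sub>R J2 Z + (- 2 * e2 * w J2 e2) *\<^sub>R J1 Z"
proof -
  have e: "e1 \<noteq> 0" "e2 \<noteq> 0" "e3 \<noteq> 0" using signs by auto
  note lT = linear_add[OF T] linear_cmul[OF T] linear_neg[OF T] linear_diff[OF T]
  have m1: "T (J1 Z) = J1 (T Z) + (p1 *\<^sub>R J1 Z + p2 *\<^sub>R J2 Z + p3 *\<^sub>R J3 Z)" for Z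
    using n1[of Z] by (metis add.commute diff_add_cancel)
  have m2: "T (J2 Z) = J2 (T Z) + (q1 *\<^sub>R J1 Z + q2 *\<^sub>R J2 Z + q3 *\<^sub>R J3 Z)" for Z
    using n2[of Z] by (metis add.commute diff_add_cancel)
  have m3: "T (J3 Z) = J3 (T Z) + (r1 *\<^sub>R J1 Z + r2 *\<^sub>R J2 Z + r3 *\<^sub>R J3 Z)" for Z
    using n3[of Z] by (metis add.commute diff_add_cancel)
  have "(2 * p1 * e1) *\<^sub>R Z + 0 *\<^sub>R J1 Z + 0 *\<^sub>R J2 Z + 0 *\<^sub>R J3 Z = 0" for Z
  proof -
    \<comment> \<open>Since J1 squares to a scalar, the derivation maps J1 to an element that anticommutes with it.\<close>
    have "T (J1 (J1 Z)) = e1 *\<^sub>R T Z" by (simp add: table lT)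
    then show ?thesis
      unfolding m1 by (simp add: table blinfun.bilinear_simps algebra_simps flip: scaleR_2)
  qed
  from triple_linear_independent[OF triple this] have p1: "p1 = 0" using e by simp
  have "(2 * q2 * e2) *\<^sub>R Z + 0 *\<^sub>R J1 Z + 0 *\<^sub>R J2 Z + 0 *\<^sub>R J3 Z = 0" for Z
  proof -
    have "T (J2 (J2 Z)) = e2 *\<^sub>R T Z" by (simp add: table lT)
    then show ?thesis
      unfolding m2 by (simp add: table blinfun.bilinear_simps algebra_simps flip: scaleR_2)
  qed
  from triple_linear_independent[OF triple this] have q2: "q2 = 0" using e by simp
  have "(p2 * e2 + q1 * e1) *\<^sub>R Z + (p3 * e2 - r1) *\<^sub>R J1 Z + (q3 * e1 - r2) *\<^sub>R J2 Z
      + (p1 + q2 - r3) *\<^sub>R J3 Z = 0" for Z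
  proof -
    \<comment> \<open>The product rule for J3 = J1 J2 relates the remaining coefficients.\<close>
    have "T (J1 (J2 Z)) = T (J3 Z)" by (simp add: table)
    then show ?thesis
      unfolding m1 m2 m3 by (simp add: table blinfun.bilinear_simps algebra_simps)
  qed
  from triple_linear_independent[OF triple this]
  have r: "p2 * e2 + q1 * e1 = 0" "r1 = p3 * e2" "r2 = q3 * e1" "r3 = 0" using p1 q2 by auto
  define u1 where "u1 = q3 / 2"
  define u2 where "u2 = - p3 / 2"
  define u3 where "u3 = e2 * q1 / 2"
  have pq: "p3 = - 2 * u2" "q3 = 2 * u1" "q1 = 2 * e2 * u3" "p2 = - 2 * e1 * u3"
    "r1 = - 2 * e2 * u2" "r2 = 2 * e1 * u1"
    using r by (cases rule: sign_cases; simp add: u1_def u2_def u3_def)+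
  define T' where "T' Z = T Z - (u1 *\<^sub>R J1 Z + u2 *\<^sub>R J2 Z + u3 *\<^sub>R J3 Z)" for Z
  have linT': "linear T'"
    by (rule linearI) (simp_all add: T'_def lT blinfun.bilinear_simps algebra_simps)
  have T'1: "T' (J1 Z) = J1 (T' Z)" for Z
    unfolding T'_def m1 by (simp add: table blinfun.bilinear_simps p1 pq algebra_simps flip: scaleR_2)
  have T'2: "T' (J2 Z) = J2 (T' Z)" for Z
    unfolding T'_def m2 by (simp add: table blinfun.bilinear_simps q2 pq algebra_simps flip: scaleR_2)
  have T'3: "T' (J3 Z) = J3 (T' Z)" for Z
    by (metis T'1 T'2 table(4))
  have lin: "linear (\<lambda>Z. J (T' Z))" for J :: "'e \<Rightarrow>\<^sub>L 'e"
    using linear_compose[OF linT' linear_J[of J]] by (simp only: o_def)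
  have t1: "endo_trace (\<lambda>Z. J1 (T' Z)) = 0"
    by (rule endo_trace_anticommuting[OF lin table(2) e(2)]) (simp only: T'2 table minus_minus)
  have t2: "endo_trace (\<lambda>Z. J2 (T' Z)) = 0"
    by (rule endo_trace_anticommuting[OF lin table(1) e(1)]) (simp only: T'1 table)
  have t3: "endo_trace (\<lambda>Z. J3 (T' Z)) = 0"
    by (rule endo_trace_anticommuting[OF lin table(1) e(1)]) (simp only: T'1 table)
  have TT': "T Z = T' Z + (u1 *\<^sub>R J1 Z + u2 *\<^sub>R J2 Z + u3 *\<^sub>R J3 Z)" for Z
    by (simp add: T'_def)
  have w: "w J1 e1 = u1" "w J2 e2 = u2" "w J3 e3 = u3"
    using e unfolding w_def TT' blinfun.add_right blinfun.scaleR_right table endo_trace_add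
      endo_trace_scaleR endo_trace_minus t1 t2 t3 endo_trace_frame endo_trace_id
    by simp_all
  show "T (J1 Z) - J1 (T Z) = (- 2 * w J2 e2) *\<^sub>R J3 Z + (- 2 * e1 * w J3 e3) *\<^sub>R J2 Z"
    unfolding n1 w p1 pq by simp
  show "T (J2 Z) - J2 (T Z) = (2 * w J1 e1) *\<^sub>R J3 Z + (2 * e2 * w J3 e3) *\<^sub>R J1 Z"
    unfolding n2 w q2 pq by simp
  show "T (J3 Z) - J3 (T Z) = (2 * e1 * w J1 e1) *\<^sub>R J2 Z + (- 2 * e2 * w J2 e2) *\<^sub>R J1 Z"
    unfolding n3 w r(4) pq by simp
qed

text \<open>
  The classical argument in dimension at least 8. Write [R(X,Y), .] as the commutator with the sum of the
  w_a(X,Y) J_a, and put b_a(X,Y) = w_a(J_a Y, X). The trace identity gives N b_a = 2 Ric - 4 (b_b + b_c), where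
  N is the dimension; as N is not 4, the three forms b_a agree. Their common value is symmetric and compatible with
  the triple, and the symmetry of the defects, one for each element of the triple, makes it proportional to B.
  This identifies the w_a with those of a multiple of R0.
\<close>

theorem quaternionic_curvature_decomposition:
  assumes dim: "DIM('e) \<ge> 8" and R: "algebraic_curvature B R"
    and n1: "\<And>X Y. \<exists>p1 p2 p3. \<forall>Z. R X Y (J1 Z) - J1 (R X Y Z) = p1 *\<^sub>R J1 Z + p2 *\<^sub>R J2 Z + p3 *\<^sub>R J3 Z"
    and n2: "\<And>X Y. \<exists>p1 p2 p3. \<forall>Z. R X Y (J2 Z) - J2 (R X Y Z) = p1 *\<^sub>R J1 Z + p2 *\<^sub>R J2 Z + p3 *\<^sub>R J3 Z"
    and n3: "\<And>X Y. \<exists>p1 p2 p3. \<forall>Z. R X Y (J3 Z) - J3 (R X Y Z) = p1 *\<^sub>R J1 Z + p2 *\<^sub>R J2 Z + p3 *\<^sub>R J3 Z"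
  shows "\<exists>\<nu>. \<forall>X Y Z.
    R X Y (J1 Z) - J1 (R X Y Z) = \<nu> *\<^sub>R (R0' X Y (J1 Z) - J1 (R0' X Y Z)) \<and>
    R X Y (J2 Z) - J2 (R X Y Z) = \<nu> *\<^sub>R (R0' X Y (J2 Z) - J2 (R0' X Y Z)) \<and>
    R X Y (J3 Z) - J3 (R X Y Z) = \<nu> *\<^sub>R (R0' X Y (J3 Z) - J3 (R0' X Y Z))"
proof -
  define N where "N = real DIM('e)"
  have N: "N \<ge> 8" using dim by (simp add: N_def)
  have e: "e1 \<noteq> 0" "e2 \<noteq> 0" "e3 \<noteq> 0" using signs by auto
  have linR: "linear (R X Y)" "linear (\<lambda>X. R X Y Z)" for X Y Z
    using R unfolding algebraic_curvature_def by blast+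
  have antiR: "R X Y Z = - R Y X Z" for X Y Z using R unfolding algebraic_curvature_def by blast
  note ps = algebraic_curvature_pair_symmetric[OF R sym]
  define w where "w J a X Y = endo_trace (\<lambda>Z. blinfun_apply J (R X Y Z)) / (a * N)" for J a X Y
  let ?w1 = "w J1 e1" and ?w2 = "w J2 e2" and ?w3 = "w J3 e3"
  have c: "R X Y (J1 Z) - J1 (R X Y Z) = (- 2 * ?w2 X Y) *\<^sub>R J3 Z + (- 2 * e1 * ?w3 X Y) *\<^sub>R J2 Z"
    "R X Y (J2 Z) - J2 (R X Y Z) = (2 * ?w1 X Y) *\<^sub>R J3 Z + (2 * e2 * ?w3 X Y) *\<^sub>R J1 Z"
    "R X Y (J3 Z) - J3 (R X Y Z) = (2 * e1 * ?w1 X Y) *\<^sub>R J2 Z + (- 2 * e2 * ?w2 X Y) *\<^sub>R J1 Z" for X Y Z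
  proof -
    obtain p1 p2 p3 q1 q2 q3 r1 r2 r3 where
      "\<And>Z. R X Y (J1 Z) - J1 (R X Y Z) = p1 *\<^sub>R J1 Z + p2 *\<^sub>R J2 Z + p3 *\<^sub>R J3 Z"
      "\<And>Z. R X Y (J2 Z) - J2 (R X Y Z) = q1 *\<^sub>R J1 Z + q2 *\<^sub>R J2 Z + q3 *\<^sub>R J3 Z"
      "\<And>Z. R X Y (J3 Z) - J3 (R X Y Z) = r1 *\<^sub>R J1 Z + r2 *\<^sub>R J2 Z + r3 *\<^sub>R J3 Z"
      using n1[of X Y] n2[of X Y] n3[of X Y] by blast
    note * = normalizer_eq[OF linR(1) this, folded N_def]
    show "R X Y (J1 Z) - J1 (R X Y Z) = (- 2 * ?w2 X Y) *\<^sub>R J3 Z + (- 2 * e1 * ?w3 X Y) *\<^sub>R J2 Z"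
      "R X Y (J2 Z) - J2 (R X Y Z) = (2 * ?w1 X Y) *\<^sub>R J3 Z + (2 * e2 * ?w3 X Y) *\<^sub>R J1 Z"
      "R X Y (J3 Z) - J3 (R X Y Z) = (2 * e1 * ?w1 X Y) *\<^sub>R J2 Z + (- 2 * e2 * ?w2 X Y) *\<^sub>R J1 Z"
      unfolding w_def by (rule *)+
  qed
  have wadd: "w J a (X + X') Y = w J a X Y + w J a X' Y" for J a X X' Y
    by (simp only: w_def linear_add[OF linR(2)] blinfun.add_right endo_trace_add add_divide_distrib)
  have wcmul: "w J a (r *\<^sub>R X) Y = r * w J a X Y" for J a r X Y
    by (simp only: w_def linear_cmul[OF linR(2)] blinfun.scaleR_right endo_trace_scaleR times_divide_eq_right)
  have wlin: "linear (\<lambda>X. k * w J a X Y)" for k J a Y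
    by (rule linearI) (simp_all add: wadd wcmul distrib_left)
  have wneg: "w J a (- X) Y = - w J a X Y" for J a X Y
    using wcmul[of J a "-1"] by simp
  have wanti: "w J a X Y = - w J a Y X" for J a X Y
    unfolding w_def antiR[of X Y] blinfun.minus_right endo_trace_minus by simp
  define Ric where "Ric X Y = endo_trace (\<lambda>V. R V X Y)" for X Y
  have Riccm: "Ric X (r *\<^sub>R Y) = r * Ric X Y" for X r Y
    by (simp only: Ric_def linear_cmul[OF linR(1)] endo_trace_scaleR)
  have Ricneg: "Ric X (- Y) = - Ric X Y" for X Y
    using Riccm[of X "-1"] by simp
  have Ricsym: "Ric X Y = Ric Y X" for X Y
    unfolding Ric_def
  proof (rule endo_trace_adjoint[OF nondeg sym linR(2)])
    fix V V'
    have "B (R V X Y) V' = B (R Y V' V) X" by (rule ps)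
    also have "\<dots> = - B V (R Y V' X)" using R unfolding algebraic_curvature_def by blast
    also have "\<dots> = B V (R V' Y X)" by (simp only: antiR[of Y V'] blinfun.minus_right minus_minus)
    finally show "B (R V X Y) V' = B V (R V' Y X)" .
  qed
  have tr: "a * N * w J a X Y = endo_trace (\<lambda>Z. J (R X Y Z))" if "a \<noteq> 0" for J a X Y
    using that N by (simp add: w_def)
  have t1: "e1 * N * ?w1 X Y = - 2 * (Ric X (J1 Y) - (- 2 * ?w2 (J3 Y) X) - (- 2 * e1 * ?w3 (J2 Y) X))" for X Y
    unfolding tr[OF e(1)] Ric_def
    by (rule trace_J_curvature[OF nondeg sym R skew(1) c(1)]) (rule wlin)+
  have t2: "e2 * N * ?w2 X Y = - 2 * (Ric X (J2 Y) - (2 * ?w1 (J3 Y) X) - (2 * e2 * ?w3 (J1 Y) X))" for X Y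
    unfolding tr[OF e(2)] Ric_def
    by (rule trace_J_curvature[OF nondeg sym R skew(2) c(2)]) (rule wlin)+
  have t3: "e3 * N * ?w3 X Y = - 2 * (Ric X (J3 Y) - (2 * e1 * ?w1 (J2 Y) X) - (- 2 * e2 * ?w2 (J1 Y) X))" for X Y
    unfolding tr[OF e(3)] Ric_def
    by (rule trace_J_curvature[OF nondeg sym R skew(3) c(3)]) (rule wlin)+
  define b1 where "b1 X Y = ?w1 (J1 Y) X" for X Y
  define b2 where "b2 X Y = ?w2 (J2 Y) X" for X Y
  define b3 where "b3 X Y = ?w3 (J3 Y) X" for X Y
  \<comment> \<open>Substituting J_a Y for Y in the trace identities.\<close>
  have u1: "N * b1 X Y = 2 * Ric X Y - 4 * b2 X Y - 4 * b3 X Y" for X Y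
    using t1[of X "J1 Y"] wanti[of J1 e1 X "J1 Y"] unfolding b1_def b2_def b3_def
    by (cases rule: sign_cases; simp add: table wneg wcmul Riccm Ricneg)
  have u2: "N * b2 X Y = 2 * Ric X Y - 4 * b1 X Y - 4 * b3 X Y" for X Y
    using t2[of X "J2 Y"] wanti[of J2 e2 X "J2 Y"] unfolding b1_def b2_def b3_def
    by (cases rule: sign_cases; simp add: table wneg wcmul Riccm Ricneg)
  have u3: "N * b3 X Y = 2 * Ric X Y - 4 * b1 X Y - 4 * b2 X Y" for X Y
    using t3[of X "J3 Y"] wanti[of J3 e3 X "J3 Y"] unfolding b1_def b2_def b3_def
    by (cases rule: sign_cases; simp add: table wneg wcmul Riccm Ricneg)
  have b21: "b2 X Y = b1 X Y" for X Y
  proof -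
    have "(N - 4) * (b2 X Y - b1 X Y) = 0" using u1[of X Y] u2[of X Y] by (simp add: algebra_simps)
    then show ?thesis using N by simp
  qed
  have b31: "b3 X Y = b1 X Y" for X Y
  proof -
    have "(N - 4) * (b3 X Y - b1 X Y) = 0" using u1[of X Y] u3[of X Y] by (simp add: algebra_simps)
    then show ?thesis using N by simp
  qed
  have bsym: "b1 X Y = b1 Y X" for X Y
  proof -
    have "(N + 8) * (b1 X Y - b1 Y X) = 0"
      using u1[of X Y] u1[of Y X] Ricsym[of X Y] by (simp add: b21 b31 algebra_simps)
    then show ?thesis using N by simp
  qed
  have wb: "?w1 X Y = e1 * b1 Y (J1 X)" "?w2 X Y = e2 * b1 Y (J2 X)" "?w3 X Y = e3 * b1 Y (J3 X)" for X Y
  proof -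
    show "?w1 X Y = e1 * b1 Y (J1 X)" using signs by (simp add: b1_def table wcmul flip: mult.assoc)
    show "?w2 X Y = e2 * b1 Y (J2 X)" unfolding b21[symmetric] using signs by (simp add: b2_def table wcmul flip: mult.assoc)
    show "?w3 X Y = e3 * b1 Y (J3 X)" unfolding b31[symmetric] by (cases rule: sign_cases; simp add: b3_def table wcmul wneg)
  qed
  have bJ: "b1 (J1 U) (J1 V) = - e1 * b1 U V" "b1 (J2 U) (J2 V) = - e2 * b1 U V" "b1 (J3 U) (J3 V) = - e3 * b1 U V" for U V
  proof -
    have *: "e * x = y \<Longrightarrow> e * e = 1 \<Longrightarrow> x = e * y" for e x y :: real by (metis mult.assoc mult_1)
    have "b1 (J1 U) (J1 V) = e1 * ?w1 V (J1 U)" "b1 (J2 U) (J2 V) = e2 * ?w2 V (J2 U)"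
      "b1 (J3 U) (J3 V) = e3 * ?w3 V (J3 U)"
      using wb(1)[of V "J1 U"] wb(2)[of V "J2 U"] wb(3)[of V "J3 U"] * signs by metis+
    moreover have "?w1 V (J1 U) = - b1 V U" "?w2 V (J2 U) = - b1 V U" "?w3 V (J3 U) = - b1 V U"
      using wanti[of J1 e1 V "J1 U"] wanti[of J2 e2 V "J2 U"] wanti[of J3 e3 V "J3 U"]
      by (simp_all add: b1_def[symmetric] b2_def[symmetric] b3_def[symmetric] b21 b31)
    ultimately show "b1 (J1 U) (J1 V) = - e1 * b1 U V" "b1 (J2 U) (J2 V) = - e2 * b1 U V" "b1 (J3 U) (J3 V) = - e3 * b1 U V"
      using bsym[of U V] by simp_all
  qed
  have bcm: "b1 U (r *\<^sub>R V) = r * b1 U V" "b1 U (- V) = - b1 U V" for U r V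
    by (simp_all add: b1_def blinfun.bilinear_simps wcmul wneg)
  have inv: "?w2 (J1 X) (J1 Y) = e1 * ?w2 X Y" "?w3 (J1 X) (J1 Y) = e1 * ?w3 X Y"
    "?w1 (J2 X) (J2 Y) = e2 * ?w1 X Y" "?w3 (J2 X) (J2 Y) = e2 * ?w3 X Y"
    "?w1 (J3 X) (J3 Y) = e3 * ?w1 X Y" "?w2 (J3 X) (J3 Y) = e3 * ?w2 X Y" for X Y
  proof -
    have J: "J2 (J1 X) = - J1 (J2 X)" "J3 (J1 X) = - J1 (J3 X)" "J1 (J2 X) = - J2 (J1 X)"
      "J3 (J2 X) = - J2 (J3 X)" "J1 (J3 X) = - J3 (J1 X)" "J2 (J3 X) = - J3 (J2 X)"
      by (simp_all add: table)
    show "?w2 (J1 X) (J1 Y) = e1 * ?w2 X Y" unfolding wb J(1) bcm bJ by simp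
    show "?w3 (J1 X) (J1 Y) = e1 * ?w3 X Y" unfolding wb J(2) bcm bJ by simp
    show "?w1 (J2 X) (J2 Y) = e2 * ?w1 X Y" unfolding wb J(3) bcm bJ by simp
    show "?w3 (J2 X) (J2 Y) = e2 * ?w3 X Y" unfolding wb J(4) bcm bJ by simp
    show "?w1 (J3 X) (J3 Y) = e3 * ?w1 X Y" unfolding wb J(5) bcm bJ by simp
    show "?w2 (J3 X) (J3 Y) = e3 * ?w2 X Y" unfolding wb J(6) bcm bJ by simp
  qed
  note bl = blinfun.add_left blinfun.scaleR_left blinfun.add_right blinfun.scaleR_right
  have k: "B (J3 Z) (J1 V) = - e1 * B (J2 Z) V" "B (J2 Z) (J1 V) = - B (J3 Z) V"
    "B (J3 Z) (J2 V) = e2 * B (J1 Z) V" "B (J1 Z) (J2 V) = B (J3 Z) V"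
    "B (J2 Z) (J3 V) = - e2 * B (J1 Z) V" "B (J1 Z) (J3 V) = e1 * B (J2 Z) V" for Z V
    by (simp_all add: skew_right table blinfun.bilinear_simps)
  have i1: "B ((- 2 * ?w2 (J1 X) (J1 Y)) *\<^sub>R J3 Z + (- 2 * e1 * ?w3 (J1 X) (J1 Y)) *\<^sub>R J2 Z) (J1 V)
      = e1 * B ((- 2 * ?w2 X Y) *\<^sub>R J3 Z + (- 2 * e1 * ?w3 X Y) *\<^sub>R J2 Z) (J1 V)" for X Y Z V
    by (simp add: blinfun.bilinear_simps inv algebra_simps)
  have s23: "?w2 X Y * B (J2 Z) V + ?w3 X Y * B (J3 Z) V = ?w2 Z V * B (J2 X) Y + ?w3 Z V * B (J3 X) Y" for X Y Z V
  proof -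
    have "(2 * e1) * (?w2 X Y * B (J2 Z) V + ?w3 X Y * B (J3 Z) V) = B ((- 2 * ?w2 X Y) *\<^sub>R J3 Z + (- 2 * e1 * ?w3 X Y) *\<^sub>R J2 Z) (J1 V)"
      unfolding bl k by (simp add: algebra_simps)
    also have "\<dots> = B ((- 2 * ?w2 Z V) *\<^sub>R J3 X + (- 2 * e1 * ?w3 Z V) *\<^sub>R J2 X) (J1 Y)"
      by (rule defect_symmetric[where R = R and J = J1 and e = e1
            and C = "\<lambda>X Y Z. (- 2 * ?w2 X Y) *\<^sub>R J3 Z + (- 2 * e1 * ?w3 X Y) *\<^sub>R J2 Z"])
         (rule sym R skew table signs c i1)+
    also have "\<dots> = (2 * e1) * (?w2 Z V * B (J2 X) Y + ?w3 Z V * B (J3 X) Y)"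
      unfolding bl k by (simp add: algebra_simps)
    finally show ?thesis using e by simp
  qed
  have i2: "B ((2 * ?w1 (J2 X) (J2 Y)) *\<^sub>R J3 Z + (2 * e2 * ?w3 (J2 X) (J2 Y)) *\<^sub>R J1 Z) (J2 V)
      = e2 * B ((2 * ?w1 X Y) *\<^sub>R J3 Z + (2 * e2 * ?w3 X Y) *\<^sub>R J1 Z) (J2 V)" for X Y Z V
    by (simp add: blinfun.bilinear_simps inv algebra_simps)
  have s13: "?w1 X Y * B (J1 Z) V + ?w3 X Y * B (J3 Z) V = ?w1 Z V * B (J1 X) Y + ?w3 Z V * B (J3 X) Y" for X Y Z V
  proof -
    have "(2 * e2) * (?w1 X Y * B (J1 Z) V + ?w3 X Y * B (J3 Z) V) = B ((2 * ?w1 X Y) *\<^sub>R J3 Z + (2 * e2 * ?w3 X Y) *\<^sub>R J1 Z) (J2 V)"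
      unfolding bl k by (simp add: algebra_simps)
    also have "\<dots> = B ((2 * ?w1 Z V) *\<^sub>R J3 X + (2 * e2 * ?w3 Z V) *\<^sub>R J1 X) (J2 Y)"
      by (rule defect_symmetric[where R = R and J = J2 and e = e2
            and C = "\<lambda>X Y Z. (2 * ?w1 X Y) *\<^sub>R J3 Z + (2 * e2 * ?w3 X Y) *\<^sub>R J1 Z"])
         (rule sym R skew table signs c i2)+
    also have "\<dots> = (2 * e2) * (?w1 Z V * B (J1 X) Y + ?w3 Z V * B (J3 X) Y)"
      unfolding bl k by (simp add: algebra_simps)
    finally show ?thesis using e by simp
  qed
  have i3: "B ((2 * e1 * ?w1 (J3 X) (J3 Y)) *\<^sub>R J2 Z + (- 2 * e2 * ?w2 (J3 X) (J3 Y)) *\<^sub>R J1 Z) (J3 V)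
      = e3 * B ((2 * e1 * ?w1 X Y) *\<^sub>R J2 Z + (- 2 * e2 * ?w2 X Y) *\<^sub>R J1 Z) (J3 V)" for X Y Z V
    by (simp add: blinfun.bilinear_simps inv algebra_simps)
  have s12: "?w1 X Y * B (J1 Z) V + ?w2 X Y * B (J2 Z) V = ?w1 Z V * B (J1 X) Y + ?w2 Z V * B (J2 X) Y" for X Y Z V
  proof -
    have "(- (2 * e1 * e2)) * (?w1 X Y * B (J1 Z) V + ?w2 X Y * B (J2 Z) V) = B ((2 * e1 * ?w1 X Y) *\<^sub>R J2 Z + (- 2 * e2 * ?w2 X Y) *\<^sub>R J1 Z) (J3 V)"
      unfolding bl k by (simp add: algebra_simps)
    also have "\<dots> = B ((2 * e1 * ?w1 Z V) *\<^sub>R J2 X + (- 2 * e2 * ?w2 Z V) *\<^sub>R J1 X) (J3 Y)"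
      by (rule defect_symmetric[where R = R and J = J3 and e = e3
            and C = "\<lambda>X Y Z. (2 * e1 * ?w1 X Y) *\<^sub>R J2 Z + (- 2 * e2 * ?w2 X Y) *\<^sub>R J1 Z"])
         (rule sym R skew table signs c i3)+
    also have "\<dots> = (- (2 * e1 * e2)) * (?w1 Z V * B (J1 X) Y + ?w2 Z V * B (J2 X) Y)"
      unfolding bl k by (simp add: algebra_simps)
    finally show ?thesis using e by simp
  qed
  \<comment> \<open>Two defects minus the third isolate a single index.\<close>
  have s11: "?w1 X Y * B (J1 Z) V = ?w1 Z V * B (J1 X) Y" for X Y Z V
    using s23[of X Y Z V] s13[of X Y Z V] s12[of X Y Z V] by linarith
  obtain x :: 'e where x: "x \<noteq> 0" by (metis SOME_Basis nonzero_Basis)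
  then obtain V where V: "B x V \<noteq> 0" using nondeg by (auto simp: nondegenerate_on_def)
  \<comment> \<open>Z and V are chosen such that B (J1 Z) V is not zero, which makes k the factor of proportionality.\<close>
  define Z where "Z = e1 *\<^sub>R J1 x"
  have Z: "J1 Z = x" using signs by (simp add: Z_def table blinfun.scaleR_right)
  define k where "k = e1 * ?w1 Z V / B x V"
  have b: "b1 X Y = k * B X Y" for X Y
    using s11[of "J1 Y" X Z V] V unfolding b1_def k_def Z
    by (simp add: table blinfun.bilinear_simps sym[of Y X] field_simps)
  have wk: "?w1 X Y = e1 * k * B (J1 X) Y" "?w2 X Y = e2 * k * B (J2 X) Y" "?w3 X Y = e3 * k * B (J3 X) Y" for X Y
    unfolding wb b by (simp_all add: sym[of Y])
  show ?thesis
  proof (intro exI[of _ "2 * k"] allI conjI)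
    fix X Y Z
    show "R X Y (J1 Z) - J1 (R X Y Z) = (2 * k) *\<^sub>R (R0' X Y (J1 Z) - J1 (R0' X Y Z))"
      unfolding c R0_commutator wk by (simp add: scaleR_add_right algebra_simps)
    show "R X Y (J2 Z) - J2 (R X Y Z) = (2 * k) *\<^sub>R (R0' X Y (J2 Z) - J2 (R0' X Y Z))"
      unfolding c R0_commutator wk by (simp add: scaleR_add_right algebra_simps)
    show "R X Y (J3 Z) - J3 (R X Y Z) = (2 * k) *\<^sub>R (R0' X Y (J3 Z) - J3 (R0' X Y Z))"
      unfolding c R0_commutator wk using signs by (simp add: scaleR_add_right algebra_simps flip: mult.assoc)
  qed
qed

end

section \<open>Dimensions of invariant subspaces\<close>

lemma dim_sum_le:
  fixes S T W :: "'e::euclidean_space set"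
  assumes "subspace S" "subspace T" "S \<inter> T \<subseteq> {0}" "S \<subseteq> W" "T \<subseteq> W" "subspace W"
  shows "dim S + dim T \<le> dim W"
proof -
  have "dim {x + y |x y. x \<in> S \<and> y \<in> T} + dim (S \<inter> T) = dim S + dim T"
    by (rule dim_sums_Int[OF assms(1,2)])
  moreover have "dim (S \<inter> T) = 0" using assms(3) by (simp add: dim_eq_0)
  moreover have "dim {x + y |x y. x \<in> S \<and> y \<in> T} \<le> dim W"
    using assms(4,5,6) by (intro dim_subset) (auto intro: subspace_add)
  ultimately show ?thesis by simp
qed

lemma dim_sum_ge:
  fixes S T W :: "'e::euclidean_space set"
  assumes "subspace S" "subspace T" "\<And>w. w \<in> W \<Longrightarrow> \<exists>x\<in>S. \<exists>y\<in>T. w = x + y"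
  shows "dim W \<le> dim S + dim T"
proof -
  have "dim W \<le> dim {x + y |x y. x \<in> S \<and> y \<in> T}"
    using assms(3) by (intro dim_subset) blast
  then show ?thesis using dim_sums_Int[OF assms(1,2)] by simp
qed

lemma dim_kernel_Int:
  fixes f :: "'e::euclidean_space \<Rightarrow> real"
  assumes "linear f" "subspace W"
  shows "dim W \<le> dim {x\<in>W. f x = 0} + 1"
proof (cases "\<exists>v\<in>W. f v \<noteq> 0")
  case True
  then obtain v where v: "v \<in> W" "f v \<noteq> 0" by blast
  have s: "subspace {x\<in>W. f x = 0}"
    using assms by (auto simp: subspace_def linear_0 linear_add linear_cmul)
  have "dim W \<le> dim {x\<in>W. f x = 0} + dim (span {v})"
  proof (rule dim_sum_ge[OF s subspace_span])
    fix w assume w: "w \<in> W"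
    let ?y = "(f w / f v) *\<^sub>R v"
    have "w = (w - ?y) + ?y" "?y \<in> span {v}" by (auto simp: span_base span_scale)
    moreover have "w - ?y \<in> {x\<in>W. f x = 0}"
      using w v assms by (auto simp: linear_diff linear_cmul intro!: subspace_diff subspace_scale)
    ultimately show "\<exists>x\<in>{x\<in>W. f x = 0}. \<exists>y\<in>span {v}. w = x + y" by blast
  qed
  also have "dim (span {v}) \<le> 1" using dim_le_card'[of "{v}"] by simp
  finally show ?thesis by simp
next
  case False
  then have "{x\<in>W. f x = 0} = W" by auto
  then show ?thesis by simp
qed

text \<open>
  The image of an isotropic subspace under the Gram operator is orthogonal to it.
\<close>

lemma isotropic_dim:
  fixes B :: "'e::euclidean_space \<Rightarrow>\<^sub>L 'e \<Rightarrow>\<^sub>L real"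
  assumes nd: "nondegenerate_on B UNIV" and S: "subspace S" and iso: "\<And>u v. u \<in> S \<Longrightarrow> v \<in> S \<Longrightarrow> B u v = 0"
  shows "2 * dim S \<le> DIM('e)"
proof -
  let ?G = "gram B"
  have inj: "inj ?G" using bij_gram[OF nd] by (rule bij_is_inj)
  have dG: "dim (?G ` S) = dim S"
    by (rule dim_image_eq[OF linear_gram]) (use inj in \<open>blast intro: inj_on_subset\<close>)
  have "dim (?G ` S) + dim S \<le> dim (UNIV :: 'e set)"
  proof (rule dim_sum_le)
    show "subspace (?G ` S)" by (rule linear_subspace_image[OF linear_gram S])
    show "?G ` S \<inter> S \<subseteq> {0}"
    proof clarify
      fix u assume u: "u \<in> S" "?G u \<in> S"
      then have "?G u \<bullet> ?G u = 0" using iso by (simp add: inner_gram)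
      then show "?G u = 0" by simp
    qed
  qed (use S in auto)
  then show ?thesis using dG by simp
qed

text \<open>
  A pair u, v with s u v nonzero spans a hyperbolic plane; its s-complement is again nondegenerate, of dimension
  smaller by 2.
\<close>

lemma even_dim_of_symplectic:
  fixes s :: "'e::euclidean_space \<Rightarrow> 'e \<Rightarrow> real"
  assumes bil: "\<And>u. linear (s u)" and W: "subspace W"
    and skew: "\<And>u v. u \<in> W \<Longrightarrow> v \<in> W \<Longrightarrow> s u v = - s v u"
    and nd: "\<And>u. u \<in> W \<Longrightarrow> (\<And>v. v \<in> W \<Longrightarrow> s u v = 0) \<Longrightarrow> u = 0"
  shows "even (dim W)"
  using W skew nd
proof (induction "dim W" arbitrary: W rule: less_induct)
  case (less W)
  show ?case
  proof (cases "W \<subseteq> {0}")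
    case True
    then have "dim W = 0" by (simp add: dim_eq_0)
    then show ?thesis by (metis even_zero)
  next
    case False
    then obtain u where u: "u \<in> W" "u \<noteq> 0" by blast
    then obtain v where v: "v \<in> W" "s u v \<noteq> 0" using less.prems(3)[of u] u by blast
    let ?P = "{x\<in>W. s u x = 0 \<and> s v x = 0}"
    have uu: "s u u = 0" "s v v = 0" using less.prems(2)[of u u] less.prems(2)[of v v] u v by auto
    have vu: "s v u = - s u v" using less.prems(2) u v by blast
    have sP: "subspace ?P" using less.prems(1) bil by (auto simp: subspace_def linear_0 linear_add linear_cmul)
    have decomp: "\<exists>x\<in>?P. \<exists>y\<in>span {u, v}. w = x + y" if w: "w \<in> W" for w
    proof -
      let ?y = "(s v w / s v u) *\<^sub>R u + (s u w / s u v) *\<^sub>R v"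
      have "?y \<in> span {u, v}" by (simp add: span_add span_scale span_base)
      moreover have "w - ?y \<in> ?P"
        using w u v uu vu bil less.prems(1)
        by (auto simp: linear_diff linear_add linear_cmul intro!: subspace_diff subspace_add subspace_scale)
      ultimately show ?thesis by (intro bexI[of _ "w - ?y"] bexI[of _ ?y]) auto
    qed
    have uv: "u \<noteq> v" "independent {u, v}"
    proof -
      show "u \<noteq> v" using uu v by auto
      have "u \<notin> span {v}"
      proof
        assume "u \<in> span {v}"
        then obtain k where "u = k *\<^sub>R v" by (auto simp: span_singleton)
        then have "s v u = 0" using bil uu by (simp add: linear_cmul)
        then show False using vu v by simp
      qed
      then show "independent {u, v}" using v \<open>u \<noteq> v\<close> linear_0[OF bil]
        by (auto simp: independent_insert)
    qed
    then have d2: "dim (span {u, v}) = 2" using dim_eq_card_independent[of "{u, v}"] uv by simp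
    have "dim ?P + dim (span {u, v}) \<le> dim W"
    proof (rule dim_sum_le[OF sP subspace_span])
      show "?P \<inter> span {u, v} \<subseteq> {0}"
      proof clarify
        fix x assume x: "s u x = 0" "s v x = 0" "x \<in> span {u, v}"
        then obtain a b where ab: "x = a *\<^sub>R u + b *\<^sub>R v"
          by (auto simp: span_insert span_singleton algebra_simps)
        then show "x = 0" using x(1,2) uu vu v bil by (simp add: linear_add linear_cmul)
      qed
      show "span {u, v} \<subseteq> W" using u v less.prems(1) by (simp add: span_minimal)
    qed (use less.prems(1) in auto)
    moreover have "dim W \<le> dim ?P + dim (span {u, v})"
      by (rule dim_sum_ge[OF sP subspace_span decomp])
    ultimately have dW: "dim W = dim ?P + 2" using d2 by simp
    have "even (dim ?P)"
    proof (rule less.hyps[OF _ sP])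
      fix x assume x: "x \<in> ?P" and h: "\<And>y. y \<in> ?P \<Longrightarrow> s x y = 0"
      have "s x w = 0" if w: "w \<in> W" for w
      proof -
        obtain p y where py: "p \<in> ?P" "y \<in> span {u, v}" "w = p + y" using decomp[OF w] by blast
        obtain a b where ab: "y = a *\<^sub>R u + b *\<^sub>R v" using py(2)
          by (auto simp: span_insert span_singleton algebra_simps)
        have "s x u = 0" "s x v = 0" using x less.prems(2)[of x u] less.prems(2)[of x v] u v by auto
        then show ?thesis using h[OF py(1)] bil py(3) ab by (simp add: linear_add linear_cmul)
      qed
      then show "x = 0" using less.prems(3) x by blast
    next
      show "dim ?P < dim W" using dW by simp
      show "s x y = - s y x" if "x \<in> ?P" "y \<in> ?P" for x y
        using less.prems(2) that by blast
    qed
    then show ?thesis using dW by simp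
  qed
qed

lemma involution_split:
  fixes J :: "'e::euclidean_space \<Rightarrow>\<^sub>L 'e"
  assumes W: "subspace W" and JW: "\<And>v. v \<in> W \<Longrightarrow> J v \<in> W" and JJ: "\<And>v. v \<in> W \<Longrightarrow> J (J v) = v"
  shows "dim W = dim {v\<in>W. J v = v} + dim {v\<in>W. J v = - v}"
proof -
  have s: "subspace {v\<in>W. J v = v}" "subspace {v\<in>W. J v = - v}"
    using W by (auto simp: subspace_def blinfun.bilinear_simps)
  have "dim W \<le> dim {v\<in>W. J v = v} + dim {v\<in>W. J v = - v}"
  proof (rule dim_sum_ge[OF s])
    fix w assume w: "w \<in> W"
    have "(1/2) *\<^sub>R (w + J w) \<in> {v\<in>W. J v = v}" "(1/2) *\<^sub>R (w - J w) \<in> {v\<in>W. J v = - v}"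
      using w W JW JJ by (auto simp: blinfun.bilinear_simps algebra_simps intro!: subspace_add subspace_diff subspace_scale)
    moreover have "w = (1/2) *\<^sub>R (w + J w) + (1/2) *\<^sub>R (w - J w)"
      by (simp add: algebra_simps flip: scaleR_2 scaleR_add_left)
    ultimately show "\<exists>x\<in>{v\<in>W. J v = v}. \<exists>y\<in>{v\<in>W. J v = - v}. w = x + y" by blast
  qed
  moreover have "dim {v\<in>W. J v = v} + dim {v\<in>W. J v = - v} \<le> dim W"
  proof (rule dim_sum_le[OF s])
    show "{v\<in>W. J v = v} \<inter> {v\<in>W. J v = - v} \<subseteq> {0}"
    proof clarify
      fix x assume "J x = x" "J x = - x"
      then have "2 *\<^sub>R x = 0" unfolding scaleR_2 by (metis add.right_inverse)
      then show "x = 0" by simp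
    qed
  qed (use W in auto)
  ultimately show ?thesis by simp
qed

text \<open>
  W is the sum of the two eigenspaces of I, which K interchanges, so they have equal dimensions. Each is isotropic,
  hence (u,v) |-> B u (K v) is a symplectic form on the first one, whose dimension is therefore even.
\<close>

lemma four_dvd_dim_invariant:
  fixes B :: "'e::euclidean_space \<Rightarrow>\<^sub>L 'e \<Rightarrow>\<^sub>L real" and I K :: "'e \<Rightarrow>\<^sub>L 'e"
  assumes sym: "\<And>u v. B u v = B v u" and W: "subspace W" and nd: "nondegenerate_on B W"
    and IW: "\<And>v. v \<in> W \<Longrightarrow> I v \<in> W" and KW: "\<And>v. v \<in> W \<Longrightarrow> K v \<in> W"
    and II: "\<And>v. I (I v) = v" and KK: "\<And>v. K (K v) = e *\<^sub>R v" and e: "e \<noteq> 0"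
    and IK: "\<And>v. I (K v) = - K (I v)"
    and skew: "\<And>u v. B (I u) v = - B u (I v)" "\<And>u v. B (K u) v = - B u (K v)"
  shows "4 dvd dim W"
proof -
  let ?P = "{v\<in>W. I v = v}" and ?M = "{v\<in>W. I v = - v}"
  have sP: "subspace ?P" "subspace ?M" using W by (auto simp: subspace_def blinfun.bilinear_simps)
  have linK: "linear K" by (simp add: bounded_linear.linear blinfun.bounded_linear_right)
  have injK: "inj K" unfolding linear_injective_0[OF linK]
    by (metis KK e blinfun.zero_right scaleR_eq_0_iff)
  have dK: "dim (K ` S) = dim S" for S
    by (rule dim_image_eq[OF linK]) (use injK in \<open>blast intro: inj_on_subset\<close>)
  have "K ` ?P \<subseteq> ?M" "K ` ?M \<subseteq> ?P" using KW IK by (auto simp: blinfun.minus_right)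
  from this[THEN dim_subset] have "dim ?P = dim ?M" unfolding dK by (rule le_antisym)
  then have d: "dim W = 2 * dim ?P" using involution_split[OF W IW] II by simp
  have iso: "B u v = 0" if "I u = u" "I v = v" for u v
    using skew(1)[of u v] that by simp
  have "even (dim ?P)"
  proof (rule even_dim_of_symplectic[OF _ sP(1), of "\<lambda>u v. B u (K v)"])
    show "linear (\<lambda>v. B u (K v))" for u by (rule linearI) (simp_all add: blinfun.bilinear_simps)
    show "B u (K v) = - B v (K u)" for u v using skew(2)[of u v] sym[of v "K u"] by simp
    fix u assume u: "u \<in> ?P" and h: "\<And>v. v \<in> ?P \<Longrightarrow> B u (K v) = 0"
    have "B u w = 0" if w: "w \<in> W" for w
    proof -
      have 1: "B u (w + I w) = 0" using u w IW II by (intro iso) (auto simp: blinfun.bilinear_simps)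
      have "K (w - I w) \<in> ?P" using w IW KW W II IK
        by (auto simp: blinfun.bilinear_simps subspace_diff)
      then have "B u (K (K (w - I w))) = 0" by (rule h)
      then have "B u (w - I w) = 0" using e by (simp add: KK blinfun.scaleR_right)
      then have "B u (w + I w) + B u (w - I w) = 0" using 1 by simp
      then show ?thesis by (simp add: blinfun.bilinear_simps)
    qed
    then show "u = 0" using u nd by (auto simp: nondegenerate_on_def)
  qed
  then show ?thesis using d by (auto elim!: evenE)
qed

text \<open>
  The two eigenspaces of J are isotropic and span everything, so each has half the dimension.
\<close>

lemma involution_dims:
  fixes B :: "'e::euclidean_space \<Rightarrow>\<^sub>L 'e \<Rightarrow>\<^sub>L real" and J :: "'e \<Rightarrow>\<^sub>L 'e"
  assumes nd: "nondegenerate_on B UNIV" and JJ: "\<And>v. J (J v) = v" and skew: "\<And>u v. B (J u) v = - B u (J v)"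
  shows "2 * dim {v. J v = v} = DIM('e)" "2 * dim {v. J v = - v} = DIM('e)"
proof -
  have s: "subspace {v. J v = v}" "subspace {v. J v = - v}"
    by (auto simp: subspace_def blinfun.bilinear_simps)
  have "2 * dim {v. J v = v} \<le> DIM('e)"
  proof (rule isotropic_dim[OF nd s(1)])
    show "B u v = 0" if "u \<in> {v. J v = v}" "v \<in> {v. J v = v}" for u v
      using skew[of u v] that by simp
  qed
  moreover have "2 * dim {v. J v = - v} \<le> DIM('e)"
  proof (rule isotropic_dim[OF nd s(2)])
    show "B u v = 0" if "u \<in> {v. J v = - v}" "v \<in> {v. J v = - v}" for u v
      using skew[of u v] that by (simp add: blinfun.bilinear_simps)
  qed
  moreover have "DIM('e) = dim {v. J v = v} + dim {v. J v = - v}"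
    using involution_split[of UNIV J] JJ by simp
  ultimately show "2 * dim {v. J v = v} = DIM('e)" "2 * dim {v. J v = - v} = DIM('e)" by auto
qed

text \<open>
  Since B pairs the two isotropic eigenspaces of J perfectly, there is a map phi from the first to the second with
  B (phi u) v = u . v for v in the first. The graphs of phi and - phi are a positive and a negative definite
  subspace of half the dimension.
\<close>

lemma neutral_signature:
  fixes B :: "'e::euclidean_space \<Rightarrow>\<^sub>L 'e \<Rightarrow>\<^sub>L real" and J :: "'e \<Rightarrow>\<^sub>L 'e"
  assumes nd: "nondegenerate_on B UNIV" and sym: "\<And>u v. B u v = B v u"
    and JJ: "\<And>v. J (J v) = v" and skew: "\<And>u v. B (J u) v = - B u (J v)"
    and dim: "DIM('e) = 2 * d"
  shows "has_signature B d d"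
proof -
  let ?P = "{v. J v = v}"
  have sP: "subspace ?P" by (auto simp: subspace_def blinfun.bilinear_simps)
  have dP: "dim ?P = d" using involution_dims(1)[OF nd JJ skew] dim by simp
  define H where "H = inv (gram B)"
  have linH: "linear H"
    unfolding H_def by (rule inj_linear_imp_inv_linear[OF linear_gram bij_is_inj[OF bij_gram[OF nd]]])
  have BH: "B (H u) v = u \<bullet> v" for u v
    using bij_gram[OF nd] by (simp add: H_def surj_f_inv_f bij_is_surj flip: inner_gram)
  define \<phi> where "\<phi> u = (1/2) *\<^sub>R (H u - J (H u))" for u
  have lin\<phi>: "linear \<phi>"
    by (rule linearI) (simp_all add: \<phi>_def linear_add[OF linH] linear_cmul[OF linH] blinfun.bilinear_simps algebra_simps)
  have J\<phi>: "J (\<phi> u) = - \<phi> u" for u by (simp add: \<phi>_def JJ blinfun.bilinear_simps algebra_simps)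
  have iso: "B u v = 0" if "J u = u" "J v = v" for u v using skew[of u v] that by simp
  have iso': "B u v = 0" if "J u = - u" "J v = - v" for u v
    using skew[of u v] that by (simp add: blinfun.bilinear_simps)
  have pair: "B (\<phi> u) v = u \<bullet> v" if "J v = v" for u v
    using skew[of "H u" v] that by (simp add: \<phi>_def blinfun.bilinear_simps BH)
  have sign: "\<exists>P. subspace P \<and> dim P = d \<and> (\<forall>u\<in>P. u \<noteq> 0 \<longrightarrow> c * B u u > 0)" if c: "c = 1 \<or> c = -1" for c :: real
  proof -
    define f where "f u = u + c *\<^sub>R \<phi> u" for u
    have linf: "linear f"
      by (rule linearI) (simp_all add: f_def linear_add[OF lin\<phi>] linear_cmul[OF lin\<phi>] algebra_simps)
    have Bf: "c * B (f u) (f u) = 2 * (u \<bullet> u)" if "J u = u" for u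
      using pair[OF that, of u] sym[of u "\<phi> u"] iso[OF that that] iso'[OF J\<phi> J\<phi>, of u u] c
      by (auto simp: f_def blinfun.bilinear_simps)
    have "inj_on f ?P"
    proof (rule inj_onI)
      fix u v assume uv: "u \<in> ?P" "v \<in> ?P" "f u = f v"
      then have "J (u - v) = u - v" "f (u - v) = 0"
        by (simp_all add: blinfun.bilinear_simps linear_diff[OF linf])
      then have "(u - v) \<bullet> (u - v) = 0" using Bf[of "u - v"] by (simp add: blinfun.bilinear_simps)
      then show "u = v" by simp
    qed
    then have "dim (f ` ?P) = d"
      using dim_image_eq[OF linf, of ?P] sP dP by (simp add: span_eq_iff[THEN iffD2])
    moreover have "c * B w w > 0" if w: "w \<in> f ` ?P" "w \<noteq> 0" for w
    proof -
      obtain u where u: "J u = u" "w = f u" using w by auto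
      then have "u \<noteq> 0" using w linear_0[OF linf] by auto
      then show ?thesis using Bf[OF u(1)] u(2) by simp
    qed
    ultimately show ?thesis
      using linear_subspace_image[OF linf sP] by (intro exI[of _ "f ` ?P"]) auto
  qed
  show ?thesis unfolding has_signature_def
    using sign[of 1] sign[of "-1"] dim by auto
qed

section \<open>The Nijenhuis tensor at a point\<close>

lemma span_tripleE:
  assumes "A \<in> span {J1, J2, J3 :: 'e::real_vector}"
  obtains a b c where "A = a *\<^sub>R J1 + b *\<^sub>R J2 + c *\<^sub>R J3"
  using assms by (auto simp: span_insert span_singleton algebra_simps)

lemma span_tripleI: "a *\<^sub>R J1 + b *\<^sub>R J2 + c *\<^sub>R J3 \<in> span {J1, J2, J3 :: 'e::real_vector}"
  by (intro span_add span_scale span_base) auto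

context
  fixes e1 e2 e3 :: real and J1 J2 J3 :: "'e::euclidean_space \<Rightarrow>\<^sub>L 'e"
  assumes t: "para_hypercomplex_triple e1 e2 e3 J1 J2 J3"
begin

lemma triple_commutator_in_span:
  assumes "A \<in> span {J1, J2, J3}" "B \<in> span {J1, J2, J3}"
  shows "(A o\<^sub>L B) - (B o\<^sub>L A) \<in> span {J1, J2, J3}"
proof -
  obtain a1 a2 a3 b1 b2 b3 where A: "A = a1 *\<^sub>R J1 + a2 *\<^sub>R J2 + a3 *\<^sub>R J3"
    and B: "B = b1 *\<^sub>R J1 + b2 *\<^sub>R J2 + b3 *\<^sub>R J3"
    using assms by (metis span_tripleE)
  have "(A o\<^sub>L B) - (B o\<^sub>L A) = (2 * e2 * (a3 * b2 - a2 * b3)) *\<^sub>R J1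
     + (2 * e1 * (a1 * b3 - a3 * b1)) *\<^sub>R J2 + (2 * (a1 * b2 - a2 * b1)) *\<^sub>R J3"
    by (rule blinfun_eqI, rule vector_eq_inner)
       (simp add: A B para_hypercomplex_triple_table[OF t] blinfun.bilinear_simps inner_simps algebra_simps)
  then show ?thesis by (simp only: span_tripleI)
qed

lemma triple_anticommutator_scalar:
  assumes "A \<in> span {J1, J2, J3}" "B \<in> span {J1, J2, J3}"
  shows "\<exists>s. \<forall>x. A (B x) + B (A x) = s *\<^sub>R x"
proof -
  obtain a1 a2 a3 b1 b2 b3 where A: "A = a1 *\<^sub>R J1 + a2 *\<^sub>R J2 + a3 *\<^sub>R J3"
    and B: "B = b1 *\<^sub>R J1 + b2 *\<^sub>R J2 + b3 *\<^sub>R J3"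
    using assms by (metis span_tripleE)
  have "A (B x) + B (A x) = (2 * (e1 * a1 * b1 + e2 * a2 * b2 + e3 * a3 * b3)) *\<^sub>R x" for x
    by (rule vector_eq_inner)
       (simp add: A B para_hypercomplex_triple_table[OF t] blinfun.bilinear_simps inner_simps algebra_simps)
  then show ?thesis by blast
qed

lemma triple_square_scalar:
  assumes "A \<in> span {J1, J2, J3}"
  shows "\<exists>s. \<forall>x. A (A x) = s *\<^sub>R x"
proof -
  obtain s where "\<And>x. A (A x) + A (A x) = s *\<^sub>R x"
    using triple_anticommutator_scalar[OF assms assms] by blast
  then have "2 *\<^sub>R A (A x) = s *\<^sub>R x" for x by (simp add: scaleR_2)
  then have "(1/2) *\<^sub>R (2 *\<^sub>R A (A x)) = (s / 2) *\<^sub>R x" for x by simp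
  then show ?thesis by (intro exI[of _ "s / 2"]) simp
qed

text \<open>
  Half the commutators of J with the frame are candidates. If all three squares vanished, their sum, weighted by
  the signs, would force the square of J to be 0.
\<close>

lemma exists_anticommuting_nonnull:
  assumes J: "J \<in> span {J1, J2, J3}" and JJ: "\<And>x. J (J x) = e *\<^sub>R x" and e: "e \<noteq> 0"
  obtains K d where "K \<in> span {J1, J2, J3}" "d \<noteq> 0" "\<And>x. K (K x) = d *\<^sub>R x" "\<And>x. K (J x) = - J (K x)"
proof -
  obtain a1 a2 a3 where A: "J = a1 *\<^sub>R J1 + a2 *\<^sub>R J2 + a3 *\<^sub>R J3"
    using J by (metis span_tripleE)
  note T = para_hypercomplex_triple_table[OF t] and s = para_hypercomplex_triple_signs[OF t]
  have JJ': "J (J x) = (e1 * a1\<^sup>2 + e2 * a2\<^sup>2 + e3 * a3\<^sup>2) *\<^sub>R x" for x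
    by (rule vector_eq_inner) (simp add: A T blinfun.bilinear_simps inner_simps algebra_simps power2_eq_square)
  obtain x :: 'e where x: "x \<noteq> 0" by (metis SOME_Basis nonzero_Basis)
  have q: "e1 * a1\<^sup>2 + e2 * a2\<^sup>2 + e3 * a3\<^sup>2 \<noteq> 0" using JJ[of x] JJ'[of x] x e by auto
  define K1 where "K1 = a2 *\<^sub>R J3 + (e1 * a3) *\<^sub>R J2"
  define K2 where "K2 = a1 *\<^sub>R J3 + (e2 * a3) *\<^sub>R J1"
  define K3 where "K3 = (e1 * a1) *\<^sub>R J2 - (e2 * a2) *\<^sub>R J1"
  have in_span: "K1 \<in> span {J1, J2, J3}" "K2 \<in> span {J1, J2, J3}" "K3 \<in> span {J1, J2, J3}"
    unfolding K1_def K2_def K3_def by (intro span_add span_diff span_scale span_base; simp)+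
  have e3: "e3 = - e1 * e2" by (rule s)
  have ee: "e1 * e1 = 1" "e2 * e2 = 1" "\<And>z. e1 * (e1 * z) = z" "\<And>z. e2 * (e2 * z) = z"
    using s by (simp_all flip: mult.assoc)
  have anti: "K1 (J x) = - J (K1 x)" "K2 (J x) = - J (K2 x)" "K3 (J x) = - J (K3 x)" for x
    by (rule vector_eq_inner;
        simp add: A K1_def K2_def K3_def T e3 blinfun.bilinear_simps inner_simps algebra_simps ee)+
  have sq: "K1 (K1 x) = (e3 * a2\<^sup>2 + e2 * a3\<^sup>2) *\<^sub>R x" "K2 (K2 x) = (e3 * a1\<^sup>2 + e1 * a3\<^sup>2) *\<^sub>R x"
     "K3 (K3 x) = (e2 * a1\<^sup>2 + e1 * a2\<^sup>2) *\<^sub>R x" for x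
    by (rule vector_eq_inner;
        simp add: A K1_def K2_def K3_def T e3 blinfun.bilinear_simps inner_simps algebra_simps power2_eq_square ee)+
  have "e3 * a2\<^sup>2 + e2 * a3\<^sup>2 \<noteq> 0 \<or> e3 * a1\<^sup>2 + e1 * a3\<^sup>2 \<noteq> 0 \<or> e2 * a1\<^sup>2 + e1 * a2\<^sup>2 \<noteq> 0"
    using q t by (auto simp: para_hypercomplex_triple_def para_quaternionic_signs_def)
  then show thesis using that in_span anti sq by metis
qed

text \<open>
  J, K and JK are independent by the quaternion relations, and a space spanned by three elements contains no
  four independent ones.
\<close>

lemma span_eq_of_anticommuting:
  assumes J: "J \<in> span {J1, J2, J3}" and JJ: "\<And>x. J (J x) = e *\<^sub>R x" and e: "e \<noteq> 0"
    and K: "K \<in> span {J1, J2, J3}" and KK: "\<And>x. K (K x) = d *\<^sub>R x" and d: "d \<noteq> 0"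
    and KJ: "\<And>x. K (J x) = - J (K x)"
  shows "span {J1, J2, J3} = span {J, K, J o\<^sub>L K}"
proof
  have "J o\<^sub>L K = (1/2) *\<^sub>R ((J o\<^sub>L K) - (K o\<^sub>L J))"
    by (rule blinfun_eqI) (simp add: blinfun.bilinear_simps KJ flip: scaleR_2)
  also have "\<dots> \<in> span {J1, J2, J3}"
    by (intro span_scale triple_commutator_in_span J K)
  finally have JK: "J o\<^sub>L K \<in> span {J1, J2, J3}" .
  show "span {J, K, J o\<^sub>L K} \<subseteq> span {J1, J2, J3}"
    using J K JK by (intro span_minimal) auto
  have lin0: "b = 0 \<and> c = 0 \<and> f = 0" if "b *\<^sub>R J + c *\<^sub>R K + f *\<^sub>R (J o\<^sub>L K) = 0" for b c f
  proof -
    have "0 *\<^sub>R x + b *\<^sub>R J x + c *\<^sub>R K x + f *\<^sub>R J (K x) = 0" for x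
      using arg_cong[OF that, of "\<lambda>A. blinfun_apply A x"] by (simp add: blinfun.bilinear_simps)
    from quaternion_independent[OF JJ KK KJ e d this] show ?thesis by simp
  qed
  have ne: "J \<noteq> K" "J \<noteq> J o\<^sub>L K" "K \<noteq> J o\<^sub>L K"
    using lin0[of 1 "-1" 0] lin0[of 1 0 "-1"] lin0[of 0 1 "-1"] by auto
  have ind: "independent {J, K, J o\<^sub>L K}"
  proof -
    have "J o\<^sub>L K \<noteq> 0" using lin0[of 0 0 1] by auto
    moreover have "K \<notin> span {J o\<^sub>L K}"
    proof
      assume "K \<in> span {J o\<^sub>L K}"
      then obtain k where "K = k *\<^sub>R (J o\<^sub>L K)" by (auto simp: span_singleton)
      then show False using lin0[of 0 1 "- k"] by simp
    qed
    moreover have "J \<notin> span {K, J o\<^sub>L K}"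
    proof
      assume "J \<in> span {K, J o\<^sub>L K}"
      then obtain k l where "J = k *\<^sub>R K + l *\<^sub>R (J o\<^sub>L K)"
        by (auto simp: span_insert span_singleton algebra_simps)
      then have "J - (k *\<^sub>R K + l *\<^sub>R (J o\<^sub>L K)) = 0" by (metis diff_self)
      moreover have "1 *\<^sub>R J + (- k) *\<^sub>R K + (- l) *\<^sub>R (J o\<^sub>L K) = J - (k *\<^sub>R K + l *\<^sub>R (J o\<^sub>L K))"
        by (simp add: algebra_simps)
      ultimately show False using lin0[of 1 "- k" "- l"] by (metis one_neq_zero)
    qed
    ultimately show ?thesis by (intro independent_insertI independent_empty) simp_all
  qed
  show "span {J1, J2, J3} \<subseteq> span {J, K, J o\<^sub>L K}"
  proof (rule ccontr)
    assume "\<not> ?thesis"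
    then obtain A where A: "A \<in> span {J1, J2, J3}" "A \<notin> span {J, K, J o\<^sub>L K}" by (meson subsetI)
    have "independent (insert A {J, K, J o\<^sub>L K})"
      by (rule independent_insertI[OF A(2) ind])
    moreover have nin: "A \<notin> {J, K, J o\<^sub>L K}" using A(2) span_base by metis
    moreover have "insert A {J, K, J o\<^sub>L K} \<subseteq> span {J1, J2, J3}" using A J K JK by simp
    ultimately have "card (insert A {J, K, J o\<^sub>L K}) \<le> card {J1, J2, J3}"
      using independent_span_bound[of "{J1, J2, J3}" "insert A {J, K, J o\<^sub>L K}"] by simp
    moreover have "card {J1, J2, J3} \<le> 3"
      by (simp add: card_insert_if)
    moreover have "card (insert A {J, K, J o\<^sub>L K}) = 4"
      using ne nin by (simp add: card_insert_if)
    ultimately show False by linarith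
  qed
qed

end

definition pullback_form :: "('e::euclidean_space \<Rightarrow>\<^sub>L 'e \<Rightarrow>\<^sub>L real) \<Rightarrow> ('m::euclidean_space \<Rightarrow>\<^sub>L 'e) \<Rightarrow> 'm \<Rightarrow>\<^sub>L 'm \<Rightarrow>\<^sub>L real" where
  "pullback_form B D = Blinfun (\<lambda>u. B (D u) o\<^sub>L D)"

lemma pullback_form_apply: "pullback_form B D u v = B (D u) (D v)"
proof -
  have "bounded_linear (\<lambda>u. B (D u) o\<^sub>L D)"
    by (intro bounded_linear_intros)
  then show ?thesis by (simp add: pullback_form_def bounded_linear_Blinfun_apply)
qed

lemma nondegenerate_pullback_form:
  assumes "nondegenerate_on B (range (blinfun_apply D))" "inj (blinfun_apply D)"
  shows "nondegenerate_on (pullback_form B D) UNIV"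
  using assms unfolding nondegenerate_on_def pullback_form_apply
  by (auto simp: inj_def)

text \<open>
  In the application D is the differential of the immersion, j the restriction of J to the submanifold, and F is
  built from the covariant derivative of J; the tangency of F X (D Y) - F Y (D X) is the part of the
  Nijenhuis identity used here. Write F X = (al X + be X J) K with K anticommuting with J. The largest invariant
  subspace of range D is the image of W = {v. K (D v) in range D}, and the tangency says that
  al X Y - be X jY - al Y X + be Y jX lies in W. Together with F not 0 this bounds the codimension of W by 2. But W
  and the whole space have dimensions divisible by 4, because the form is nondegenerate on the image of W, so W is
  everything.
\<close>

lemma nijenhuis_tensor_forces_invariance:
  fixes G :: "'e::euclidean_space \<Rightarrow>\<^sub>L 'e \<Rightarrow>\<^sub>L real" and D :: "'m::euclidean_space \<Rightarrow>\<^sub>L 'e"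
    and I1 I2 I3 J :: "'e \<Rightarrow>\<^sub>L 'e" and j :: "'m \<Rightarrow>\<^sub>L 'm" and F :: "'m \<Rightarrow> 'e \<Rightarrow>\<^sub>L 'e"
  assumes st: "skew_triple G e1 e2 e3 I1 I2 I3"
    and eps: "eps \<in> {-1, 1}" and dim: "DIM('m) = 4 * k"
    and injD: "inj D" and nd: "nondegenerate_on G (range D)"
    and J: "J \<in> span {I1, I2, I3}" "\<And>x. J (J x) = eps *\<^sub>R x" and Jj: "\<And>u. J (D u) = D (j u)"
    and Flin: "linear F" and FQ: "\<And>X. F X \<in> span {I1, I2, I3}" and FJ: "\<And>X x. F X (J x) = - J (F X x)"
    and Fj: "\<And>X x. F (j X) x = - J (F X x)"
    and Ftan: "\<And>X Y. F X (D Y) - F Y (D X) \<in> range D" and F0: "F X0 \<noteq> 0"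
    and ndT: "nondegenerate_on G {v \<in> range D. \<forall>A\<in>span {I1, I2, I3}. A v \<in> range D}"
  shows "\<forall>A\<in>span {I1, I2, I3}. blinfun_apply A ` range D \<subseteq> range D"
proof -
  interpret skew_triple G e1 e2 e3 I1 I2 I3 by (rule st)
  let ?Q = "span {I1, I2, I3}" and ?S = "range (blinfun_apply D)"
  have eps0: "eps \<noteq> 0" and eps2: "eps * eps = 1" using eps by auto
  have linD: "linear D" by (simp add: bounded_linear.linear blinfun.bounded_linear_right)
  have sS: "subspace ?S" using linear_subspace_image[OF linD subspace_UNIV] .
  have skQ: "G (A u) v = - G u (A v)" if AQ: "A \<in> ?Q" for A u v
  proof -
    obtain a b c where "A = a *\<^sub>R I1 + b *\<^sub>R I2 + c *\<^sub>R I3" using AQ by (rule span_tripleE)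
    then show ?thesis by (simp add: blinfun.bilinear_simps skew algebra_simps)
  qed
  obtain K d where K: "K \<in> ?Q" and d: "d \<noteq> 0" and KK: "\<And>x. K (K x) = d *\<^sub>R x" and KJ: "\<And>x. K (J x) = - J (K x)"
    using exists_anticommuting_nonnull[OF triple J eps0] by blast
  have Qspan: "?Q = span {J, K, J o\<^sub>L K}"
    by (rule span_eq_of_anticommuting[OF triple J eps0 K KK d KJ])
  note ind = quaternion_independent[OF J(2) KK KJ eps0 d]
  have injK: "K x = 0 \<Longrightarrow> x = 0" for x using KK[of x] d by (auto simp: blinfun.zero_right)
  define W where "W = {v. K (D v) \<in> ?S}"
  have sW: "subspace W" using sS
    by (auto simp: W_def subspace_def blinfun.bilinear_simps simp del: rangeI image_iff)
  have JS: "x \<in> ?S \<Longrightarrow> J x \<in> ?S" for x using Jj by auto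
  have jW: "j v \<in> W" if "v \<in> W" for v
  proof -
    have "K (D (j v)) = - J (K (D v))" by (simp add: KJ flip: Jj)
    then show ?thesis using that JS sS by (auto simp: W_def subspace_neg)
  qed
  have inT: "A (D v) \<in> ?S" if vW: "v \<in> W" and AQ: "A \<in> ?Q" for v A
  proof -
    obtain a b c where "A = a *\<^sub>R J + b *\<^sub>R K + c *\<^sub>R (J o\<^sub>L K)"
      using AQ unfolding Qspan by (rule span_tripleE)
    then have "A (D v) = a *\<^sub>R J (D v) + b *\<^sub>R K (D v) + c *\<^sub>R J (K (D v))"
      by (simp add: blinfun.bilinear_simps)
    then show ?thesis using vW JS sS by (auto simp: W_def intro!: subspace_add subspace_scale)
  qed
  have T_eq: "{v \<in> ?S. \<forall>A\<in>?Q. A v \<in> ?S} = D ` W"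
    using inT K by (auto simp: W_def)
  have "\<exists>a b. F X = a *\<^sub>R K + b *\<^sub>R (J o\<^sub>L K)" for X
  proof -
    obtain a b c where F: "F X = a *\<^sub>R J + b *\<^sub>R K + c *\<^sub>R (J o\<^sub>L K)"
      using FQ[of X] unfolding Qspan by (rule span_tripleE)
    have "(2 * a * eps) *\<^sub>R x + 0 *\<^sub>R J x + 0 *\<^sub>R K x + 0 *\<^sub>R J (K x) = 0" for x
    proof -
      have "F X (J x) + J (F X x) = 0" using FJ[of X x] by simp
      then show ?thesis
        by (simp add: F J(2) KJ blinfun.bilinear_simps algebra_simps flip: scaleR_2)
    qed
    then have "a = 0" using ind eps0 by fastforce
    then show ?thesis using F by auto
  qed
  then obtain al be where F: "\<And>X. F X = al X *\<^sub>R K + be X *\<^sub>R (J o\<^sub>L K)" by metis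
  have uniq: "a = a' \<and> b = b'" if "a *\<^sub>R K + b *\<^sub>R (J o\<^sub>L K) = a' *\<^sub>R K + b' *\<^sub>R (J o\<^sub>L K)" for a b a' b'
  proof -
    have "0 *\<^sub>R x + 0 *\<^sub>R J x + (a - a') *\<^sub>R K x + (b - b') *\<^sub>R J (K x) = 0" for x
      using arg_cong[OF that, of "\<lambda>A. blinfun_apply A x"] by (simp add: blinfun.bilinear_simps algebra_simps)
    from ind[OF this] show ?thesis by simp
  qed
  have lin: "linear al" "linear be"
  proof -
    have "al (X + Y) = al X + al Y \<and> be (X + Y) = be X + be Y" for X Y
      by (rule uniq) (simp add: linear_add[OF Flin] scaleR_add_left flip: F, simp add: F algebra_simps)
    moreover have "al (c *\<^sub>R X) = c * al X \<and> be (c *\<^sub>R X) = c * be X" for c X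
      by (rule uniq) (simp add: linear_cmul[OF Flin] flip: F, simp add: F algebra_simps)
    ultimately show "linear al" "linear be" by (auto intro!: linearI)
  qed
  have jal: "al (j X) = - eps * be X" "be (j X) = - al X" for X
  proof -
    have "al (j X) *\<^sub>R K + be (j X) *\<^sub>R (J o\<^sub>L K) = (- eps * be X) *\<^sub>R K + (- al X) *\<^sub>R (J o\<^sub>L K)"
      unfolding F[symmetric]
      by (rule blinfun_eqI) (simp only: Fj, simp add: F blinfun.bilinear_simps J(2))
    from uniq[OF this] show "al (j X) = - eps * be X" "be (j X) = - al X" by auto
  qed
  have V: "al X *\<^sub>R Y - be X *\<^sub>R j Y - al Y *\<^sub>R X + be Y *\<^sub>R j X \<in> W" for X Y
  proof -
    have "K (D (al X *\<^sub>R Y - be X *\<^sub>R j Y - al Y *\<^sub>R X + be Y *\<^sub>R j X)) = F X (D Y) - F Y (D X)"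
      by (simp add: F blinfun.bilinear_simps KJ flip: Jj)
    then show ?thesis using Ftan[of X Y] by (simp add: W_def)
  qed
  have jj: "j (j v) = eps *\<^sub>R v" for v
  proof -
    have "D (j (j v)) = D (eps *\<^sub>R v)" by (simp add: J(2) blinfun.scaleR_right flip: Jj)
    then show ?thesis using injD by (simp add: inj_eq)
  qed
  define g where "g = pullback_form G D"
  have g: "g u v = G (D u) (D v)" for u v by (simp add: g_def pullback_form_apply)
  have gnd: "nondegenerate_on g UNIV" unfolding g_def by (rule nondegenerate_pullback_form[OF nd injD])
  have gskew: "g (j u) v = - g u (j v)" for u v by (simp add: g skQ[OF J(1)] flip: Jj)
  \<comment> \<open>If some al X + be X J is invertible, then W contains the common kernel of al and be. Otherwise eps = 1 and
    al = s be with s = 1 or s = -1; then W contains all but one dimension of an eigenspace of j, and K carries this part into the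
    other eigenspace.\<close>
  have codim: "4 * k \<le> dim W + 2"
  proof (cases "\<exists>X. (al X)\<^sup>2 - eps * (be X)\<^sup>2 \<noteq> 0")
    case True
    then obtain X where X: "(al X)\<^sup>2 - eps * (be X)\<^sup>2 \<noteq> 0" by blast
    have "{Y \<in> {Y \<in> UNIV. al Y = 0}. be Y = 0} \<subseteq> W"
    proof clarify
      fix Y assume Y: "al Y = 0" "be Y = 0"
      have v: "al X *\<^sub>R Y - be X *\<^sub>R j Y \<in> W" using V[of X Y] Y by simp
      have "al X *\<^sub>R (al X *\<^sub>R Y - be X *\<^sub>R j Y) + be X *\<^sub>R j (al X *\<^sub>R Y - be X *\<^sub>R j Y) \<in> W"
        using v jW[OF v] sW by (intro subspace_add subspace_scale)
      also have "al X *\<^sub>R (al X *\<^sub>R Y - be X *\<^sub>R j Y) + be X *\<^sub>R j (al X *\<^sub>R Y - be X *\<^sub>R j Y)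
        = ((al X)\<^sup>2 - eps * (be X)\<^sup>2) *\<^sub>R Y"
        by (simp add: blinfun.bilinear_simps jj algebra_simps power2_eq_square)
      finally have "(1 / ((al X)\<^sup>2 - eps * (be X)\<^sup>2)) *\<^sub>R (((al X)\<^sup>2 - eps * (be X)\<^sup>2) *\<^sub>R Y) \<in> W"
        by (rule subspace_scale[OF sW])
      then show "Y \<in> W" using X by simp
    qed
    then have "dim {Y \<in> {Y \<in> UNIV. al Y = 0}. be Y = 0} \<le> dim W" by (rule dim_subset)
    moreover have "dim {Y \<in> UNIV. al Y = 0} \<le> dim {Y \<in> {Y \<in> UNIV. al Y = 0}. be Y = 0} + 1"
      using lin(1) by (intro dim_kernel_Int lin(2)) (auto simp: subspace_def linear_0 linear_add linear_cmul)
    moreover have "dim (UNIV :: 'm set) \<le> dim {Y \<in> UNIV. al Y = 0} + 1"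
      by (intro dim_kernel_Int lin(1)) simp
    ultimately show ?thesis using dim by simp
  next
    case False
    then have sq: "(al X)\<^sup>2 = eps * (be X)\<^sup>2" for X by auto
    have alX0: "al X0 \<noteq> 0"
    proof
      assume "al X0 = 0"
      then have "be X0 = 0" using sq[of X0] eps0 by simp
      then show False using F0 F \<open>al X0 = 0\<close> by simp
    qed
    have eps1: "eps = 1"
    proof (rule ccontr)
      assume "eps \<noteq> 1"
      then have "(al X0)\<^sup>2 = - (be X0)\<^sup>2" using sq[of X0] eps by auto
      then show False using alX0 by (metis neg_le_0_iff_le not_le zero_le_power2 zero_less_power2)
    qed
    define s where "s = be X0 / al X0"
    have s2: "s * s = 1" using sq[of X0] eps1 alX0 by (auto simp: s_def power2_eq_square)
    \<comment> \<open>Polarizing the identity of the squares of al and be.\<close>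
    have bes: "be X = s * al X" for X
    proof -
      have "(al X0 + al X)\<^sup>2 = (be X0 + be X)\<^sup>2"
        using sq[of "X0 + X"] eps1 by (simp add: linear_add[OF lin(1)] linear_add[OF lin(2)])
      then have "al X0 * al X = be X0 * be X" using sq[of X] sq[of X0] eps1
        by (simp add: power2_eq_square algebra_simps)
      also have "be X0 = s * al X0" using alX0 by (simp add: s_def)
      finally have "al X0 * al X = al X0 * (s * be X)" by (simp only: ac_simps)
      then have "al X = s * be X" using alX0 by simp
      then show ?thesis using s2 by (simp flip: mult.assoc)
    qed
    define L where "L = {v \<in> {v. s *\<^sub>R j v = - v}. al v = 0}"
    have ss: "subspace {v. s *\<^sub>R j v = - v}"
    proof (rule subspaceI; clarsimp)
      show "s *\<^sub>R j (x + y) = - x - y" if "s *\<^sub>R j x = - x" "s *\<^sub>R j y = - y" for x y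
        using that by (simp add: blinfun.add_right scaleR_add_right)
      show "s *\<^sub>R j (c *\<^sub>R x) = - (c *\<^sub>R x)" if "s *\<^sub>R j x = - x" for c x
        using that by (metis blinfun.scaleR_right scaleR_left_commute scaleR_minus_right)
    qed
    have sL: "subspace L" unfolding L_def using ss lin(1)
      by (auto simp: subspace_def linear_0 linear_add linear_cmul)
    have LW: "L \<subseteq> W"
    proof
      fix v assume v: "v \<in> L"
      have "al X0 *\<^sub>R v - be X0 *\<^sub>R j v \<in> W" using V[of X0 v] v bes[of v] by (simp add: L_def)
      also have "al X0 *\<^sub>R v - be X0 *\<^sub>R j v = al X0 *\<^sub>R (v - s *\<^sub>R j v)"
        by (simp add: bes[of X0] algebra_simps)
      also have "\<dots> = (2 * al X0) *\<^sub>R v" using v by (simp add: L_def mult.commute flip: scaleR_2)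
      finally have "(1 / (2 * al X0)) *\<^sub>R ((2 * al X0) *\<^sub>R v) \<in> W" by (rule subspace_scale[OF sW])
      then show "v \<in> W" using alX0 by simp
    qed
    have "2 * dim {v. (s *\<^sub>R j) v = - v} = DIM('m)"
    proof (rule involution_dims(2)[OF gnd])
      show "(s *\<^sub>R j) ((s *\<^sub>R j) v) = v" for v
        by (simp add: blinfun.bilinear_simps jj eps1 s2)
      show "g ((s *\<^sub>R j) u) v = - g u ((s *\<^sub>R j) v)" for u v
        by (simp add: blinfun.bilinear_simps gskew)
    qed
    then have "2 * dim {v. s *\<^sub>R j v = - v} = 4 * k" using dim by (simp add: blinfun.scaleR_left)
    moreover have "dim {v. s *\<^sub>R j v = - v} \<le> dim L + 1"
      unfolding L_def by (rule dim_kernel_Int[OF lin(1) ss])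
    ultimately have dL: "2 * k \<le> dim L + 1" by simp
    have dimD: "dim (D ` A) = dim A" for A
      by (rule dim_image_eq[OF linD]) (use injD in \<open>blast intro: inj_on_subset\<close>)
    have linK: "linear K" by (simp add: bounded_linear.linear blinfun.bounded_linear_right)
    have injKm: "inj K" unfolding linear_injective_0[OF linK] using injK by blast
    have dimK: "dim (K ` A) = dim A" for A
      by (rule dim_image_eq[OF linK]) (use injKm in \<open>blast intro: inj_on_subset\<close>)
    have sDW: "subspace (D ` W)" "subspace (D ` L)" "subspace (K ` D ` L)"
      by (intro linear_subspace_image linD linK sW sL)+
    have "K ` D ` L \<subseteq> D ` W"
    proof clarify
      fix v assume "v \<in> L"
      then have "v \<in> W" using LW by blast
      then obtain w where w: "K (D v) = D w" by (auto simp: W_def)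
      then have "K (D w) = d *\<^sub>R D v" by (simp add: KK flip: w)
      then have "K (D w) \<in> ?S" using sS by (simp add: subspace_scale)
      then show "K (D v) \<in> D ` W" using w by (auto simp: W_def)
    qed
    then have "dim (D ` L) + dim (K ` D ` L) \<le> dim (D ` W)"
    proof (intro dim_sum_le sDW)
      show "D ` L \<inter> K ` D ` L \<subseteq> {0}"
      proof clarify
        fix u v assume uv: "u \<in> L" "v \<in> L" "D u = K (D v)"
        have "s *\<^sub>R J (D u) = - D u"
          using uv(1) by (simp add: L_def Jj flip: blinfun.scaleR_right blinfun.minus_right)
        moreover have "s *\<^sub>R J (K (D v)) = K (D v)"
        proof -
          have "s *\<^sub>R J (K (D v)) = - K (s *\<^sub>R J (D v))" by (simp add: KJ blinfun.scaleR_right)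
          also have "s *\<^sub>R J (D v) = - D v"
            using uv(2) by (simp add: L_def Jj flip: blinfun.scaleR_right blinfun.minus_right)
          finally show ?thesis by (simp add: blinfun.minus_right)
        qed
        ultimately have "D u = - D u" using uv(3) by metis
        then have "2 *\<^sub>R D u = 0" unfolding scaleR_2 by (metis add.right_inverse)
        then show "D u = 0" by simp
      qed
      show "D ` L \<subseteq> D ` W" using LW by blast
    qed auto
    then show ?thesis using dL dimD dimK by simp
  qed
  have dimDW: "dim (D ` W) = dim W"
    by (rule dim_image_eq[OF linD]) (use injD in \<open>blast intro: inj_on_subset\<close>)
  have QT: "A v \<in> D ` W" if AQ: "A \<in> ?Q" and vW: "v \<in> D ` W" for A v
  proof -
    obtain w where w: "w \<in> W" "v = D w" using vW by blast
    obtain u where u: "A (D w) = D u" using inT[OF w(1) AQ] by blast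
    have "K (A (D w)) \<in> ?S"
    proof -
      obtain s where "K (A x) + A (K x) = s *\<^sub>R x" for x
        using triple_anticommutator_scalar[OF triple K AQ] by blast
      then have eq: "K (A (D w)) = s *\<^sub>R D w - A (K (D w))" by (metis add_diff_cancel)
      obtain a b c where A: "A = a *\<^sub>R J + b *\<^sub>R K + c *\<^sub>R (J o\<^sub>L K)"
        using AQ unfolding Qspan by (rule span_tripleE)
      have "A (K (D w)) = a *\<^sub>R J (K (D w)) + b *\<^sub>R d *\<^sub>R D w + c *\<^sub>R d *\<^sub>R J (D w)"
        by (simp add: A KK blinfun.bilinear_simps)
      then have "A (K (D w)) \<in> ?S" using w(1) JS sS
        by (auto simp: W_def intro!: subspace_add subspace_scale)
      then show ?thesis unfolding eq using sS by (intro subspace_diff subspace_scale) auto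
    qed
    then have "u \<in> W" using u by (simp add: W_def)
    then show ?thesis using u w by auto
  qed
  have "4 dvd dim (D ` W)"
  proof -
    have sDW: "subspace (D ` W)" by (rule linear_subspace_image[OF linD sW])
    have in_Q: "I1 \<in> ?Q" "I2 \<in> ?Q" by (auto intro: span_base)
    note * = four_dvd_dim_invariant[OF sym sDW ndT[unfolded T_eq]]
    have "e1 = 1 \<or> e2 = 1" using triple by (auto simp: para_hypercomplex_triple_def para_quaternionic_signs_def)
    then show ?thesis
    proof
      assume "e1 = 1"
      then show ?thesis using signs
        by (intro *[of I1 I2 e2]) (auto simp: table skew intro: QT in_Q)
    next
      assume "e2 = 1"
      then show ?thesis using signs
        by (intro *[of I2 I1 e1]) (auto simp: table skew intro: QT in_Q)
    qed
  qed
  then obtain l where l: "dim W = 4 * l" using dimDW by auto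
  have "dim W \<le> 4 * k" using dim_subset_UNIV[of W] dim by simp
  then have "dim W = 4 * k" using l codim by presburger
  then have "W = UNIV" using subspace_dim_equal[OF sW subspace_UNIV] dim by simp
  then show ?thesis using inT by auto
qed

section \<open>The Levi-Civita connection in coordinates\<close>

lemma has_derivative_eq_on_open:
  assumes "open S" "y \<in> S" "\<And>z. z \<in> S \<Longrightarrow> f z = g z"
    and "(f has_derivative f') (at y)" "(g has_derivative g') (at y)"
  shows "f' h = g' h"
proof -
  have "(g has_derivative f') (at y)"
    using assms(4) has_derivative_cong_open[OF assms(1,2), of f g] assms(3) by blast
  then have "f' = g'" using assms(5) by (rule has_derivative_unique)
  then show ?thesis by simp
qed

lemma has_derivative_blinfun_apply:
  assumes "(F has_derivative F') (at y)" "(g has_derivative g') (at y)"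
  shows "((\<lambda>z. blinfun_apply (F z) (g z)) has_derivative (\<lambda>h. F y (g' h) + F' h (g y))) (at y)"
  by (rule bounded_bilinear.FDERIV[OF bounded_bilinear_blinfun_apply assms])

lemma has_derivative_blinfun_apply_const:
  assumes "(F has_derivative F') (at y)"
  shows "((\<lambda>z. blinfun_apply (F z) v) has_derivative (\<lambda>h. F' h v)) (at y)"
  using has_derivative_blinfun_apply[OF assms has_derivative_const[of v]] by (simp add: blinfun.zero_right)

lemma has_derivative_blinfun_compose:
  assumes "(F has_derivative F') (at y)" "(g has_derivative g') (at y)"
  shows "((\<lambda>z. F z o\<^sub>L g z) has_derivative (\<lambda>h. (F y o\<^sub>L g' h) + (F' h o\<^sub>L g y))) (at y)"
  by (rule bounded_bilinear.FDERIV[OF bounded_bilinear_blinfun_compose assms])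

definition blinfun2 :: "('a::euclidean_space \<Rightarrow> 'b::euclidean_space \<Rightarrow> 'c::real_normed_vector) \<Rightarrow> 'a \<Rightarrow>\<^sub>L 'b \<Rightarrow>\<^sub>L 'c" where
  "blinfun2 f = Blinfun (\<lambda>x. Blinfun (f x))"

lemma Blinfun_linear:
  fixes f :: "'a::euclidean_space \<Rightarrow> 'b::real_normed_vector"
  assumes "linear f"
  shows "Blinfun f x = f x"
  using assms by (simp add: bounded_linear_Blinfun_apply linear_conv_bounded_linear)

lemma blinfun2_apply:
  assumes "\<And>x. linear (f x)" "\<And>y. linear (\<lambda>x. f x y)"
  shows "blinfun2 f x y = f x y"
proof -
  have "linear (\<lambda>x. Blinfun (f x))"
    by (rule linearI; rule blinfun_eqI;
        simp add: Blinfun_linear[OF assms(1)] blinfun.bilinear_simps linear_add[OF assms(2)] linear_cmul[OF assms(2)])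
  then show ?thesis by (simp add: blinfun2_def Blinfun_linear assms(1))
qed

text \<open>
  Index raising: the inverse of the operator u |-> B u from vectors to functionals.
\<close>

definition raise :: "('e::euclidean_space \<Rightarrow>\<^sub>L 'e \<Rightarrow>\<^sub>L real) \<Rightarrow> ('e \<Rightarrow>\<^sub>L real) \<Rightarrow>\<^sub>L 'e" where
  "raise B = Blinfun (\<lambda>\<phi>. inv (gram B) (\<Sum>b\<in>Basis. blinfun_apply \<phi> b *\<^sub>R b))"

lemma raise_works:
  fixes B :: "'e::euclidean_space \<Rightarrow>\<^sub>L 'e \<Rightarrow>\<^sub>L real"
  assumes "nondegenerate_on B UNIV"
  shows "B (raise B \<phi>) v = \<phi> v" and "raise B (B u) = u"
proof -
  have bij: "bij (gram B)" by (rule bij_gram[OF assms])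
  have linH: "linear (inv (gram B))"
    by (rule inj_linear_imp_inv_linear[OF linear_gram bij_is_inj[OF bij]])
  have "bounded_linear (\<lambda>\<phi>. \<Sum>b\<in>Basis. blinfun_apply \<phi> b *\<^sub>R b)"
    by (intro bounded_linear_sum bounded_linear_intros)
  then have "bounded_linear (\<lambda>\<phi>. inv (gram B) (\<Sum>b\<in>Basis. blinfun_apply \<phi> b *\<^sub>R b))"
    by (rule bounded_linear_compose[OF linH[unfolded linear_conv_bounded_linear]])
  then have r: "raise B \<phi> = inv (gram B) (\<Sum>b\<in>Basis. \<phi> b *\<^sub>R b)" for \<phi>
    by (simp add: raise_def bounded_linear_Blinfun_apply)
  have "B (raise B \<phi>) v = (\<Sum>b\<in>Basis. \<phi> b *\<^sub>R b) \<bullet> v"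
    using bij by (simp add: r surj_f_inv_f bij_is_surj flip: inner_gram)
  also have "\<dots> = (\<Sum>b\<in>Basis. (v \<bullet> b) *\<^sub>R \<phi> b)"
    by (simp add: inner_sum_left) (simp add: inner_commute mult.commute)
  also have "\<dots> = \<phi> v"
    by (rule linear_basis_sum[symmetric]) (simp add: bounded_linear.linear blinfun.bounded_linear_right)
  finally show "B (raise B \<phi>) v = \<phi> v" .
  have "raise B (B u) = inv (gram B) (gram B u)" by (simp add: r gram_def)
  then show "raise B (B u) = u" using bij by (simp add: bij_is_inj)
qed

lemma smooth_on_raise:
  assumes "open S" "smooth_on S G" "\<And>y. y \<in> S \<Longrightarrow> nondegenerate_on (G y) UNIV"
  shows "smooth_on S (\<lambda>y. raise (G y))"
  by (rule smooth_on_inverse[OF assms(1,2)])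
     (auto intro!: blinfun_eqI simp: raise_works assms(3))

definition is_christoffel :: "('e::euclidean_space \<Rightarrow> 'e \<Rightarrow>\<^sub>L 'e \<Rightarrow>\<^sub>L real) \<Rightarrow> 'e \<Rightarrow> ('e \<Rightarrow>\<^sub>L 'e \<Rightarrow>\<^sub>L 'e) \<Rightarrow> bool" where
  "is_christoffel G z \<Gamma> \<longleftrightarrow> (\<forall>X Y. \<Gamma> X Y = \<Gamma> Y X) \<and>
     (\<forall>X Y Z. frechet_derivative G (at z) X Y Z = G z (\<Gamma> X Y) Z + G z Y (\<Gamma> X Z))"

text \<open>
  The Christoffel form of a metric on an open set of the model space. For the coordinate expression of a metric
  in a chart it is the Levi-Civita connection of that chart.
\<close>

definition christoffel :: "('e::euclidean_space \<Rightarrow> 'e \<Rightarrow>\<^sub>L 'e \<Rightarrow>\<^sub>L real) \<Rightarrow> 'e \<Rightarrow> 'e \<Rightarrow>\<^sub>L 'e \<Rightarrow>\<^sub>L 'e" where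
  "christoffel G z = (THE \<Gamma>. is_christoffel G z \<Gamma>)"

definition coord_curvature :: "('e::euclidean_space \<Rightarrow> 'e \<Rightarrow>\<^sub>L 'e \<Rightarrow>\<^sub>L 'e) \<Rightarrow> 'e \<Rightarrow> 'e \<Rightarrow> 'e \<Rightarrow> 'e \<Rightarrow>\<^sub>L 'e" where
  "coord_curvature \<Gamma> z X Y = der \<Gamma> z X Y - der \<Gamma> z Y X + (\<Gamma> z X o\<^sub>L \<Gamma> z Y) - (\<Gamma> z Y o\<^sub>L \<Gamma> z X)"

locale local_metric =
  fixes U :: "'e::euclidean_space set" and G :: "'e \<Rightarrow> 'e \<Rightarrow>\<^sub>L 'e \<Rightarrow>\<^sub>L real"
  assumes open_U: "open U" and smooth_G: "smooth_on U G"
    and G_sym: "\<And>z u v. z \<in> U \<Longrightarrow> G z u v = G z v u"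
    and G_nondeg: "\<And>z. z \<in> U \<Longrightarrow> nondegenerate_on (G z) UNIV"
begin

abbreviation \<Gamma> where "\<Gamma> \<equiv> christoffel G"

lemma dG: "z \<in> U \<Longrightarrow> (G has_derivative blinfun_apply (der G z)) (at z)"
  by (rule smooth_on_has_derivative[OF smooth_G])

lemma der_G: "z \<in> U \<Longrightarrow> frechet_derivative G (at z) = blinfun_apply (der G z)"
  by (rule frechet_derivative_eqI[OF dG])

lemma der_G_sym: "z \<in> U \<Longrightarrow> der G z X Y Z = der G z X Z Y"
  by (rule has_derivative_eq_on_open[OF open_U, of z "\<lambda>z. G z Y Z" "\<lambda>z. G z Z Y"])
     (auto intro!: has_derivative_blinfun_apply_const dG simp: G_sym)

definition "koszul z X Y Z = (1/2) * (der G z X Y Z + der G z Y X Z - der G z Z X Y)"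

lemma linear_koszul: "linear (koszul z X Y)" "linear (\<lambda>Y. koszul z X Y Z)" "linear (\<lambda>X. koszul z X Y Z)"
  by (rule linearI; simp add: koszul_def blinfun.bilinear_simps algebra_simps)+

definition "koszul_christoffel z = blinfun2 (\<lambda>X Y. raise (G z) (Blinfun (koszul z X Y)))"

lemma koszul_christoffel_apply: "koszul_christoffel z X Y = raise (G z) (Blinfun (koszul z X Y))"
  unfolding koszul_christoffel_def
proof (rule blinfun2_apply)
  have *: "Blinfun (koszul z X Y) Z = koszul z X Y Z" for X Y Z by (rule Blinfun_linear[OF linear_koszul(1)])
  have 1: "linear (\<lambda>Y. Blinfun (koszul z X Y))" for X
    by (rule linearI; rule blinfun_eqI;
        simp add: * blinfun.bilinear_simps linear_add[OF linear_koszul(2)] linear_cmul[OF linear_koszul(2)])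
  have 2: "linear (\<lambda>X. Blinfun (koszul z X Y))" for Y
    by (rule linearI; rule blinfun_eqI;
        simp add: * blinfun.bilinear_simps linear_add[OF linear_koszul(3)] linear_cmul[OF linear_koszul(3)])
  show "linear (\<lambda>Y. raise (G z) (Blinfun (koszul z X Y)))" for X
    by (rule linearI; simp add: linear_add[OF 1] linear_cmul[OF 1] blinfun.bilinear_simps)
  show "linear (\<lambda>X. raise (G z) (Blinfun (koszul z X Y)))" for Y
    by (rule linearI; simp add: linear_add[OF 2] linear_cmul[OF 2] blinfun.bilinear_simps)
qed

lemma G_koszul_christoffel: "z \<in> U \<Longrightarrow> G z (koszul_christoffel z X Y) Z = koszul z X Y Z"
  by (simp add: koszul_christoffel_apply raise_works G_nondeg Blinfun_linear linear_koszul)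

text \<open>
  The Koszul formula.
\<close>

lemma is_christoffel_unique:
  assumes z: "z \<in> U" and C: "is_christoffel G z C"
  shows "C = koszul_christoffel z"
proof (rule blinfun_eqI, rule blinfun_eqI)
  fix X Y
  have s: "C X Y = C Y X" for X Y using C by (simp add: is_christoffel_def)
  have m: "der G z X Y Z = G z (C X Y) Z + G z Y (C X Z)" for X Y Z
    using C der_G[OF z] unfolding is_christoffel_def by simp
  have "G z (C X Y - koszul_christoffel z X Y) Z = 0" for Z
    using m[of X Y Z] m[of Y X Z] m[of Z X Y] s[of Z X] s[of Z Y] s[of X Y]
      G_sym[OF z, of "C X Z" Y] G_sym[OF z, of X "C Y Z"]
    by (simp add: blinfun.bilinear_simps G_koszul_christoffel[OF z] koszul_def)
  then have "C X Y - koszul_christoffel z X Y = 0"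
    using G_nondeg[OF z] unfolding nondegenerate_on_def by blast
  then show "C X Y = koszul_christoffel z X Y" by simp
qed

lemma is_christoffel_koszul: "z \<in> U \<Longrightarrow> is_christoffel G z (koszul_christoffel z)"
  unfolding is_christoffel_def
proof (intro conjI allI)
  fix X Y Z assume z: "z \<in> U"
  have "koszul z X Y = koszul z Y X" for X Y
    by (rule ext) (simp add: koszul_def der_G_sym[OF z, of _ X Y])
  then show "koszul_christoffel z X Y = koszul_christoffel z Y X"
    by (simp add: koszul_christoffel_apply)
  show "frechet_derivative G (at z) X Y Z
      = G z (koszul_christoffel z X Y) Z + G z Y (koszul_christoffel z X Z)"
  proof -
    have e: "G z Y (koszul_christoffel z X Z) = koszul z X Z Y"
      using G_sym[OF z, of Y "koszul_christoffel z X Z"] G_koszul_christoffel[OF z, of X Z Y] by (rule trans)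
    show ?thesis unfolding e G_koszul_christoffel[OF z] der_G[OF z]
      by (simp add: koszul_def der_G_sym[OF z, of X Z Y] field_simps)
  qed
qed

lemma christoffel_eq: "z \<in> U \<Longrightarrow> is_christoffel G z C \<Longrightarrow> \<Gamma> z = C"
  unfolding christoffel_def using is_christoffel_unique by (metis (mono_tags, lifting) the_equality)

lemma christoffel_koszul: "z \<in> U \<Longrightarrow> \<Gamma> z = koszul_christoffel z"
  by (rule christoffel_eq[OF _ is_christoffel_koszul])

lemma is_christoffel_\<Gamma>: "z \<in> U \<Longrightarrow> is_christoffel G z (\<Gamma> z)"
  by (simp add: christoffel_koszul is_christoffel_koszul)

lemma \<Gamma>_sym: "z \<in> U \<Longrightarrow> \<Gamma> z X Y = \<Gamma> z Y X"
  using is_christoffel_\<Gamma> by (simp add: is_christoffel_def)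

lemma \<Gamma>_metric: "z \<in> U \<Longrightarrow> der G z X Y Z = G z (\<Gamma> z X Y) Z + G z Y (\<Gamma> z X Z)"
  using is_christoffel_\<Gamma> der_G by (simp add: is_christoffel_def)

lemma smooth_\<Gamma>: "smooth_on U \<Gamma>"
proof -
  have d: "smooth_on U (\<lambda>z. der G z X Y Z)" for X Y Z
    by (intro smooth_on_linear[OF blinfun.bounded_linear_left] smooth_on_der open_U smooth_G)
  have "smooth_on U (\<lambda>z. koszul z X Y Z)" for X Y Z
    unfolding koszul_def
    by (intro smooth_on_linear[OF bounded_linear_mult_right] smooth_on_diff smooth_on_add d open_U)
  then have "smooth_on U (\<lambda>z. Blinfun (koszul z X Y))" for X Y
    by (intro smooth_on_blinfunI open_U) (simp add: Blinfun_linear linear_koszul)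
  then have "smooth_on U (\<lambda>z. koszul_christoffel z X Y)" for X Y
    unfolding koszul_christoffel_apply
    by (intro smooth_on_apply smooth_on_raise open_U smooth_G G_nondeg)
  then have "smooth_on U koszul_christoffel"
    by (intro smooth_on_blinfunI open_U)
  then show ?thesis using smooth_on_cong[OF open_U] christoffel_koszul by metis
qed

lemma d\<Gamma>: "z \<in> U \<Longrightarrow> (\<Gamma> has_derivative blinfun_apply (der \<Gamma> z)) (at z)"
  by (rule smooth_on_has_derivative[OF smooth_\<Gamma>])

lemma der_\<Gamma>_sym: "z \<in> U \<Longrightarrow> der \<Gamma> z X Y Z = der \<Gamma> z X Z Y"
  by (rule has_derivative_eq_on_open[OF open_U, of z "\<lambda>z. \<Gamma> z Y Z" "\<lambda>z. \<Gamma> z Z Y"])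
     (auto intro!: has_derivative_blinfun_apply_const d\<Gamma> simp: \<Gamma>_sym)

abbreviation R where "R \<equiv> coord_curvature \<Gamma>"

lemma R_apply: "R z X Y Z = der \<Gamma> z X Y Z - der \<Gamma> z Y X Z + \<Gamma> z X (\<Gamma> z Y Z) - \<Gamma> z Y (\<Gamma> z X Z)"
  by (simp add: coord_curvature_def blinfun.bilinear_simps)

text \<open>
  Differentiating the compatibility of the connection with the metric once more expresses the second derivative of
  the metric by the connection; its symmetry is the claim.
\<close>

lemma R_skew:
  assumes z: "z \<in> U"
  shows "G z (R z W X Y) Z = - G z Y (R z W X Z)"
proof -
  have d: "der (der G) z W X Y Z
    = (G z (\<Gamma> z W (\<Gamma> z X Y)) Z + G z (\<Gamma> z X Y) (\<Gamma> z W Z)) + G z (der \<Gamma> z W X Y) Z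
     + (G z (\<Gamma> z W Y) (\<Gamma> z X Z) + G z Y (\<Gamma> z W (\<Gamma> z X Z))) + G z Y (der \<Gamma> z W X Z)" for W X Y Z
  proof -
    have 1: "((\<lambda>z. der G z X Y Z) has_derivative (\<lambda>h. der (der G) z h X Y Z)) (at z)"
      by (intro has_derivative_blinfun_apply_const smooth_on_has_derivative[OF smooth_on_der[OF open_U smooth_G] z])
    have 2: "((\<lambda>z. \<Gamma> z X Y) has_derivative (\<lambda>h. der \<Gamma> z h X Y)) (at z)" for Y
      by (intro has_derivative_blinfun_apply_const d\<Gamma> z)
    have 3: "((\<lambda>z. G z (\<Gamma> z X Y) Z + G z Y (\<Gamma> z X Z)) has_derivative
       (\<lambda>h. (G z (der \<Gamma> z h X Y) + der G z h (\<Gamma> z X Y)) Z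
            + (G z Y (der \<Gamma> z h X Z) + der G z h Y (\<Gamma> z X Z)))) (at z)"
      by (intro has_derivative_add has_derivative_blinfun_apply_const[of "\<lambda>z. G z (\<Gamma> z X Y)"]
          has_derivative_blinfun_apply[OF dG[OF z] 2]
          has_derivative_blinfun_apply[OF has_derivative_blinfun_apply_const[OF dG[OF z]] 2])
    have "der (der G) z W X Y Z = (G z (der \<Gamma> z W X Y) + der G z W (\<Gamma> z X Y)) Z
            + (G z Y (der \<Gamma> z W X Z) + der G z W Y (\<Gamma> z X Z))"
      by (rule has_derivative_eq_on_open[OF open_U z _ 1 3]) (rule \<Gamma>_metric)
    then show ?thesis by (simp add: \<Gamma>_metric[OF z] blinfun.bilinear_simps)
  qed
  have "der (der G) z W X Y Z = der (der G) z X W Y Z"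
    using der_der_symmetric[OF open_U smooth_G z] by simp
  then show ?thesis
    unfolding d by (simp add: R_apply blinfun.bilinear_simps)
qed

lemma R_algebraic:
  assumes z: "z \<in> U"
  shows "algebraic_curvature (G z) (\<lambda>X Y Z. R z X Y Z)"
  unfolding algebraic_curvature_def
proof (intro conjI allI)
  show "linear (\<lambda>X. R z X Y Z)" for Y Z
    by (rule linearI; simp add: R_apply blinfun.bilinear_simps algebra_simps)
  show "linear (\<lambda>Y. R z X Y Z)" for X Z
    by (rule linearI; simp add: R_apply blinfun.bilinear_simps algebra_simps)
  show "linear (\<lambda>Z. R z X Y Z)" for X Y
    by (rule linearI; simp add: R_apply blinfun.bilinear_simps algebra_simps)
  show "R z X Y Z = - R z Y X Z" for X Y Z by (simp add: R_apply)
  show "G z (R z X Y Z) V = - G z Z (R z X Y V)" for X Y Z V by (rule R_skew[OF z])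
  show "R z X Y Z + R z Y Z X + R z Z X Y = 0" for X Y Z
    by (simp add: R_apply der_\<Gamma>_sym[OF z, of X Z Y] der_\<Gamma>_sym[OF z, of Y X Z] der_\<Gamma>_sym[OF z, of Z X Y]
        \<Gamma>_sym[OF z, of Z X] \<Gamma>_sym[OF z, of Y X] \<Gamma>_sym[OF z, of Z Y])
qed

end

section \<open>Parallel bundles of endomorphisms\<close>

text \<open>
  The covariant derivative of a field of endomorphisms at a point, in one direction: A is its value, A' its
  directional derivative, and C the connection operator in that direction. Keeping the three apart makes the formula
  apply to fields along a map as well.
\<close>

definition cov_endo :: "('e::euclidean_space \<Rightarrow>\<^sub>L 'e) \<Rightarrow> ('e \<Rightarrow>\<^sub>L 'e) \<Rightarrow> ('e \<Rightarrow>\<^sub>L 'e) \<Rightarrow> 'e \<Rightarrow>\<^sub>L 'e" where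
  "cov_endo C A A' = A' + (C o\<^sub>L A) - (A o\<^sub>L C)"

lemma cov_endo_apply: "cov_endo C A A' x = A' x + C (A x) - A (C x)"
  by (simp add: cov_endo_def blinfun.bilinear_simps)

lemma cov_endo_linear:
  "cov_endo C (a *\<^sub>R A) (b *\<^sub>R A + a *\<^sub>R A') = b *\<^sub>R A + a *\<^sub>R cov_endo C A A'"
  "cov_endo C (A + B) (A' + B') = cov_endo C A A' + cov_endo C B B'"
  by (rule blinfun_eqI; simp add: cov_endo_apply blinfun.bilinear_simps algebra_simps)+

text \<open>
  The coefficients of a section in the frame are differentiable, because they can be read off from the
  anticommutators with the frame. By the product rule, a bundle whose frame has covariant derivatives in the bundle
  is parallel.
\<close>

lemma section_cov_in_span:
  fixes K1 K2 K3 A :: "'s::euclidean_space \<Rightarrow> 'x::euclidean_space \<Rightarrow>\<^sub>L 'x"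
  assumes S: "open S" "y \<in> S"
    and t: "\<And>z. z \<in> S \<Longrightarrow> para_hypercomplex_triple e1 e2 e3 (K1 z) (K2 z) (K3 z)"
    and dK: "(K1 has_derivative K1') (at y)" "(K2 has_derivative K2') (at y)" "(K3 has_derivative K3') (at y)"
    and A: "\<And>z. z \<in> S \<Longrightarrow> A z \<in> span {K1 z, K2 z, K3 z}" and dA: "(A has_derivative A') (at y)"
    and cK: "cov_endo C (K1 y) (K1' X) \<in> span {K1 y, K2 y, K3 y}"
      "cov_endo C (K2 y) (K2' X) \<in> span {K1 y, K2 y, K3 y}"
      "cov_endo C (K3 y) (K3' X) \<in> span {K1 y, K2 y, K3 y}"
  shows "cov_endo C (A y) (A' X) \<in> span {K1 y, K2 y, K3 y}"
proof -
  obtain b :: 'x where b: "b \<in> Basis" using SOME_Basis by blast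
  then have bb: "b \<bullet> b = 1" by simp
  \<comment> \<open>The anticommutator of the section with a frame element is a scalar endomorphism, 2e times the coefficient;
    it is evaluated on a unit vector.\<close>
  define c where "c e K z = (e / 2) * ((A z (K z b) + K z (A z b)) \<bullet> b)" for e and K :: "'s \<Rightarrow> 'x \<Rightarrow>\<^sub>L 'x" and z
  have rep: "A z = c e1 K1 z *\<^sub>R K1 z + c e2 K2 z *\<^sub>R K2 z + c e3 K3 z *\<^sub>R K3 z" if z: "z \<in> S" for z
  proof -
    obtain a1 a2 a3 where Az: "A z = a1 *\<^sub>R K1 z + a2 *\<^sub>R K2 z + a3 *\<^sub>R K3 z" using A[OF z] by (rule span_tripleE)
    note T = para_hypercomplex_triple_table[OF t[OF z]] and s = para_hypercomplex_triple_signs[OF t[OF z]]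
    have "A z (K1 z b) + K1 z (A z b) = (2 * e1 * a1) *\<^sub>R b"
      "A z (K2 z b) + K2 z (A z b) = (2 * e2 * a2) *\<^sub>R b"
      "A z (K3 z b) + K3 z (A z b) = (2 * e3 * a3) *\<^sub>R b"
      by (rule vector_eq_inner; simp add: Az T blinfun.bilinear_simps inner_simps algebra_simps)+
    then have "c e1 K1 z = a1" "c e2 K2 z = a2" "c e3 K3 z = a3"
      unfolding c_def using s(1,2,3) by (simp_all add: bb flip: mult.assoc)
    then show ?thesis using Az by simp
  qed
  have dc: "\<exists>c'. (c e K has_derivative c') (at y)" if dK: "(K has_derivative K') (at y)" for e K K'
  proof -
    have "((\<lambda>z. A z (K z b) + K z (A z b)) has_derivative
        (\<lambda>h. (A y (K' h b) + A' h (K y b)) + (K y (A' h b) + K' h (A y b)))) (at y)"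
      by (intro has_derivative_add
          has_derivative_blinfun_apply[OF dA has_derivative_blinfun_apply_const[OF dK]]
          has_derivative_blinfun_apply[OF dK has_derivative_blinfun_apply_const[OF dA]])
    from bounded_linear.has_derivative[OF bounded_linear_mult_right
        bounded_linear.has_derivative[OF bounded_linear_inner_left this]]
    show ?thesis unfolding c_def by blast
  qed
  obtain c1 c2 c3 where dc': "(c e1 K1 has_derivative c1) (at y)" "(c e2 K2 has_derivative c2) (at y)"
    "(c e3 K3 has_derivative c3) (at y)"
    using dc[OF dK(1)] dc[OF dK(2)] dc[OF dK(3)] by blast
  have d: "((\<lambda>z. c e1 K1 z *\<^sub>R K1 z + c e2 K2 z *\<^sub>R K2 z + c e3 K3 z *\<^sub>R K3 z) has_derivative
     (\<lambda>h. (c e1 K1 y *\<^sub>R K1' h + c1 h *\<^sub>R K1 y) + (c e2 K2 y *\<^sub>R K2' h + c2 h *\<^sub>R K2 y)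
        + (c e3 K3 y *\<^sub>R K3' h + c3 h *\<^sub>R K3 y))) (at y)"
    by (intro has_derivative_add has_derivative_scaleR dc' dK)
  have A': "A' X = (c1 X *\<^sub>R K1 y + c e1 K1 y *\<^sub>R K1' X) + (c2 X *\<^sub>R K2 y + c e2 K2 y *\<^sub>R K2' X)
        + (c3 X *\<^sub>R K3 y + c e3 K3 y *\<^sub>R K3' X)"
    using has_derivative_eq_on_open[OF S rep dA d, of X] by (simp add: ac_simps)
  have "cov_endo C (A y) (A' X) = (c1 X *\<^sub>R K1 y + c e1 K1 y *\<^sub>R cov_endo C (K1 y) (K1' X))
     + (c2 X *\<^sub>R K2 y + c e2 K2 y *\<^sub>R cov_endo C (K2 y) (K2' X))
     + (c3 X *\<^sub>R K3 y + c e3 K3 y *\<^sub>R cov_endo C (K3 y) (K3' X))"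
    unfolding A' rep[OF S(2)] cov_endo_linear ..
  also have "\<dots> \<in> span {K1 y, K2 y, K3 y}"
    by (intro span_add span_scale cK) (auto intro: span_base)
  finally show ?thesis .
qed

text \<open>
  The coordinate picture of a para-quaternionic Kaehler manifold on a domain with an adapted frame.
\<close>

locale quaternionic_patch = local_metric U G for U :: "'e::euclidean_space set" and G +
  fixes e1 e2 e3 :: real and I1 I2 I3 :: "'e \<Rightarrow> 'e \<Rightarrow>\<^sub>L 'e"
  assumes smooth_I: "smooth_on U I1" "smooth_on U I2" "smooth_on U I3"
    and triple: "\<And>z. z \<in> U \<Longrightarrow> para_hypercomplex_triple e1 e2 e3 (I1 z) (I2 z) (I3 z)"
    and I_skew: "\<And>z A u v. z \<in> U \<Longrightarrow> A \<in> span {I1 z, I2 z, I3 z} \<Longrightarrow> G z (A u) v = - G z u (A v)"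
    and parallel: "\<And>A z X. smooth_on U A \<Longrightarrow> (\<And>z. z \<in> U \<Longrightarrow> A z \<in> span {I1 z, I2 z, I3 z}) \<Longrightarrow> z \<in> U \<Longrightarrow>
        cov_endo (christoffel G z X) (A z) (der A z X) \<in> span {I1 z, I2 z, I3 z}"
begin

abbreviation Q where "Q z \<equiv> span {I1 z, I2 z, I3 z}"

lemma I_in_Q: "I1 z \<in> Q z" "I2 z \<in> Q z" "I3 z \<in> Q z"
  by (auto intro: span_base)

lemma frame_parallel:
  "z \<in> U \<Longrightarrow> cov_endo (\<Gamma> z X) (I1 z) (der I1 z X) \<in> Q z"
  "z \<in> U \<Longrightarrow> cov_endo (\<Gamma> z X) (I2 z) (der I2 z X) \<in> Q z"
  "z \<in> U \<Longrightarrow> cov_endo (\<Gamma> z X) (I3 z) (der I3 z X) \<in> Q z"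
  by (intro parallel smooth_I I_in_Q; assumption)+

lemma skew_triple_at: "z \<in> U \<Longrightarrow> skew_triple (G z) e1 e2 e3 (I1 z) (I2 z) (I3 z)"
  by unfold_locales (auto intro: G_sym G_nondeg triple I_skew I_in_Q)

text \<open>
  The commutator of R(X,Y) with a section is the skew part of its second covariant derivative, which stays in the
  parallel bundle.
\<close>

lemma curvature_normalizes_section:
  assumes A: "smooth_on U A" and AQ: "\<And>z. z \<in> U \<Longrightarrow> A z \<in> Q z" and z: "z \<in> U"
  shows "(R z X Y o\<^sub>L A z) - (A z o\<^sub>L R z X Y) \<in> Q z"
proof -
  define B where "B Y z = cov_endo (\<Gamma> z Y) (A z) (der A z Y)" for Y z
  have sB: "smooth_on U (B Y)" for Y
    unfolding B_def cov_endo_def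
    by (intro smooth_on_diff smooth_on_add smooth_on_blinfun_compose open_U A
        smooth_on_linear[OF blinfun.bounded_linear_left] smooth_\<Gamma> smooth_on_der)
  have BQ: "z \<in> U \<Longrightarrow> B Y z \<in> Q z" for Y z unfolding B_def by (intro parallel A AQ)
  have c: "cov_endo (\<Gamma> z X) (B Y z) (der (B Y) z X) \<in> Q z" for X Y
    by (intro parallel sB BQ z)
  have dB: "der (B Y) z X = der (der A) z X Y + ((\<Gamma> z Y o\<^sub>L der A z X) + (der \<Gamma> z X Y o\<^sub>L A z))
      - ((A z o\<^sub>L der \<Gamma> z X Y) + (der A z X o\<^sub>L \<Gamma> z Y))" for X Y
  proof -
    have dA: "(A has_derivative blinfun_apply (der A z)) (at z)" by (rule smooth_on_has_derivative[OF A z])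
    have dG: "((\<lambda>z. \<Gamma> z Y) has_derivative (\<lambda>h. der \<Gamma> z h Y)) (at z)"
      by (rule has_derivative_blinfun_apply_const[OF d\<Gamma>[OF z]])
    have "(B Y has_derivative (\<lambda>h. der (der A) z h Y + ((\<Gamma> z Y o\<^sub>L der A z h) + (der \<Gamma> z h Y o\<^sub>L A z))
      - ((A z o\<^sub>L der \<Gamma> z h Y) + (der A z h o\<^sub>L \<Gamma> z Y)))) (at z)"
      unfolding B_def cov_endo_def
      by (intro has_derivative_diff has_derivative_add has_derivative_blinfun_compose dA dG
          has_derivative_blinfun_apply_const[OF smooth_on_has_derivative[OF smooth_on_der[OF open_U A] z]])
    from has_derivative_unique[OF smooth_on_has_derivative[OF sB z] this] show ?thesis by metis
  qed
  have "(R z X Y o\<^sub>L A z) - (A z o\<^sub>L R z X Y)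
    = cov_endo (\<Gamma> z X) (B Y z) (der (B Y) z X) - cov_endo (\<Gamma> z Y) (B X z) (der (B X) z Y)"
    by (rule blinfun_eqI)
       (simp add: dB cov_endo_apply B_def coord_curvature_def blinfun.bilinear_simps
         der_der_symmetric[OF open_U A z, of X Y] algebra_simps)
  also have "\<dots> \<in> Q z" by (intro span_diff c)
  finally show ?thesis .
qed

lemma curvature_normalizes:
  assumes z: "z \<in> U" and A: "A \<in> Q z"
  shows "(R z X Y o\<^sub>L A) - (A o\<^sub>L R z X Y) \<in> Q z"
proof -
  obtain a b c where A: "A = a *\<^sub>R I1 z + b *\<^sub>R I2 z + c *\<^sub>R I3 z" using A by (rule span_tripleE)
  have "(R z X Y o\<^sub>L A) - (A o\<^sub>L R z X Y) = a *\<^sub>R ((R z X Y o\<^sub>L I1 z) - (I1 z o\<^sub>L R z X Y))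
    + b *\<^sub>R ((R z X Y o\<^sub>L I2 z) - (I2 z o\<^sub>L R z X Y)) + c *\<^sub>R ((R z X Y o\<^sub>L I3 z) - (I3 z o\<^sub>L R z X Y))"
    by (rule blinfun_eqI) (simp add: A blinfun.bilinear_simps algebra_simps)
  also have "\<dots> \<in> Q z"
    by (intro span_add span_scale curvature_normalizes_section smooth_I I_in_Q z)
  finally show ?thesis .
qed

text \<open>
  Along a map, a section of the bundle has no extension to the ambient space in general. Its covariant derivative is
  computed from that of the frame.
\<close>

lemma cov_along:
  fixes f :: "'s::euclidean_space \<Rightarrow> 'e"
  assumes S: "open S" "y \<in> S" and f: "\<And>y. y \<in> S \<Longrightarrow> f y \<in> U" and df: "(f has_derivative f') (at y)"
    and A: "\<And>y. y \<in> S \<Longrightarrow> A y \<in> Q (f y)" and dA: "(A has_derivative A') (at y)"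
  shows "cov_endo (\<Gamma> (f y) (f' X)) (A y) (A' X) \<in> Q (f y)"
proof -
  have dI: "((\<lambda>y. I (f y)) has_derivative (\<lambda>h. der I (f y) (f' h))) (at y)" if "smooth_on U I" for I :: "'e \<Rightarrow> 'e \<Rightarrow>\<^sub>L 'e"
    using diff_chain_at[OF df smooth_on_has_derivative[OF that f[OF S(2)]]] by (simp only: o_def)
  show ?thesis
    by (rule section_cov_in_span[where ?K1.0 = "\<lambda>y. I1 (f y)" and ?K2.0 = "\<lambda>y. I2 (f y)" and ?K3.0 = "\<lambda>y. I3 (f y)",
          OF S triple[OF f] dI[OF smooth_I(1)] dI[OF smooth_I(2)] dI[OF smooth_I(3)] A dA])
       (intro frame_parallel f S(2) | assumption)+
qed

end

section \<open>Immersions into a para-quaternionic Kaehler patch\<close>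

text \<open>
  The Nijenhuis tensor on constant coordinate fields.
\<close>

definition coord_nijenhuis :: "('m::euclidean_space \<Rightarrow> 'm \<Rightarrow>\<^sub>L 'm) \<Rightarrow> 'm \<Rightarrow> 'm \<Rightarrow> 'm \<Rightarrow> 'm" where
  "coord_nijenhuis j y X Y = der j y (j y X) Y - der j y (j y Y) X + j y (der j y Y X) - j y (der j y X Y)"

locale immersed_patch = quaternionic_patch U G e1 e2 e3 I1 I2 I3
  for U :: "'e::euclidean_space set" and G e1 e2 e3 I1 I2 I3 +
  fixes S :: "'m::euclidean_space set" and f :: "'m \<Rightarrow> 'e"
  assumes open_S: "open S" and smooth_f: "smooth_on S f" and f_U: "\<And>y. y \<in> S \<Longrightarrow> f y \<in> U"
    and inj_D: "\<And>y. y \<in> S \<Longrightarrow> inj (blinfun_apply (der f y))"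
    and nondeg_D: "\<And>y. y \<in> S \<Longrightarrow> nondegenerate_on (G (f y)) (range (blinfun_apply (der f y)))"
begin

abbreviation D where "D \<equiv> der f"

lemma f_image: "f ` S \<subseteq> U" using f_U by blast

lemma df: "y \<in> S \<Longrightarrow> (f has_derivative blinfun_apply (D y)) (at y)"
  by (rule smooth_on_has_derivative[OF smooth_f])

lemma smooth_D: "smooth_on S D" by (rule smooth_on_der[OF open_S smooth_f])

lemma dD: "y \<in> S \<Longrightarrow> (D has_derivative blinfun_apply (der D y)) (at y)"
  by (rule smooth_on_has_derivative[OF smooth_D])

lemma smooth_along: "smooth_on U F \<Longrightarrow> smooth_on S (\<lambda>y. F (f y))"
  by (rule smooth_on_compose[OF open_S open_U f_image smooth_f])

lemma d_along: "smooth_on U F \<Longrightarrow> y \<in> S \<Longrightarrow>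
    ((\<lambda>y. F (f y)) has_derivative (\<lambda>h. der F (f y) (D y h))) (at y)"
  using diff_chain_at[OF df smooth_on_has_derivative[OF _ f_U]] by (auto simp: o_def)

lemma D_eq_iff: "y \<in> S \<Longrightarrow> D y u = D y v \<longleftrightarrow> u = v"
  using inj_D by (auto simp: inj_eq)

definition g where "g y = pullback_form (G (f y)) (D y)"

lemma g_apply: "g y u v = G (f y) (D y u) (D y v)"
  by (simp add: g_def pullback_form_apply)

lemma smooth_pullback_pairing:
  fixes A :: "'m \<Rightarrow> 'e \<Rightarrow>\<^sub>L 'e"
  assumes "smooth_on S A"
  shows "smooth_on S (\<lambda>y. G (f y) (A y (D y u)) (D y v))"
  by (intro smooth_on_apply smooth_along smooth_G assms open_S smooth_D smooth_on_const)

lemma smooth_g: "smooth_on S g"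
  by (intro smooth_on_blinfunI open_S; unfold g_apply;
      intro smooth_on_apply smooth_along smooth_G open_S smooth_D smooth_on_const)

sublocale M: local_metric S g
  by unfold_locales
     (auto simp: open_S smooth_g pullback_form_apply G_sym f_U g_def intro!: nondegenerate_pullback_form nondeg_D inj_D)

text \<open>
  The ambient covariant derivative of the image of a coordinate field. Its class modulo the tangent space is the
  second fundamental form; working with the whole vector avoids normal projections.
\<close>

definition hessian where "hessian y X Y = der D y X Y + \<Gamma> (f y) (D y X) (D y Y)"

lemma hessian_sym: "y \<in> S \<Longrightarrow> hessian y X Y = hessian y Y X"
  by (simp add: hessian_def der_der_symmetric[OF open_S smooth_f, of y X Y] \<Gamma>_sym[OF f_U, of y "D y X"])

lemma hessian_bilinear:
  "hessian y (X + X') Y = hessian y X Y + hessian y X' Y" "hessian y X (Y + Y') = hessian y X Y + hessian y X Y'"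
  "hessian y (c *\<^sub>R X) Y = c *\<^sub>R hessian y X Y" "hessian y X (c *\<^sub>R Y) = c *\<^sub>R hessian y X Y"
  by (simp_all add: hessian_def blinfun.bilinear_simps algebra_simps)

text \<open>
  The derivative of the relation A D = D a along the immersion.
\<close>

lemma leibniz:
  fixes A :: "'m \<Rightarrow> 'e \<Rightarrow>\<^sub>L 'e" and a :: "'m \<Rightarrow> 'm \<Rightarrow>\<^sub>L 'm"
  assumes y: "y \<in> S" and dA: "(A has_derivative A') (at y)" and da: "(a has_derivative a') (at y)"
    and eq: "\<And>z u. z \<in> S \<Longrightarrow> A z (D z u) = D z (a z u)"
  shows "hessian y X (a y Y) + D y (a' X Y) = cov_endo (\<Gamma> (f y) (D y X)) (A y) (A' X) (D y Y) + A y (hessian y X Y)"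
proof -
  have 1: "((\<lambda>z. A z (D z Y)) has_derivative (\<lambda>h. A y (der D y h Y) + A' h (D y Y))) (at y)"
    by (rule has_derivative_blinfun_apply[OF dA has_derivative_blinfun_apply_const[OF dD[OF y]]])
  have 2: "((\<lambda>z. D z (a z Y)) has_derivative (\<lambda>h. D y (a' h Y) + der D y h (a y Y))) (at y)"
    by (rule has_derivative_blinfun_apply[OF dD[OF y] has_derivative_blinfun_apply_const[OF da]])
  have "A y (der D y X Y) + A' X (D y Y) = D y (a' X Y) + der D y X (a y Y)"
    by (rule has_derivative_eq_on_open[OF open_S y eq 1 2])
  then show ?thesis
    by (simp add: hessian_def cov_endo_apply blinfun.bilinear_simps eq[OF y] algebra_simps)
qed

text \<open>
  The endomorphism of the tangent space representing the bilinear form G (A D u) (D v). It equals the restriction of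
  A when A preserves the tangent space, and it is smooth without that assumption; this makes the condition of being
  preserved closed.
\<close>

definition tangential_part :: "('m \<Rightarrow> 'e \<Rightarrow>\<^sub>L 'e) \<Rightarrow> 'm \<Rightarrow> 'm \<Rightarrow>\<^sub>L 'm" where
  "tangential_part A y = raise (g y) o\<^sub>L blinfun2 (\<lambda>u v. G (f y) (A y (D y u)) (D y v))"

lemma tangential_part_pairing:
  fixes A :: "'m \<Rightarrow> 'e \<Rightarrow>\<^sub>L 'e"
  assumes y: "y \<in> S"
  shows "g y (tangential_part A y u) v = G (f y) (A y (D y u)) (D y v)"
proof -
  have "blinfun2 (\<lambda>u v. G (f y) (A y (D y u)) (D y v)) u v = G (f y) (A y (D y u)) (D y v)"
    by (rule blinfun2_apply) (rule linearI; simp add: blinfun.bilinear_simps)+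
  then show ?thesis by (simp add: tangential_part_def raise_works M.G_nondeg[OF y])
qed

lemma tangential_part_eqI:
  fixes A :: "'m \<Rightarrow> 'e \<Rightarrow>\<^sub>L 'e"
  assumes y: "y \<in> S" and eq: "A y (D y u) = D y w"
  shows "tangential_part A y u = w"
proof -
  have "g y (tangential_part A y u - w) v = 0" for v
    using tangential_part_pairing[OF y, of A u v] by (simp add: eq g_apply blinfun.bilinear_simps)
  then have "tangential_part A y u - w = 0" using M.G_nondeg[OF y] unfolding nondegenerate_on_def by blast
  then show ?thesis by simp
qed

lemma smooth_tangential_part:
  fixes A :: "'m \<Rightarrow> 'e \<Rightarrow>\<^sub>L 'e"
  assumes A: "smooth_on S A"
  shows "smooth_on S (tangential_part A)"
proof -
  have "blinfun2 (\<lambda>u v. G (f y) (A y (D y u)) (D y v)) u v = G (f y) (A y (D y u)) (D y v)" for y u v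
    by (rule blinfun2_apply) (rule linearI; simp add: blinfun.bilinear_simps)+
  then have "smooth_on S (\<lambda>y. blinfun2 (\<lambda>u v. G (f y) (A y (D y u)) (D y v)))"
    by (intro smooth_on_blinfunI open_S) (simp add: smooth_pullback_pairing[OF A])
  then show ?thesis unfolding tangential_part_def
    by (intro smooth_on_blinfun_compose open_S smooth_on_raise smooth_g M.G_nondeg)
qed

lemma smooth_restricted:
  fixes A :: "'m \<Rightarrow> 'e \<Rightarrow>\<^sub>L 'e" and a :: "'m \<Rightarrow> 'm \<Rightarrow>\<^sub>L 'm"
  assumes A: "smooth_on S A" and eq: "\<And>z u. z \<in> S \<Longrightarrow> A z (D z u) = D z (a z u)"
  shows "smooth_on S a"
proof -
  have "tangential_part A z = a z" if "z \<in> S" for z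
    by (rule blinfun_eqI, rule tangential_part_eqI[where A = A, OF that], rule eq[OF that])
  then show ?thesis using smooth_tangential_part[OF A] smooth_on_cong[OF open_S] by metis
qed

text \<open>
  The Leibniz rule for J D = D j is combined as in the definition of the Nijenhuis tensor. All terms with the
  hessian cancel, by its symmetry, and what remains is F X (D Y) - F Y (D X) = D (N X Y), where
  F X = E (jX) - J (E X) and E X is the covariant derivative of J. As J squares to a constant, E X is an element of
  the bundle that anticommutes with J.
\<close>

lemma invariant_where_nijenhuis_nonzero:
  fixes J :: "'m \<Rightarrow> 'e \<Rightarrow>\<^sub>L 'e" and j :: "'m \<Rightarrow> 'm \<Rightarrow>\<^sub>L 'm"
  assumes y: "y \<in> S" and J: "smooth_on S J" and JQ: "\<And>z. z \<in> S \<Longrightarrow> J z \<in> Q (f z)"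
    and JJ: "\<And>z x. z \<in> S \<Longrightarrow> J z (J z x) = eps *\<^sub>R x" and eps: "eps \<in> {-1, 1}"
    and Jj: "\<And>z u. z \<in> S \<Longrightarrow> J z (D z u) = D z (j z u)"
    and dim: "DIM('m) = 4 * k" and N: "coord_nijenhuis j y X0 Y0 \<noteq> 0"
    and nd: "nondegenerate_on (G (f y)) {v \<in> range (D y). \<forall>A\<in>Q (f y). A v \<in> range (D y)}"
  shows "\<forall>A\<in>Q (f y). blinfun_apply A ` range (D y) \<subseteq> range (D y)"
proof -
  have dJ: "(J has_derivative blinfun_apply (der J y)) (at y)" by (rule smooth_on_has_derivative[OF J y])
  have dj: "(j has_derivative blinfun_apply (der j y)) (at y)"
    by (rule smooth_on_has_derivative[OF smooth_restricted[OF J Jj] y])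
  define E where "E X = cov_endo (\<Gamma> (f y) (D y X)) (J y) (der J y X)" for X
  have EQ: "E X \<in> Q (f y)" for X
    unfolding E_def by (rule cov_along[OF open_S y f_U df[OF y] JQ dJ])
  have linE: "linear E"
    by (rule linearI; rule blinfun_eqI; simp add: E_def cov_endo_apply blinfun.bilinear_simps algebra_simps)
  have dJJ: "der J y X (J y x) = - J y (der J y X x)" for X x
  proof -
    have 1: "((\<lambda>z. J z (J z x)) has_derivative (\<lambda>h. J y (der J y h x) + der J y h (J y x))) (at y)"
      by (rule has_derivative_blinfun_apply[OF dJ has_derivative_blinfun_apply_const[OF dJ]])
    have "J y (der J y X x) + der J y X (J y x) = 0"
      by (rule has_derivative_eq_on_open[OF open_S y JJ 1 has_derivative_const])
    then show ?thesis by (metis add.commute eq_neg_iff_add_eq_0)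
  qed
  have EJ: "E X (J y x) = - J y (E X x)" for X x
    by (simp add: E_def cov_endo_apply dJJ JJ[OF y] blinfun.bilinear_simps)
  have lz: "D y (der j y X Y) = E X (D y Y) + J y (hessian y X Y) - hessian y X (j y Y)" for X Y
    using leibniz[OF y dJ dj Jj, of X Y] unfolding E_def by (simp add: eq_diff_eq ac_simps)
  define F where "F X = E (j y X) - (J y o\<^sub>L E X)" for X
  have main: "F X (D y Y) - F Y (D y X) = D y (coord_nijenhuis j y X Y)" for X Y
  proof -
    have "D y (coord_nijenhuis j y X Y) = D y (der j y (j y X) Y) - D y (der j y (j y Y) X)
        + J y (D y (der j y Y X)) - J y (D y (der j y X Y))"
      by (simp add: coord_nijenhuis_def blinfun.bilinear_simps Jj[OF y])
    also have "\<dots> = F X (D y Y) - F Y (D y X)"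
      unfolding lz
      using hessian_sym[OF y, of "j y X" Y] hessian_sym[OF y, of "j y Y" X] hessian_sym[OF y, of "j y X" "j y Y"] hessian_sym[OF y, of X Y]
      by (simp add: F_def blinfun.bilinear_simps JJ[OF y])
    finally show ?thesis by simp
  qed
  have jj: "j y (j y v) = eps *\<^sub>R v" for v
  proof -
    have "D y (j y (j y v)) = D y (eps *\<^sub>R v)" by (simp add: JJ[OF y] blinfun.scaleR_right flip: Jj[OF y])
    then show ?thesis by (simp add: D_eq_iff[OF y])
  qed
  show ?thesis
  proof (rule nijenhuis_tensor_forces_invariance[OF skew_triple_at[OF f_U[OF y]] eps dim inj_D[OF y] nondeg_D[OF y]
        JQ[OF y] JJ[OF y] Jj[OF y], where F = F])
    show "linear F"
      by (rule linearI; rule blinfun_eqI;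
          simp add: F_def linear_add[OF linE] linear_cmul[OF linE] blinfun.bilinear_simps algebra_simps)
    show "F X \<in> Q (f y)" for X
    proof -
      have "J y o\<^sub>L E X = (1/2) *\<^sub>R ((J y o\<^sub>L E X) - (E X o\<^sub>L J y))"
        by (rule blinfun_eqI) (simp add: blinfun.bilinear_simps EJ flip: scaleR_2)
      also have "\<dots> \<in> Q (f y)"
        by (intro span_scale triple_commutator_in_span[OF triple[OF f_U[OF y]]] JQ[OF y] EQ)
      finally show ?thesis unfolding F_def by (intro span_diff EQ)
    qed
    show "F X (J y x) = - J y (F X x)" for X x
      by (simp add: F_def blinfun.bilinear_simps EJ JJ[OF y])
    show "F (j y X) x = - J y (F X x)" for X x
      by (simp add: F_def blinfun.bilinear_simps jj linear_cmul[OF linE] JJ[OF y])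
    show "F X (D y Y) - F Y (D y X) \<in> range (D y)" for X Y unfolding main by simp
    show "F (if F X0 \<noteq> 0 then X0 else Y0) \<noteq> 0"
    proof
      assume "F (if F X0 \<noteq> 0 then X0 else Y0) = 0"
      then have "F X0 = 0" "F Y0 = 0" by (auto split: if_splits)
      then have "D y (coord_nijenhuis j y X0 Y0) = D y 0"
        using main[of X0 Y0] by (simp add: blinfun.bilinear_simps)
      then show False using N D_eq_iff[OF y] by blast
    qed
  qed (rule nd)
qed

text \<open>
  The tangent space is preserved exactly where I D agrees with D composed with the tangential part of I. Both
  sides are continuous.
\<close>

lemma invariant_by_density:
  assumes dense: "\<And>V. open V \<Longrightarrow> V \<subseteq> S \<Longrightarrow> V \<noteq> {} \<Longrightarrow>
      \<exists>y\<in>V. \<forall>A\<in>Q (f y). blinfun_apply A ` range (D y) \<subseteq> range (D y)"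
    and y: "y \<in> S" and A: "A \<in> Q (f y)"
  shows "A (D y u) \<in> range (D y)"
proof -
  have *: "I (f y) (D y u) \<in> range (D y)"
    if I: "smooth_on U I" "\<And>z. I z \<in> Q z" for I and u :: 'm
  proof -
    define P where "P z = (I (f z) o\<^sub>L D z) - (D z o\<^sub>L tangential_part (\<lambda>z. I (f z)) z)" for z
    have "smooth_on S P"
      unfolding P_def
      by (intro smooth_on_diff smooth_on_blinfun_compose open_S smooth_along I smooth_D smooth_tangential_part)
    then have cont: "continuous_on S P" by (rule smooth_on_continuous_on)
    have "P y = 0"
    proof (rule ccontr)
      assume "P y \<noteq> 0"
      define V where "V = {z \<in> S. P z \<noteq> 0}"
      have "V = S \<inter> P -` (- {0})" by (auto simp: V_def)
      then have oV: "open V" using continuous_open_preimage[OF cont open_S, of "- {0}"] by auto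
      have VS: "V \<subseteq> S" "V \<noteq> {}" using y \<open>P y \<noteq> 0\<close> by (auto simp: V_def)
      obtain z where z: "z \<in> V" and inv: "\<forall>A\<in>Q (f z). blinfun_apply A ` range (D z) \<subseteq> range (D z)"
        by (rule bexE[OF dense[OF oV VS]])
      have zS: "z \<in> S" using z by (simp add: V_def)
      have "P z = 0"
      proof (rule blinfun_eqI)
        fix v
        have "I (f z) (D z v) \<in> range (D z)" using bspec[OF inv I(2)[of "f z"]] by (rule subsetD) simp
        then obtain w where w: "I (f z) (D z v) = D z w" by blast
        have "tangential_part (\<lambda>z. I (f z)) z v = w" by (rule tangential_part_eqI[where A = "\<lambda>z. I (f z)", OF zS w])
        then show "P z v = blinfun_apply 0 v" by (simp add: P_def blinfun.bilinear_simps w)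
      qed
      then show False using z by (simp add: V_def)
    qed
    then have "blinfun_apply (P y) u = 0" by simp
    then have "I (f y) (D y u) = D y (tangential_part (\<lambda>z. I (f z)) y u)" by (simp add: P_def blinfun.bilinear_simps)
    then show ?thesis by simp
  qed
  obtain a b c where "A = a *\<^sub>R I1 (f y) + b *\<^sub>R I2 (f y) + c *\<^sub>R I3 (f y)" using A by (rule span_tripleE)
  then have "A (D y u) = a *\<^sub>R I1 (f y) (D y u) + b *\<^sub>R I2 (f y) (D y u) + c *\<^sub>R I3 (f y) (D y u)"
    by (simp add: blinfun.bilinear_simps)
  moreover have "subspace (range (D y))"
    by (rule linear_subspace_image) (simp_all add: bounded_linear.linear blinfun.bounded_linear_right)
  ultimately show ?thesis
    using *[OF smooth_I(1) I_in_Q(1)] *[OF smooth_I(2) I_in_Q(2)] *[OF smooth_I(3) I_in_Q(3)]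
    by (auto intro!: subspace_add subspace_scale)
qed

end

section \<open>Immersions with invariant tangent spaces\<close>

lemma algebraic_curvatureD:
  assumes "algebraic_curvature B R"
  shows "linear (\<lambda>X. R X Y Z)" "linear (\<lambda>Y. R X Y Z)" "linear (\<lambda>Z. R X Y Z)"
    "R X Y Z = - R Y X Z" "B (R X Y Z) V = - B Z (R X Y V)" "R X Y Z + R Y Z X + R Z X Y = 0"
  using assms unfolding algebraic_curvature_def by blast+

lemma algebraic_curvature_diff:
  assumes "algebraic_curvature B R" "algebraic_curvature B R'"
  shows "algebraic_curvature B (\<lambda>X Y Z. R X Y Z - c *\<^sub>R R' X Y Z)"
proof -
  note l = algebraic_curvatureD(1-3)[OF assms(1)] algebraic_curvatureD(1-3)[OF assms(2)]
  note a = algebraic_curvatureD(4)[OF assms(1)] algebraic_curvatureD(4)[OF assms(2)]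
    algebraic_curvatureD(5)[OF assms(1)] algebraic_curvatureD(5)[OF assms(2)]
    algebraic_curvatureD(6)[OF assms(1)] algebraic_curvatureD(6)[OF assms(2)]
  show ?thesis
    unfolding algebraic_curvature_def
  proof (intro conjI allI)
    show "linear (\<lambda>X. R X Y Z - c *\<^sub>R R' X Y Z)" for Y Z
      by (intro linear_compose_sub linear_compose_scale_right l)
    show "linear (\<lambda>Y. R X Y Z - c *\<^sub>R R' X Y Z)" for X Z
      by (intro linear_compose_sub linear_compose_scale_right l)
    show "linear (\<lambda>Z. R X Y Z - c *\<^sub>R R' X Y Z)" for X Y
      by (intro linear_compose_sub linear_compose_scale_right l)
    show "R X Y Z - c *\<^sub>R R' X Y Z = - (R Y X Z - c *\<^sub>R R' Y X Z)" for X Y Z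
      by (subst (1) a(1), subst (1) a(2)) simp
    show "B (R X Y Z - c *\<^sub>R R' X Y Z) V = - B Z (R X Y V - c *\<^sub>R R' X Y V)" for X Y Z V
      by (simp only: blinfun.bilinear_simps a(3)[of X Y Z V] a(4)[of X Y Z V]) simp
    show "(R X Y Z - c *\<^sub>R R' X Y Z) + (R Y Z X - c *\<^sub>R R' Y Z X) + (R Z X Y - c *\<^sub>R R' Z X Y) = 0" for X Y Z
    proof -
      have "(R X Y Z - c *\<^sub>R R' X Y Z) + (R Y Z X - c *\<^sub>R R' Y Z X) + (R Z X Y - c *\<^sub>R R' Z X Y)
        = (R X Y Z + R Y Z X + R Z X Y) - c *\<^sub>R (R' X Y Z + R' Y Z X + R' Z X Y)"
        by (simp add: algebra_simps)
      then show ?thesis by (simp only: a(5,6)) simp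
    qed
  qed
qed

text \<open>
  The restrictions b1, b2, b3 of the frame to the tangent spaces form the frame of the induced bundle.
\<close>

locale invariant_patch = immersed_patch U G e1 e2 e3 I1 I2 I3 S f
  for U :: "'e::euclidean_space set" and G e1 e2 e3 I1 I2 I3 and S :: "'m::euclidean_space set" and f +
  assumes invariant: "\<And>y A u. y \<in> S \<Longrightarrow> A \<in> Q (f y) \<Longrightarrow> A (D y u) \<in> range (blinfun_apply (D y))"
begin

definition "b1 = tangential_part (\<lambda>y. I1 (f y))"

definition "b2 = tangential_part (\<lambda>y. I2 (f y))"

definition "b3 = tangential_part (\<lambda>y. I3 (f y))"

abbreviation q where "q y \<equiv> span {b1 y, b2 y, b3 y}"

lemma smooth_b: "smooth_on S b1" "smooth_on S b2" "smooth_on S b3"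
  unfolding b1_def b2_def b3_def by (intro smooth_tangential_part smooth_along smooth_I)+

lemma Ib:
  assumes "y \<in> S"
  shows "I1 (f y) (D y u) = D y (b1 y u)" "I2 (f y) (D y u) = D y (b2 y u)" "I3 (f y) (D y u) = D y (b3 y u)"
proof -
  have *: "I (f y) (D y u) = D y (tangential_part (\<lambda>y. I (f y)) y u)" if IQ: "I (f y) \<in> Q (f y)" for I :: "'e \<Rightarrow> 'e \<Rightarrow>\<^sub>L 'e"
  proof -
    obtain w where w: "I (f y) (D y u) = D y w" using invariant[OF assms IQ] by blast
    show ?thesis using tangential_part_eqI[where A = "\<lambda>y. I (f y)", OF assms w] w by simp
  qed
  show "I1 (f y) (D y u) = D y (b1 y u)" "I2 (f y) (D y u) = D y (b2 y u)" "I3 (f y) (D y u) = D y (b3 y u)"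
    unfolding b1_def b2_def b3_def by (intro * I_in_Q)+
qed

lemma D_eqI: "y \<in> S \<Longrightarrow> D y u = D y v \<Longrightarrow> u = v"
  using D_eq_iff by blast

lemma b_table:
  assumes y: "y \<in> S"
  shows "b1 y (b1 y u) = e1 *\<^sub>R u" "b2 y (b2 y u) = e2 *\<^sub>R u" "b3 y (b3 y u) = e3 *\<^sub>R u"
    "b1 y (b2 y u) = b3 y u" "b2 y (b1 y u) = - b3 y u"
    "b1 y (b3 y u) = e1 *\<^sub>R b2 y u" "b3 y (b1 y u) = - (e1 *\<^sub>R b2 y u)"
    "b2 y (b3 y u) = - (e2 *\<^sub>R b1 y u)" "b3 y (b2 y u) = e2 *\<^sub>R b1 y u"
  by (rule D_eqI[OF y]; simp add: blinfun.bilinear_simps para_hypercomplex_triple_table[OF triple[OF f_U[OF y]]] flip: Ib[OF y])+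

lemma b_triple: "y \<in> S \<Longrightarrow> para_hypercomplex_triple e1 e2 e3 (b1 y) (b2 y) (b3 y)"
  using triple[OF f_U, of y] b_table[of y] unfolding para_hypercomplex_triple_def
  by (auto intro!: blinfun_eqI simp: blinfun.bilinear_simps)

lemma lift_section:
  assumes y: "y \<in> S" and a: "a \<in> q y"
  obtains A where "A \<in> Q (f y)" "\<And>u. A (D y u) = D y (a u)"
proof -
  obtain r s t where a: "a = r *\<^sub>R b1 y + s *\<^sub>R b2 y + t *\<^sub>R b3 y" using a by (rule span_tripleE)
  show thesis
  proof
    show "r *\<^sub>R I1 (f y) + s *\<^sub>R I2 (f y) + t *\<^sub>R I3 (f y) \<in> Q (f y)" by (rule span_tripleI)
    show "(r *\<^sub>R I1 (f y) + s *\<^sub>R I2 (f y) + t *\<^sub>R I3 (f y)) (D y u) = D y (a u)" for u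
      by (simp add: a blinfun.bilinear_simps Ib[OF y])
  qed
qed

lemma restrict_section:
  assumes y: "y \<in> S" and A: "A \<in> Q (f y)"
  obtains a where "a \<in> q y" "\<And>u. A (D y u) = D y (a u)"
proof -
  obtain r s t where A: "A = r *\<^sub>R I1 (f y) + s *\<^sub>R I2 (f y) + t *\<^sub>R I3 (f y)" using A by (rule span_tripleE)
  show thesis
  proof
    show "r *\<^sub>R b1 y + s *\<^sub>R b2 y + t *\<^sub>R b3 y \<in> q y" by (rule span_tripleI)
    show "A (D y u) = D y ((r *\<^sub>R b1 y + s *\<^sub>R b2 y + t *\<^sub>R b3 y) u)" for u
      by (simp add: A blinfun.bilinear_simps Ib[OF y])
  qed
qed

text \<open>
  On the tangent space the coefficients of A are those of a combination of the triple b1, b2, b3, which is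
  independent.
\<close>

lemma restriction_injective:
  assumes y: "y \<in> S" and A: "A \<in> Q (f y)" and 0: "\<And>u. A (D y u) = 0"
  shows "A = 0"
proof -
  obtain r s t where A: "A = r *\<^sub>R I1 (f y) + s *\<^sub>R I2 (f y) + t *\<^sub>R I3 (f y)" using A by (rule span_tripleE)
  have "0 *\<^sub>R u + r *\<^sub>R b1 y u + s *\<^sub>R b2 y u + t *\<^sub>R b3 y u = 0" for u
    using 0[of u] by (intro D_eqI[OF y]) (simp add: A blinfun.bilinear_simps Ib[OF y])
  from triple_linear_independent[OF b_triple[OF y] this] show ?thesis by (simp add: A)
qed

lemma q_skew:
  assumes y: "y \<in> S" and a: "a \<in> q y"
  shows "g y (a u) v = - g y u (a v)"
proof -
  obtain A where A: "A \<in> Q (f y)" "\<And>u. A (D y u) = D y (a u)" by (rule lift_section[OF y a]) blast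
  show ?thesis using I_skew[OF f_U[OF y] A(1)] by (simp add: g_apply flip: A(2))
qed

lemma range_D: "subspace (range (D y))"
  by (rule linear_subspace_image) (simp_all add: bounded_linear.linear blinfun.bounded_linear_right)

lemma frame_leibniz:
  assumes y: "y \<in> S"
  obtains E1 E2 E3 where "E1 \<in> Q (f y)" "E2 \<in> Q (f y)" "E3 \<in> Q (f y)"
    "\<And>Y. hessian y X (b1 y Y) + D y (der b1 y X Y) = E1 (D y Y) + I1 (f y) (hessian y X Y)"
    "\<And>Y. hessian y X (b2 y Y) + D y (der b2 y X Y) = E2 (D y Y) + I2 (f y) (hessian y X Y)"
    "\<And>Y. hessian y X (b3 y Y) + D y (der b3 y X Y) = E3 (D y Y) + I3 (f y) (hessian y X Y)"
proof
  let ?E = "\<lambda>I. cov_endo (\<Gamma> (f y) (D y X)) (I (f y)) (der I (f y) (D y X))"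
  show "?E I1 \<in> Q (f y)" "?E I2 \<in> Q (f y)" "?E I3 \<in> Q (f y)"
    by (intro frame_parallel f_U y)+
  show "hessian y X (b1 y Y) + D y (der b1 y X Y) = ?E I1 (D y Y) + I1 (f y) (hessian y X Y)" for Y
    by (rule leibniz[OF y d_along[OF smooth_I(1) y] smooth_on_has_derivative[OF smooth_b(1) y] Ib(1)])
  show "hessian y X (b2 y Y) + D y (der b2 y X Y) = ?E I2 (D y Y) + I2 (f y) (hessian y X Y)" for Y
    by (rule leibniz[OF y d_along[OF smooth_I(2) y] smooth_on_has_derivative[OF smooth_b(2) y] Ib(2)])
  show "hessian y X (b3 y Y) + D y (der b3 y X Y) = ?E I3 (D y Y) + I3 (f y) (hessian y X Y)" for Y
    by (rule leibniz[OF y d_along[OF smooth_I(3) y] smooth_on_has_derivative[OF smooth_b(3) y] Ib(3)])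
qed

text \<open>
  Modulo the tangent space, the hessian commutes with each I_a in either argument. Hence transforming both
  arguments by b_a multiplies it by e_a. For b3 = b1 b2 this gives the factor e3 as well as e1 e2 = - e3, so the
  hessian vanishes modulo the tangent space: invariant submanifolds are totally geodesic.
\<close>

lemma hessian_tangent:
  assumes y: "y \<in> S"
  shows "hessian y X Y \<in> range (D y)"
proof -
  let ?T = "range (blinfun_apply (D y))"
  have T: "subspace ?T" by (rule range_D)
  have QT: "A x \<in> ?T" if "A \<in> Q (f y)" "x \<in> ?T" for A x using invariant[OF y that(1)] that(2) by auto
  note t = para_hypercomplex_triple_table[OF triple[OF f_U[OF y]]]
  have step: "hessian y X (b1 y Y) - I1 (f y) (hessian y X Y) \<in> ?T" "hessian y X (b2 y Y) - I2 (f y) (hessian y X Y) \<in> ?T"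
    "hessian y X (b3 y Y) - I3 (f y) (hessian y X Y) \<in> ?T" for X Y
  proof -
    obtain E1 E2 E3 where E: "E1 \<in> Q (f y)" "E2 \<in> Q (f y)" "E3 \<in> Q (f y)"
      and e: "hessian y X (b1 y Y) + D y (der b1 y X Y) = E1 (D y Y) + I1 (f y) (hessian y X Y)"
      "hessian y X (b2 y Y) + D y (der b2 y X Y) = E2 (D y Y) + I2 (f y) (hessian y X Y)"
      "hessian y X (b3 y Y) + D y (der b3 y X Y) = E3 (D y Y) + I3 (f y) (hessian y X Y)"
      using frame_leibniz[OF y, of X] by metis
    have "hessian y X (b1 y Y) - I1 (f y) (hessian y X Y) = E1 (D y Y) - D y (der b1 y X Y)"
      "hessian y X (b2 y Y) - I2 (f y) (hessian y X Y) = E2 (D y Y) - D y (der b2 y X Y)"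
      "hessian y X (b3 y Y) - I3 (f y) (hessian y X Y) = E3 (D y Y) - D y (der b3 y X Y)"
      using e by (simp_all add: diff_eq_eq algebra_simps)
    then show "hessian y X (b1 y Y) - I1 (f y) (hessian y X Y) \<in> ?T" "hessian y X (b2 y Y) - I2 (f y) (hessian y X Y) \<in> ?T"
      "hessian y X (b3 y Y) - I3 (f y) (hessian y X Y) \<in> ?T"
      using QT[OF E(1)] QT[OF E(2)] QT[OF E(3)] T by (auto intro!: subspace_diff)
  qed
  have two: "hessian y (b X) (b Y) - e *\<^sub>R hessian y X Y \<in> ?T"
    if I: "I \<in> Q (f y)" and st: "\<And>X Y. hessian y X (b Y) - I (hessian y X Y) \<in> ?T" and II: "\<And>x. I (I x) = e *\<^sub>R x"
    for b :: "'m \<Rightarrow>\<^sub>L 'm" and I e X Y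
  proof -
    have "(hessian y (b X) (b Y) - I (hessian y (b X) Y)) + I (hessian y Y (b X) - I (hessian y Y X)) \<in> ?T"
      by (intro subspace_add T st QT[OF I])
    then show ?thesis by (simp add: II blinfun.diff_right hessian_sym[OF y, of "b X" Y] hessian_sym[OF y, of X Y])
  qed
  have 1: "hessian y (b1 y X) (b1 y Y) - e1 *\<^sub>R hessian y X Y \<in> ?T" for X Y by (rule two[OF I_in_Q(1) step(1) t(1)])
  have 2: "hessian y (b2 y X) (b2 y Y) - e2 *\<^sub>R hessian y X Y \<in> ?T" for X Y by (rule two[OF I_in_Q(2) step(2) t(2)])
  have 3: "hessian y (b3 y X) (b3 y Y) - e3 *\<^sub>R hessian y X Y \<in> ?T" for X Y by (rule two[OF I_in_Q(3) step(3) t(3)])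
  have 4: "hessian y (b3 y X) (b3 y Y) - e1 *\<^sub>R hessian y (b2 y X) (b2 y Y) \<in> ?T"
    using 1[of "b2 y X" "b2 y Y"] by (simp add: b_table[OF y])
  have "(hessian y (b3 y X) (b3 y Y) - e1 *\<^sub>R hessian y (b2 y X) (b2 y Y)) + e1 *\<^sub>R (hessian y (b2 y X) (b2 y Y) - e2 *\<^sub>R hessian y X Y)
      - (hessian y (b3 y X) (b3 y Y) - e3 *\<^sub>R hessian y X Y) \<in> ?T"
    by (intro subspace_add subspace_diff subspace_scale T 2 3 4)
  also have "(hessian y (b3 y X) (b3 y Y) - e1 *\<^sub>R hessian y (b2 y X) (b2 y Y)) + e1 *\<^sub>R (hessian y (b2 y X) (b2 y Y) - e2 *\<^sub>R hessian y X Y)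
      - (hessian y (b3 y X) (b3 y Y) - e3 *\<^sub>R hessian y X Y) = (2 * e3) *\<^sub>R hessian y X Y"
    by (simp add: algebra_simps para_hypercomplex_triple_signs(4)[OF triple[OF f_U[OF y]]] flip: scaleR_2 scaleR_add_left)
  finally have "(1 / (2 * e3)) *\<^sub>R ((2 * e3) *\<^sub>R hessian y X Y) \<in> ?T" by (rule subspace_scale[OF T])
  moreover have "e3 \<noteq> 0" using para_hypercomplex_triple_signs(3)[OF triple[OF f_U[OF y]]] by auto
  ultimately show ?thesis by simp
qed

text \<open>
  The tangential vectors that represent the hessian satisfy the two conditions that characterize the Christoffel
  form of the induced metric.
\<close>

lemma D_\<Gamma>:
  assumes y: "y \<in> S"
  shows "D y (M.\<Gamma> y X Y) = hessian y X Y"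
proof -
  define c where "c X Y = inv (blinfun_apply (D y)) (hessian y X Y)" for X Y
  have Dc: "D y (c X Y) = hessian y X Y" for X Y
    unfolding c_def by (rule f_inv_into_f[OF hessian_tangent[OF y]])
  have lin: "linear (c X)" "linear (\<lambda>X. c X Y)" for X Y
    by (rule linearI; rule D_eqI[OF y]; simp add: Dc blinfun.bilinear_simps hessian_bilinear)+
  define C where "C = blinfun2 c"
  have C: "C X Y = c X Y" for X Y unfolding C_def by (rule blinfun2_apply[OF lin])
  have "is_christoffel g y C"
    unfolding is_christoffel_def
  proof (intro conjI allI)
    show "C X Y = C Y X" for X Y
      by (rule D_eqI[OF y]) (simp add: C Dc hessian_sym[OF y, of X Y])
    fix X Y Z
    have 1: "((\<lambda>z. g z Y Z) has_derivative (\<lambda>h. der g y h Y Z)) (at y)"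
      by (intro has_derivative_blinfun_apply_const M.dG y)
    have 2: "((\<lambda>z. G (f z) (D z Y) (D z Z)) has_derivative
      (\<lambda>h. G (f y) (D y Y) (der D y h Z) + (G (f y) (der D y h Y) + der G (f y) (D y h) (D y Y)) (D y Z))) (at y)"
      by (intro has_derivative_blinfun_apply has_derivative_blinfun_apply_const dD y d_along smooth_G)
    have "der g y X Y Z = G (f y) (D y Y) (der D y X Z) + (G (f y) (der D y X Y) + der G (f y) (D y X) (D y Y)) (D y Z)"
      by (rule has_derivative_eq_on_open[OF open_S y _ 1 2]) (rule g_apply)
    then show "frechet_derivative g (at y) X Y Z = g y (C X Y) Z + g y Y (C X Z)"
      by (simp add: M.der_G[OF y] g_apply C Dc hessian_def \<Gamma>_metric[OF f_U[OF y]] blinfun.bilinear_simps)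
  qed
  then have "M.\<Gamma> y = C" by (rule M.christoffel_eq[OF y])
  then show ?thesis by (simp add: C Dc)
qed

lemma cov_frame:
  assumes y: "y \<in> S"
  shows "cov_endo (M.\<Gamma> y X) (b1 y) (der b1 y X) \<in> q y" "cov_endo (M.\<Gamma> y X) (b2 y) (der b2 y X) \<in> q y"
    "cov_endo (M.\<Gamma> y X) (b3 y) (der b3 y X) \<in> q y"
proof -
  have *: "cov_endo (M.\<Gamma> y X) b b' \<in> q y"
    if E: "E \<in> Q (f y)" and l: "\<And>Y. hessian y X (b Y) + D y (b' Y) = E (D y Y) + I (hessian y X Y)"
      and I: "\<And>u. I (D y u) = D y (b u)" for E I :: "'e \<Rightarrow>\<^sub>L 'e" and b b' :: "'m \<Rightarrow>\<^sub>L 'm"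
  proof -
    obtain a where a: "a \<in> q y" "\<And>u. E (D y u) = D y (a u)" by (rule restrict_section[OF y E]) blast
    have "cov_endo (M.\<Gamma> y X) b b' = a"
    proof (rule blinfun_eqI, rule D_eqI[OF y])
      fix Y
      have "D y (cov_endo (M.\<Gamma> y X) b b' Y) = (hessian y X (b Y) + D y (b' Y)) - I (hessian y X Y)"
        by (simp add: cov_endo_apply blinfun.bilinear_simps flip: D_\<Gamma>[OF y] I)
      also have "\<dots> = D y (a Y)" unfolding l by (simp add: a)
      finally show "D y (cov_endo (M.\<Gamma> y X) b b' Y) = D y (a Y)" .
    qed
    then show ?thesis using a by simp
  qed
  obtain E1 E2 E3 where E: "E1 \<in> Q (f y)" "E2 \<in> Q (f y)" "E3 \<in> Q (f y)"
      and e: "\<And>Y. hessian y X (b1 y Y) + D y (der b1 y X Y) = E1 (D y Y) + I1 (f y) (hessian y X Y)"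
      "\<And>Y. hessian y X (b2 y Y) + D y (der b2 y X Y) = E2 (D y Y) + I2 (f y) (hessian y X Y)"
      "\<And>Y. hessian y X (b3 y Y) + D y (der b3 y X Y) = E3 (D y Y) + I3 (f y) (hessian y X Y)"
    using frame_leibniz[OF y, of X] by metis
  show "cov_endo (M.\<Gamma> y X) (b1 y) (der b1 y X) \<in> q y" by (rule *[OF E(1) e(1) Ib(1)[OF y]])
  show "cov_endo (M.\<Gamma> y X) (b2 y) (der b2 y X) \<in> q y" by (rule *[OF E(2) e(2) Ib(2)[OF y]])
  show "cov_endo (M.\<Gamma> y X) (b3 y) (der b3 y X) \<in> q y" by (rule *[OF E(3) e(3) Ib(3)[OF y]])
qed

text \<open>
  By the Leibniz rule the covariant derivatives of b1, b2, b3 are restrictions of elements of the ambient bundle.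
\<close>

lemma cov_in_q:
  assumes V: "open V" "V \<subseteq> S" "y \<in> V" and a: "\<And>z. z \<in> V \<Longrightarrow> a z \<in> q z" and da: "(a has_derivative a') (at y)"
  shows "cov_endo (M.\<Gamma> y X) (a y) (a' X) \<in> q y"
proof -
  have y: "y \<in> S" using V by blast
  show ?thesis
    by (rule section_cov_in_span[OF V(1,3) _ smooth_on_has_derivative[OF smooth_b(1) y]
          smooth_on_has_derivative[OF smooth_b(2) y] smooth_on_has_derivative[OF smooth_b(3) y] a da])
       (use V in \<open>auto intro!: b_triple cov_frame y\<close>)
qed

text \<open>
  For a totally geodesic immersion the Gauss equation has no quadratic term. It follows by differentiating the
  relation between the two connections; the third derivatives of the immersion cancel by symmetry.
\<close>

lemma gauss:
  assumes y: "y \<in> S"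
  shows "D y (M.R y W X Y) = R (f y) (D y W) (D y X) (D y Y)"
proof -
  have e: "D y (der M.\<Gamma> y W X Y) + der D y W (M.\<Gamma> y X Y)
    = der (der D) y W X Y + (\<Gamma> (f y) (D y X) (der D y W Y)
        + (\<Gamma> (f y) (der D y W X) + der \<Gamma> (f y) (D y W) (D y X)) (D y Y))" for W X Y
  proof -
    have 1: "((\<lambda>z. D z (M.\<Gamma> z X Y)) has_derivative (\<lambda>h. D y (der M.\<Gamma> y h X Y) + der D y h (M.\<Gamma> y X Y))) (at y)"
      by (intro has_derivative_blinfun_apply has_derivative_blinfun_apply_const dD M.d\<Gamma> y)
    have 2: "((\<lambda>z. der D z X Y + \<Gamma> (f z) (D z X) (D z Y)) has_derivative
       (\<lambda>h. der (der D) y h X Y + (\<Gamma> (f y) (D y X) (der D y h Y)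
        + (\<Gamma> (f y) (der D y h X) + der \<Gamma> (f y) (D y h) (D y X)) (D y Y)))) (at y)"
      by (intro has_derivative_add has_derivative_blinfun_apply has_derivative_blinfun_apply_const dD y
          d_along smooth_\<Gamma> smooth_on_has_derivative[OF smooth_on_der[OF open_S smooth_D]])
    show ?thesis
      by (rule has_derivative_eq_on_open[OF open_S y _ 1 2]) (simp add: D_\<Gamma> hessian_def)
  qed
  have e': "D y (der M.\<Gamma> y W X Y)
    = der (der D) y W X Y + (\<Gamma> (f y) (D y X) (der D y W Y)
        + (\<Gamma> (f y) (der D y W X) + der \<Gamma> (f y) (D y W) (D y X)) (D y Y)) - der D y W (M.\<Gamma> y X Y)" for W X Y
    using e[of W X Y] by (simp add: eq_diff_eq)
  have DG: "D y (M.\<Gamma> y W V) = der D y W V + \<Gamma> (f y) (D y W) (D y V)" for W V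
    using D_\<Gamma>[OF y] by (simp add: hessian_def)
  show ?thesis
    by (simp add: M.R_apply R_apply blinfun.bilinear_simps e' DG
        der_der_symmetric[OF open_S smooth_D y, of W X] der_der_symmetric[OF open_S smooth_f y, of W X])
qed

text \<open>
  Restriction to the tangent space is injective on the algebra generated by the bundle, so that the relations of the
  triple on the tangent space lift.
\<close>

lemma lift_triple:
  assumes y: "y \<in> S" and K: "para_hypercomplex_triple s1 s2 s3 K1 K2 K3" and sp: "span {K1, K2, K3} = q y"
  obtains A1 A2 A3 where "para_hypercomplex_triple s1 s2 s3 A1 A2 A3" "span {A1, A2, A3} = Q (f y)"
    "\<And>u. A1 (D y u) = D y (K1 u)" "\<And>u. A2 (D y u) = D y (K2 u)" "\<And>u. A3 (D y u) = D y (K3 u)"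
proof -
  have "K1 \<in> q y" "K2 \<in> q y" "K3 \<in> q y" unfolding sp[symmetric] by (auto intro: span_base)
  then obtain A1 A2 A3 where A: "A1 \<in> Q (f y)" "A2 \<in> Q (f y)" "A3 \<in> Q (f y)"
    and D: "\<And>u. A1 (D y u) = D y (K1 u)" "\<And>u. A2 (D y u) = D y (K2 u)" "\<And>u. A3 (D y u) = D y (K3 u)"
    by (meson lift_section[OF y])
  note t = triple[OF f_U[OF y]] and T = para_hypercomplex_triple_table[OF K]
  obtain u0 :: 'm where u0: "u0 \<noteq> 0" by (metis SOME_Basis nonzero_Basis)
  then have Du0: "D y u0 \<noteq> 0" using D_eqI[OF y, of u0 0] by (auto simp: blinfun.zero_right)
  have scalar: "s = r" if "s *\<^sub>R D y u0 = r *\<^sub>R D y u0" for s r using that Du0 by simp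
  have sq: "A x = s *\<^sub>R x" if "\<And>x. A x = r *\<^sub>R x" "A (D y u0) = s *\<^sub>R D y u0" for A :: "'e \<Rightarrow> 'e" and r s x
    using that scalar[of r s] by simp
  have square: "A o\<^sub>L A = s *\<^sub>R id_blinfun" if AQ: "A \<in> Q (f y)" and "A (A (D y u0)) = s *\<^sub>R D y u0" for A s
  proof -
    obtain r where r: "\<And>x. A (A x) = r *\<^sub>R x" using triple_square_scalar[OF t AQ] by blast
    then have "r = s" using that(2) scalar by metis
    then show ?thesis by (intro blinfun_eqI) (simp add: r blinfun.bilinear_simps)
  qed
  have anti: "A o\<^sub>L B = - (B o\<^sub>L A)" if AQ: "A \<in> Q (f y)" "B \<in> Q (f y)" and "A (B (D y u0)) + B (A (D y u0)) = 0" for A B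
  proof -
    obtain r where r: "\<And>x. A (B x) + B (A x) = r *\<^sub>R x" using triple_anticommutator_scalar[OF t AQ] by blast
    then have "r = 0" using that(3) scalar[of r 0] by simp
    then have "A (B x) = - B (A x)" for x using r[of x] by (simp add: eq_neg_iff_add_eq_0)
    then show ?thesis by (intro blinfun_eqI) (simp add: blinfun.bilinear_simps)
  qed
  have a12: "A1 o\<^sub>L A2 = - (A2 o\<^sub>L A1)" by (rule anti[OF A(1,2)]) (simp add: D T blinfun.bilinear_simps)
  have "A1 o\<^sub>L A2 = (1/2) *\<^sub>R ((A1 o\<^sub>L A2) - (A2 o\<^sub>L A1))"
  proof (rule blinfun_eqI)
    fix x
    have "A2 (A1 x) = - A1 (A2 x)"
      using arg_cong[OF a12, of "\<lambda>B. blinfun_apply B x"] by (simp add: blinfun.minus_left)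
    then show "(A1 o\<^sub>L A2) x = ((1/2) *\<^sub>R ((A1 o\<^sub>L A2) - (A2 o\<^sub>L A1))) x"
      by (simp add: blinfun.bilinear_simps flip: scaleR_2)
  qed
  also have "\<dots> \<in> Q (f y)" by (intro span_scale triple_commutator_in_span[OF t] A)
  finally have "A3 - (A1 o\<^sub>L A2) \<in> Q (f y)" by (intro span_diff A)
  from restriction_injective[OF y this] have a3: "A3 = A1 o\<^sub>L A2" by (simp add: D T blinfun.bilinear_simps)
  have tr: "para_hypercomplex_triple s1 s2 s3 A1 A2 A3"
    unfolding para_hypercomplex_triple_def
  proof (intro conjI)
    show "(s1, s2, s3) \<in> para_quaternionic_signs" using K by (simp add: para_hypercomplex_triple_def)
    show "A1 o\<^sub>L A1 = s1 *\<^sub>R id_blinfun" by (rule square[OF A(1)]) (simp add: D T blinfun.bilinear_simps)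
    show "A2 o\<^sub>L A2 = s2 *\<^sub>R id_blinfun" by (rule square[OF A(2)]) (simp add: D T blinfun.bilinear_simps)
    show "A3 o\<^sub>L A3 = s3 *\<^sub>R id_blinfun" by (rule square[OF A(3)]) (simp add: D T blinfun.bilinear_simps)
    show "A1 o\<^sub>L A3 = - (A3 o\<^sub>L A1)" by (rule anti[OF A(1,3)]) (simp add: D T blinfun.bilinear_simps)
    show "A2 o\<^sub>L A3 = - (A3 o\<^sub>L A2)" by (rule anti[OF A(2,3)]) (simp add: D T blinfun.bilinear_simps)
  qed (rule a12 a3)+
  have "I \<in> span {A1, A2, A3}" if IQ: "I \<in> Q (f y)" for I
  proof -
    obtain b where b: "b \<in> q y" "\<And>u. I (D y u) = D y (b u)" by (rule restrict_section[OF y IQ]) blast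
    obtain l m n where bl: "b = l *\<^sub>R K1 + m *\<^sub>R K2 + n *\<^sub>R K3" using b(1) unfolding sp[symmetric] by (rule span_tripleE)
    let ?A = "l *\<^sub>R A1 + m *\<^sub>R A2 + n *\<^sub>R A3"
    have "I - ?A \<in> Q (f y)" by (intro span_diff span_add span_scale IQ A)
    from restriction_injective[OF y this] have "I = ?A" by (simp add: b bl D blinfun.bilinear_simps)
    then show ?thesis using span_tripleI by metis
  qed
  then have "Q (f y) \<subseteq> span {A1, A2, A3}" by (rule subsetI)
  moreover have "span {A1, A2, A3} \<subseteq> Q (f y)" by (rule span_minimal) (use A in simp_all)
  ultimately have "span {A1, A2, A3} = Q (f y)" by (rule subset_antisym[rotated])
  from that[OF tr this D] show thesis .
qed

lemma D_R0:
  fixes A1 A2 A3 :: "'e \<Rightarrow>\<^sub>L 'e" and K1 K2 K3 :: "'m \<Rightarrow>\<^sub>L 'm"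
  assumes "\<And>u. A1 (D y u) = D y (K1 u)" "\<And>u. A2 (D y u) = D y (K2 u)" "\<And>u. A3 (D y u) = D y (K3 u)"
  shows "D y (R0 (g y) s1 s2 s3 K1 K2 K3 X Y Z) = R0 (G (f y)) s1 s2 s3 A1 A2 A3 (D y X) (D y Y) (D y Z)"
  by (simp add: R0_def wedge_endo_def g_apply assms blinfun.bilinear_simps)

text \<open>
  For an ambient space of dimension at least 8, the ambient curvature minus a multiple of R0 commutes with
  the bundle. By the Gauss equation this passes to the tangent space, where such a curvature tensor is trace-free
  and invariant under the bundle.
\<close>

lemma curvature_decomposition_large_ambient:
  assumes y: "y \<in> S" and K: "para_hypercomplex_triple s1 s2 s3 K1 K2 K3" and sp: "q y = span {K1, K2, K3}"
    and dim: "DIM('e) \<ge> 8"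
  shows "\<exists>\<nu> W. algebraic_curvature (g y) W \<and> trace_free W \<and> Q_invariant_curvature (q y) W \<and>
     (\<forall>X Y Z. M.R y X Y Z = \<nu> *\<^sub>R R0 (g y) s1 s2 s3 K1 K2 K3 X Y Z + W X Y Z)"
proof -
  obtain A1 A2 A3 where A: "para_hypercomplex_triple s1 s2 s3 A1 A2 A3" "span {A1, A2, A3} = Q (f y)"
    and DK: "\<And>u. A1 (D y u) = D y (K1 u)" "\<And>u. A2 (D y u) = D y (K2 u)" "\<And>u. A3 (D y u) = D y (K3 u)"
    using lift_triple[OF y K sp[symmetric]] by metis
  have KQ: "K1 \<in> q y" "K2 \<in> q y" "K3 \<in> q y" unfolding sp by (auto intro: span_base)
  have AQ: "A1 \<in> Q (f y)" "A2 \<in> Q (f y)" "A3 \<in> Q (f y)" unfolding A(2)[symmetric] by (auto intro: span_base)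
  have fy: "f y \<in> U" by (rule f_U[OF y])
  interpret a: skew_triple "G (f y)" s1 s2 s3 A1 A2 A3
    by unfold_locales (auto intro: G_sym G_nondeg fy A I_skew AQ)
  interpret m: skew_triple "g y" s1 s2 s3 K1 K2 K3
    by unfold_locales (auto intro: M.G_sym M.G_nondeg y K q_skew KQ)
  have n: "\<exists>p1 p2 p3. \<forall>Z. R (f y) X Y (B Z) - B (R (f y) X Y Z) = p1 *\<^sub>R A1 Z + p2 *\<^sub>R A2 Z + p3 *\<^sub>R A3 Z"
    if BQ: "B \<in> Q (f y)" for X Y B
  proof -
    obtain p1 p2 p3 where "(R (f y) X Y o\<^sub>L B) - (B o\<^sub>L R (f y) X Y) = p1 *\<^sub>R A1 + p2 *\<^sub>R A2 + p3 *\<^sub>R A3"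
      using curvature_normalizes[OF fy BQ] unfolding A(2)[symmetric] by (rule span_tripleE)
    then have "((R (f y) X Y o\<^sub>L B) - (B o\<^sub>L R (f y) X Y)) Z = (p1 *\<^sub>R A1 + p2 *\<^sub>R A2 + p3 *\<^sub>R A3) Z" for Z by simp
    then show ?thesis by (auto simp: blinfun.bilinear_simps)
  qed
  obtain \<nu> where \<nu>: "\<And>X Y Z. R (f y) X Y (A1 Z) - A1 (R (f y) X Y Z) = \<nu> *\<^sub>R (a.R0' X Y (A1 Z) - A1 (a.R0' X Y Z))"
    "\<And>X Y Z. R (f y) X Y (A2 Z) - A2 (R (f y) X Y Z) = \<nu> *\<^sub>R (a.R0' X Y (A2 Z) - A2 (a.R0' X Y Z))"
    "\<And>X Y Z. R (f y) X Y (A3 Z) - A3 (R (f y) X Y Z) = \<nu> *\<^sub>R (a.R0' X Y (A3 Z) - A3 (a.R0' X Y Z))"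
    using a.quaternionic_curvature_decomposition[OF dim R_algebraic[OF fy] n[OF AQ(1)] n[OF AQ(2)] n[OF AQ(3)]]
    by blast
  define W where "W X Y Z = M.R y X Y Z - \<nu> *\<^sub>R m.R0' X Y Z" for X Y Z
  have Walg: "algebraic_curvature (g y) W"
    unfolding W_def by (rule algebraic_curvature_diff[OF M.R_algebraic[OF y] m.R0_algebraic_curvature])
  have DW: "D y (W X Y Z) = R (f y) (D y X) (D y Y) (D y Z) - \<nu> *\<^sub>R a.R0' (D y X) (D y Y) (D y Z)" for X Y Z
    by (simp add: W_def blinfun.bilinear_simps gauss[OF y] D_R0[OF DK])
  have comm: "W X Y (K Z) = K (W X Y Z)"
    if DK: "\<And>u. A (D y u) = D y (K u)"
      and \<nu>: "\<And>X Y Z. R (f y) X Y (A Z) - A (R (f y) X Y Z) = \<nu> *\<^sub>R (a.R0' X Y (A Z) - A (a.R0' X Y Z))"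
    for A :: "'e \<Rightarrow>\<^sub>L 'e" and K :: "'m \<Rightarrow>\<^sub>L 'm" and X Y Z
  proof (rule D_eqI[OF y])
    have "D y (W X Y (K Z)) - A (D y (W X Y Z)) = (R (f y) (D y X) (D y Y) (A (D y Z)) - A (R (f y) (D y X) (D y Y) (D y Z)))
       - \<nu> *\<^sub>R (a.R0' (D y X) (D y Y) (A (D y Z)) - A (a.R0' (D y X) (D y Y) (D y Z)))"
      by (simp add: DW DK blinfun.bilinear_simps algebra_simps)
    also have "\<dots> = 0" unfolding \<nu> by simp
    finally show "D y (W X Y (K Z)) = D y (K (W X Y Z))" by (simp add: DK)
  qed
  note cm = comm[OF DK(1) \<nu>(1)] comm[OF DK(2) \<nu>(2)] comm[OF DK(3) \<nu>(3)]
  have "M.R y X Y Z = \<nu> *\<^sub>R m.R0' X Y Z + W X Y Z" for X Y Z by (simp add: W_def)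
  then show ?thesis
    using Walg m.commuting_curvature[OF Walg cm] unfolding sp by blast
qed

text \<open>
  If the dimensions agree, the differential is an isomorphism and the decomposition is transported.
\<close>

lemma curvature_decomposition_transport:
  assumes y: "y \<in> S" and K: "para_hypercomplex_triple s1 s2 s3 K1 K2 K3" and sp: "q y = span {K1, K2, K3}"
    and dim: "DIM('e) = DIM('m)"
    and dec: "\<And>A1 A2 A3. para_hypercomplex_triple s1 s2 s3 A1 A2 A3 \<Longrightarrow> Q (f y) = span {A1, A2, A3} \<Longrightarrow>
      \<exists>\<nu> W. algebraic_curvature (G (f y)) W \<and> trace_free W \<and> Q_invariant_curvature (Q (f y)) W \<and>
     (\<forall>X Y Z. R (f y) X Y Z = \<nu> *\<^sub>R R0 (G (f y)) s1 s2 s3 A1 A2 A3 X Y Z + W X Y Z)"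
  shows "\<exists>\<nu> W. algebraic_curvature (g y) W \<and> trace_free W \<and> Q_invariant_curvature (q y) W \<and>
     (\<forall>X Y Z. M.R y X Y Z = \<nu> *\<^sub>R R0 (g y) s1 s2 s3 K1 K2 K3 X Y Z + W X Y Z)"
proof -
  obtain A1 A2 A3 where A: "para_hypercomplex_triple s1 s2 s3 A1 A2 A3" "span {A1, A2, A3} = Q (f y)"
    and DK: "\<And>u. A1 (D y u) = D y (K1 u)" "\<And>u. A2 (D y u) = D y (K2 u)" "\<And>u. A3 (D y u) = D y (K3 u)"
    using lift_triple[OF y K sp[symmetric]] by metis
  obtain \<nu> W where W: "algebraic_curvature (G (f y)) W" "trace_free W" "Q_invariant_curvature (Q (f y)) W"
    and RW: "\<And>X Y Z. R (f y) X Y Z = \<nu> *\<^sub>R R0 (G (f y)) s1 s2 s3 A1 A2 A3 X Y Z + W X Y Z"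
    using dec[OF A(1) A(2)[symmetric]] by blast
  have linD: "linear (D y)" by (simp add: bounded_linear.linear blinfun.bounded_linear_right)
  have "dim (range (D y)) = DIM('m)"
    using dim_image_eq[OF linD, of UNIV] inj_D[OF y] by simp
  then have surj: "range (D y) = UNIV"
    using dim subspace_dim_equal[OF range_D[of y] subspace_UNIV] by simp
  define H where "H = inv (blinfun_apply (D y))"
  have DH: "D y (H x) = x" for x unfolding H_def using surj by (simp add: surj_f_inv_f)
  have HD: "H (D y u) = u" for u unfolding H_def using inj_D[OF y] by simp
  have linH: "linear H" by (rule linearI; rule D_eqI[OF y]; simp add: DH blinfun.bilinear_simps)
  define V where "V X Y Z = H (W (D y X) (D y Y) (D y Z))" for X Y Z
  have DV: "D y (V X Y Z) = W (D y X) (D y Y) (D y Z)" for X Y Z by (simp add: V_def DH)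
  note Wd = algebraic_curvatureD[OF W(1)]
  have "algebraic_curvature (g y) V"
    unfolding algebraic_curvature_def
  proof (intro conjI allI)
    note Wl = Wd(1)[THEN linear_add] Wd(2)[THEN linear_add] Wd(3)[THEN linear_add]
      Wd(1)[THEN linear_cmul] Wd(2)[THEN linear_cmul] Wd(3)[THEN linear_cmul]
    show "linear (\<lambda>X. V X Y Z)" for Y Z
      by (rule linearI; rule D_eqI[OF y]; simp only: DV blinfun.add_right blinfun.scaleR_right Wl)
    show "linear (\<lambda>Y. V X Y Z)" for X Z
      by (rule linearI; rule D_eqI[OF y]; simp only: DV blinfun.add_right blinfun.scaleR_right Wl)
    show "linear (\<lambda>Z. V X Y Z)" for X Y
      by (rule linearI; rule D_eqI[OF y]; simp only: DV blinfun.add_right blinfun.scaleR_right Wl)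
    show "V X Y Z = - V Y X Z" for X Y Z
      by (rule D_eqI[OF y]; simp only: DV blinfun.minus_right; rule Wd(4))
    show "g y (V X Y Z) V' = - g y Z (V X Y V')" for X Y Z V'
      unfolding g_apply DV by (rule Wd(5))
    show "V X Y Z + V Y Z X + V Z X Y = 0" for X Y Z
      by (rule D_eqI[OF y]; simp only: DV blinfun.add_right blinfun.zero_right; rule Wd(6))
  qed
  moreover have "trace_free V"
    unfolding trace_free_def
  proof (intro allI)
    fix Y Z
    have "endo_trace (\<lambda>X. H (W (D y X) (D y Y) (D y Z))) = endo_trace (\<lambda>X. D y (H (W X (D y Y) (D y Z))))"
      using endo_trace_commute[OF linear_compose[OF Wd(1) linH] linD] by (simp only: o_def)
    then show "endo_trace (\<lambda>X. V X Y Z) = 0" using W(2) by (simp add: V_def DH trace_free_def)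
  qed
  moreover have "Q_invariant_curvature (q y) V"
    unfolding Q_invariant_curvature_def
  proof (intro ballI allI)
    fix a X Y Z assume a: "a \<in> q y"
    obtain A where A: "A \<in> Q (f y)" "\<And>u. A (D y u) = D y (a u)" by (rule lift_section[OF y a]) blast
    show "a (V X Y Z) - V (a X) Y Z - V X (a Y) Z - V X Y (a Z) = 0"
      by (rule D_eqI[OF y])
         (use W(3) A(1) in \<open>simp add: blinfun.bilinear_simps DV Q_invariant_curvature_def flip: A(2)\<close>)
  qed
  moreover have "M.R y X Y Z = \<nu> *\<^sub>R R0 (g y) s1 s2 s3 K1 K2 K3 X Y Z + V X Y Z" for X Y Z
    by (rule D_eqI[OF y]) (simp add: gauss[OF y] RW D_R0[OF DK] DV blinfun.bilinear_simps)
  ultimately show ?thesis by blast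
qed

end

section \<open>Charts\<close>

lemma chart_facts:
  assumes M: "smooth_manifold M" and c: "c \<in> atlas M"
  shows chart_dom_openin: "openin (mtop M) (chart_dom c)"
    and chart_range_open: "open (chart_map c ` chart_dom c)"
    and chart_inj_on: "inj_on (chart_map c) (chart_dom c)"
    and chart_image_open: "\<And>V. openin (mtop M) V \<Longrightarrow> V \<subseteq> chart_dom c \<Longrightarrow> open (chart_map c ` V)"
    and chart_preimage_open: "\<And>W. open W \<Longrightarrow> W \<subseteq> chart_map c ` chart_dom c \<Longrightarrow> openin (mtop M) (chart_inv c ` W)"
proof -
  have 1: "openin (mtop M) (chart_dom c)" and 2: "open (chart_map c ` chart_dom c)"
    and h: "homeomorphic_map (subtopology (mtop M) (chart_dom c)) (top_of_set (chart_map c ` chart_dom c)) (chart_map c)"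
    using M c unfolding smooth_manifold_def by blast+
  have ts: "topspace (subtopology (mtop M) (chart_dom c)) = chart_dom c"
    using openin_subset[OF 1] by auto
  show "openin (mtop M) (chart_dom c)" "open (chart_map c ` chart_dom c)" by fact+
  show inj: "inj_on (chart_map c) (chart_dom c)"
    using homeomorphic_imp_injective_map[OF h] ts by simp
  have iff: "openin (mtop M) V \<longleftrightarrow> open (chart_map c ` V)" if "V \<subseteq> chart_dom c" for V
    using homeomorphic_map_openness[OF h, of V] that ts openin_open_subtopology[OF 1, of V] openin_open_eq[OF 2, of "chart_map c ` V"]
    by auto
  show "open (chart_map c ` V)" if "openin (mtop M) V" "V \<subseteq> chart_dom c" for V
    using iff that by blast
  show "openin (mtop M) (chart_inv c ` W)" if W: "open W" "W \<subseteq> chart_map c ` chart_dom c" for W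
  proof -
    have "chart_map c ` chart_inv c ` W = W"
      unfolding chart_inv_def using W(2) by (rule image_inv_into_cancel[OF refl])
    moreover have "chart_inv c ` W \<subseteq> chart_dom c"
      unfolding chart_inv_def using W(2) by (auto intro: inv_into_into)
    ultimately show ?thesis using iff W(1) by metis
  qed
qed

lemma chart_inv_map:
  assumes "smooth_manifold M" "c \<in> atlas M" "p \<in> chart_dom c"
  shows "chart_inv c (chart_map c p) = p"
  unfolding chart_inv_def using chart_inj_on[OF assms(1,2)] assms(3) by simp

lemma chart_map_inv: "y \<in> chart_map c ` chart_dom c \<Longrightarrow> chart_map c (chart_inv c y) = y"
  unfolding chart_inv_def by (rule f_inv_into_f)

lemma chart_cover: "smooth_manifold M \<Longrightarrow> p \<in> topspace (mtop M) \<Longrightarrow> \<exists>c\<in>atlas M. p \<in> chart_dom c"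
  unfolding smooth_manifold_def by blast

lemma chart_dom_topspace: "smooth_manifold M \<Longrightarrow> c \<in> atlas M \<Longrightarrow> chart_dom c \<subseteq> topspace (mtop M)"
  using chart_dom_openin openin_subset by metis

text \<open>
  The transition maps compose near p by the factorization assumed for the charts; c1, c2 and c3 may
  belong to different manifolds.
\<close>

lemma dcoord_chain:
  assumes W: "open W" "chart_map c1 p \<in> W"
    and fac: "\<And>z. z \<in> W \<Longrightarrow> chart_inv c2 (chart_map c2 (chart_inv c1 z)) = chart_inv c1 z"
    and p: "chart_inv c1 (chart_map c1 p) = p"
    and d12: "(chart_map c2 \<circ> chart_inv c1) differentiable (at (chart_map c1 p))"
    and d23: "(chart_map c3 \<circ> chart_inv c2) differentiable (at (chart_map c2 p))"
  shows "dcoord c1 c3 p u = dcoord c2 c3 p (dcoord c1 c2 p u)"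
proof -
  let ?f = "chart_map c2 \<circ> chart_inv c1" and ?g = "chart_map c3 \<circ> chart_inv c2"
  have e: "?f (chart_map c1 p) = chart_map c2 p" by (simp add: p)
  have "((?g \<circ> ?f) has_derivative (frechet_derivative ?g (at (chart_map c2 p)) \<circ> frechet_derivative ?f (at (chart_map c1 p)))) (at (chart_map c1 p))"
  proof (rule diff_chain_at)
    show "(?f has_derivative frechet_derivative ?f (at (chart_map c1 p))) (at (chart_map c1 p))"
      using d12 by (simp only: frechet_derivative_works)
    show "(?g has_derivative frechet_derivative ?g (at (chart_map c2 p))) (at (?f (chart_map c1 p)))"
      unfolding e using d23 by (simp only: frechet_derivative_works)
  qed
  moreover have "(?g \<circ> ?f) z = (chart_map c3 \<circ> chart_inv c1) z" if "z \<in> W" for z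
    using fac[OF that] by simp
  ultimately have "((chart_map c3 \<circ> chart_inv c1) has_derivative (frechet_derivative ?g (at (chart_map c2 p)) \<circ> frechet_derivative ?f (at (chart_map c1 p)))) (at (chart_map c1 p))"
    using has_derivative_cong_open[OF W, of "?g \<circ> ?f" "chart_map c3 \<circ> chart_inv c1"] by blast
  from frechet_derivative_eqI[OF this] show ?thesis
    by (simp add: dcoord_def coord_deriv_def)
qed

lemma transition_smooth:
  assumes "smooth_manifold M" "c \<in> atlas M" "c' \<in> atlas M"
  shows "smooth_on (chart_map c ` (chart_dom c \<inter> chart_dom c')) (chart_map c' \<circ> chart_inv c)"
  using assms unfolding smooth_manifold_def smooth_in_chart_def by blast

lemma dcoord_self:
  assumes M: "smooth_manifold M" and c: "c \<in> atlas M" and p: "p \<in> chart_dom c"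
  shows "dcoord c c p u = u"
proof -
  have "frechet_derivative (chart_map c \<circ> chart_inv c) (at (chart_map c p)) = frechet_derivative (\<lambda>z. z) (at (chart_map c p))"
    by (rule frechet_derivative_cong_open[OF chart_range_open[OF M c]]) (use p in \<open>auto simp: chart_map_inv\<close>)
  then show ?thesis
    by (simp add: dcoord_def coord_deriv_def frechet_derivative_eqI[OF has_derivative_ident])
qed

lemma levi_civita_christoffel:
  assumes "smooth_manifold M" "c \<in> atlas M" "p \<in> chart_dom c"
  shows "levi_civita g c p = christoffel (g c \<circ> chart_inv c) (chart_map c p)"
  unfolding levi_civita_def christoffel_def is_christoffel_def coord_deriv_def
  by (simp add: chart_inv_map[OF assms])

lemma chart_local_metric:
  assumes "pseudo_riemannian M g" "c \<in> atlas M"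
  shows "local_metric (chart_map c ` chart_dom c) (g c \<circ> chart_inv c)"
proof -
  have M: "smooth_manifold M" using assms by (simp add: pseudo_riemannian_def)
  have sm: "smooth_in_chart c (chart_dom c) (g c)"
    and sn: "\<And>p. p \<in> chart_dom c \<Longrightarrow> (\<forall>u v. g c p u v = g c p v u) \<and> nondegenerate_on (g c p) UNIV"
    using assms unfolding pseudo_riemannian_def by blast+
  show ?thesis
  proof
    show "open (chart_map c ` chart_dom c)" by (rule chart_range_open[OF M assms(2)])
    show "smooth_on (chart_map c ` chart_dom c) (g c \<circ> chart_inv c)"
      using sm by (simp only: smooth_in_chart_def)
    fix z assume "z \<in> chart_map c ` chart_dom c"
    then obtain p where p: "p \<in> chart_dom c" and z: "z = chart_map c p" by blast
    have e: "(g c \<circ> chart_inv c) z = g c p" by (simp add: z chart_inv_map[OF M assms(2) p])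
    show "(g c \<circ> chart_inv c) z u v = (g c \<circ> chart_inv c) z v u" for u v
      unfolding e using sn[OF p] by blast
    show "nondegenerate_on ((g c \<circ> chart_inv c) z) UNIV"
      unfolding e using sn[OF p] by blast
  qed
qed

lemma curvature_coord:
  assumes g: "pseudo_riemannian M g" and c: "c \<in> atlas M" and p: "p \<in> chart_dom c"
  shows "curvature g c p X Y = coord_curvature (christoffel (g c \<circ> chart_inv c)) (chart_map c p) X Y"
proof -
  have M: "smooth_manifold M" using g by (simp add: pseudo_riemannian_def)
  interpret local_metric "chart_map c ` chart_dom c" "g c \<circ> chart_inv c"
    by (rule chart_local_metric[OF g c])
  have y: "chart_map c p \<in> chart_map c ` chart_dom c" using p by blast
  have "frechet_derivative (levi_civita g c \<circ> chart_inv c) (at (chart_map c p)) = frechet_derivative \<Gamma> (at (chart_map c p))"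
    by (rule frechet_derivative_cong_open[OF open_U y])
       (auto simp: levi_civita_christoffel[OF M c] chart_inv_map[OF M c])
  also have "\<dots> = blinfun_apply (der \<Gamma> (chart_map c p))"
    by (rule frechet_derivative_eqI[OF d\<Gamma>[OF y]])
  finally show ?thesis
    by (simp add: curvature_def coord_curvature_def coord_deriv_def levi_civita_christoffel[OF M c p])
qed

lemma christoffel_cong:
  assumes "open S" "y \<in> S" "\<And>z. z \<in> S \<Longrightarrow> G z = G' z"
  shows "christoffel G y = christoffel G' y"
  unfolding christoffel_def is_christoffel_def
  using assms(3)[OF assms(2)] frechet_derivative_cong_open[OF assms] by simp

lemma coord_curvature_cong:
  assumes "open S" "y \<in> S" "\<And>z. z \<in> S \<Longrightarrow> \<Gamma> z = \<Gamma>' z"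
  shows "coord_curvature \<Gamma> y = coord_curvature \<Gamma>' y"
  unfolding coord_curvature_def fun_eq_iff
  using assms(3)[OF assms(2)] der_cong_open[OF assms] by simp

text \<open>
  The coordinate expression of the structure in a chart, on the domain of a local frame of the bundle.
\<close>

lemma quaternionic_patch_exists:
  fixes Mt :: "('a, 'e::euclidean_space) manifold"
  assumes pqk: "para_quaternionic_kahler n Mt Q gt" and C: "C \<in> atlas Mt" and p: "p \<in> chart_dom C"
  obtains V e1 e2 e3 I1 I2 I3 where "openin (mtop Mt) V" "p \<in> V" "V \<subseteq> chart_dom C"
    "quaternionic_patch (chart_map C ` V) (gt C \<circ> chart_inv C) e1 e2 e3 I1 I2 I3"
    "\<And>q. q \<in> V \<Longrightarrow> Q C q = span {I1 (chart_map C q), I2 (chart_map C q), I3 (chart_map C q)}"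
proof -
  have pr: "pseudo_riemannian Mt gt" and ap: "almost_para_quaternionic Mt Q"
    and sk: "\<And>p A X Y. p \<in> chart_dom C \<Longrightarrow> A \<in> Q C p \<Longrightarrow> gt C p (A X) Y = - gt C p X (A Y)"
    and lc: "levi_civita_preserves Mt gt Q"
    using pqk C by (auto simp: para_quaternionic_kahler_def)
  have Mt: "smooth_manifold Mt" using pr by (simp add: pseudo_riemannian_def)
  obtain V e1 e2 e3 J1 J2 J3 where V: "openin (mtop Mt) V" "p \<in> V" "V \<subseteq> chart_dom C"
    and sm: "smooth_in_chart C V J1" "smooth_in_chart C V J2" "smooth_in_chart C V J3"
    and t: "\<And>q. q \<in> V \<Longrightarrow> para_hypercomplex_triple e1 e2 e3 (J1 q) (J2 q) (J3 q)"
      "\<And>q. q \<in> V \<Longrightarrow> Q C q = span {J1 q, J2 q, J3 q}"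
    using ap C p unfolding almost_para_quaternionic_def by metis
  let ?U = "chart_map C ` V" and ?G = "gt C \<circ> chart_inv C"
  have U: "open ?U" by (rule chart_image_open[OF Mt C V(1,3)])
  note im = chart_inv_map[OF Mt C]
  have inv: "chart_inv C (chart_map C q) = q" if "q \<in> V" for q using im V(3) that by blast
  interpret L: local_metric "chart_map C ` chart_dom C" ?G by (rule chart_local_metric[OF pr C])
  have sub: "?U \<subseteq> chart_map C ` chart_dom C" using V(3) by blast
  have QI: "Q C q = span {(J1 \<circ> chart_inv C) (chart_map C q), (J2 \<circ> chart_inv C) (chart_map C q), (J3 \<circ> chart_inv C) (chart_map C q)}"
    if "q \<in> V" for q using t(2)[OF that] by (simp add: inv[OF that])
  have "quaternionic_patch ?U ?G e1 e2 e3 (J1 \<circ> chart_inv C) (J2 \<circ> chart_inv C) (J3 \<circ> chart_inv C)"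
  proof
    show "open ?U" by (rule U)
    show "smooth_on ?U ?G" by (rule smooth_on_subset[OF L.smooth_G sub])
    show "smooth_on ?U (J1 \<circ> chart_inv C)" "smooth_on ?U (J2 \<circ> chart_inv C)" "smooth_on ?U (J3 \<circ> chart_inv C)"
      using sm by (simp_all add: smooth_in_chart_def)
    fix z assume z: "z \<in> ?U"
    then obtain q where q: "q \<in> V" "z = chart_map C q" by blast
    show "?G z u v = ?G z v u" for u v using L.G_sym z sub by blast
    show "nondegenerate_on (?G z) UNIV" using L.G_nondeg z sub by blast
    show "para_hypercomplex_triple e1 e2 e3 ((J1 \<circ> chart_inv C) z) ((J2 \<circ> chart_inv C) z) ((J3 \<circ> chart_inv C) z)"
      using t(1)[OF q(1)] by (simp add: q inv)
    show "?G z (A u) v = - ?G z u (A v)"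
      if "A \<in> span {(J1 \<circ> chart_inv C) z, (J2 \<circ> chart_inv C) z, (J3 \<circ> chart_inv C) z}" for A u v
      using sk[of q A u v] that QI[OF q(1)] q V(3) by (auto simp: inv)
    show "cov_endo (christoffel ?G z X) (A z) (der A z X) \<in> span {(J1 \<circ> chart_inv C) z, (J2 \<circ> chart_inv C) z, (J3 \<circ> chart_inv C) z}"
      if A: "smooth_on ?U A" and AQ: "\<And>z. z \<in> ?U \<Longrightarrow> A z \<in> span {(J1 \<circ> chart_inv C) z, (J2 \<circ> chart_inv C) z, (J3 \<circ> chart_inv C) z}" for A X
    proof -
      have eq: "((A \<circ> chart_map C) \<circ> chart_inv C) z = A z" if "z \<in> ?U" for z
        using that sub by (auto simp: chart_map_inv)
      have "smooth_in_chart C V (A \<circ> chart_map C)"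
        unfolding smooth_in_chart_def using smooth_on_cong[OF U, of "(A \<circ> chart_map C) \<circ> chart_inv C" A] eq A by blast
      moreover have "\<forall>q\<in>V. (A \<circ> chart_map C) q \<in> Q C q" using AQ QI by auto
      ultimately have cv: "cov_deriv_endo gt C (A \<circ> chart_map C) q X \<in> Q C q"
        using lc C V q(1) unfolding levi_civita_preserves_def by blast
      have "frechet_derivative ((A \<circ> chart_map C) \<circ> chart_inv C) (at z) = frechet_derivative A (at z)"
        by (rule frechet_derivative_cong_open[OF U z eq])
      also have "\<dots> = blinfun_apply (der A z)"
        by (rule frechet_derivative_eqI[OF smooth_on_has_derivative[OF A z]])
      finally have "cov_deriv_endo gt C (A \<circ> chart_map C) q X = cov_endo (christoffel ?G z X) (A z) (der A z X)"
        using levi_civita_christoffel[OF Mt C, of q gt] q V(3)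
        by (auto simp: cov_deriv_endo_def cov_endo_def coord_deriv_def)
      then show ?thesis using cv QI[OF q(1)] q(2) by simp
    qed
  qed
  then show thesis using that[OF V] QI by blast
qed

text \<open>
  A product of two elements of the bundle is half their anticommutator, a scalar, plus half their commutator, an
  element of the bundle. One application of the bundle therefore tests invariance.
\<close>

lemma maximal_invariant_subspace_eq:
  assumes t: "para_hypercomplex_triple e1 e2 e3 J1 J2 J3" and T: "subspace T"
  shows "maximal_invariant_subspace (span {J1, J2, J3}) T = {v \<in> T. \<forall>A\<in>span {J1, J2, J3}. A v \<in> T}"
  unfolding maximal_invariant_subspace_def
proof (rule Greatest_equality)
  let ?Q = "span {J1, J2, J3}" and ?L = "{v \<in> T. \<forall>A\<in>span {J1, J2, J3}. A v \<in> T}"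
  have "subspace ?L" using T by (auto simp: subspace_def blinfun.bilinear_simps)
  moreover have "B v \<in> ?L" if B: "B \<in> ?Q" and v: "v \<in> ?L" for B v
  proof -
    have "A (B v) \<in> T" if A: "A \<in> ?Q" for A
    proof -
      obtain s where s: "\<And>x. A (B x) + B (A x) = s *\<^sub>R x" using triple_anticommutator_scalar[OF t A B] by blast
      have c: "((A o\<^sub>L B) - (B o\<^sub>L A)) v \<in> T" using triple_commutator_in_span[OF t A B] v by blast
      have "A (B v) = (1/2) *\<^sub>R ((A (B v) + B (A v)) + ((A o\<^sub>L B) - (B o\<^sub>L A)) v)"
        by (simp add: blinfun.bilinear_simps flip: scaleR_2)
      also have "\<dots> \<in> T" unfolding s using v c T by (intro subspace_scale subspace_add) auto
      finally show ?thesis .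
    qed
    then show ?thesis using v B by blast
  qed
  ultimately show "subspace ?L \<and> ?L \<subseteq> T \<and> (\<forall>A\<in>?Q. blinfun_apply A ` ?L \<subseteq> ?L)" by blast
next
  fix L assume "subspace L \<and> L \<subseteq> T \<and> (\<forall>A\<in>span {J1, J2, J3}. blinfun_apply A ` L \<subseteq> L)"
  then show "L \<le> {v \<in> T. \<forall>A\<in>span {J1, J2, J3}. A v \<in> T}" by blast
qed

section \<open>Submanifolds in charts\<close>

text \<open>
  The Nijenhuis bracket is tensorial: the derivatives of the two vector fields cancel.
\<close>

lemma nijenhuis_coord:
  fixes c :: "('a, 'm::euclidean_space) chart" and J :: "'a \<Rightarrow> 'm \<Rightarrow>\<^sub>L 'm"
  assumes inv: "chart_inv c (chart_map c q) = q"
    and dj: "((J \<circ> chart_inv c) has_derivative blinfun_apply (der (J \<circ> chart_inv c) (chart_map c q))) (at (chart_map c q))"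
    and dX: "((X \<circ> chart_inv c) has_derivative X') (at (chart_map c q))"
    and dY: "((Y \<circ> chart_inv c) has_derivative Y') (at (chart_map c q))"
    and JJ: "\<And>v. J q (J q v) = eps *\<^sub>R v"
  shows "nijenhuis eps c J X Y q = coord_nijenhuis (J \<circ> chart_inv c) (chart_map c q) (X q) (Y q)"
proof -
  let ?j = "J \<circ> chart_inv c" and ?y = "chart_map c q"
  have "((\<lambda>z. ?j z ((X \<circ> chart_inv c) z)) has_derivative (\<lambda>h. ?j ?y (X' h) + der ?j ?y h ((X \<circ> chart_inv c) ?y))) (at ?y)"
    by (rule has_derivative_blinfun_apply[OF dj dX])
  then have 1: "frechet_derivative ((\<lambda>q. J q (X q)) \<circ> chart_inv c) (at ?y) = (\<lambda>h. J q (X' h) + der ?j ?y h (X q))"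
    using frechet_derivative_eqI by (fastforce simp: o_def inv)
  have "((\<lambda>z. ?j z ((Y \<circ> chart_inv c) z)) has_derivative (\<lambda>h. ?j ?y (Y' h) + der ?j ?y h ((Y \<circ> chart_inv c) ?y))) (at ?y)"
    by (rule has_derivative_blinfun_apply[OF dj dY])
  then have 2: "frechet_derivative ((\<lambda>q. J q (Y q)) \<circ> chart_inv c) (at ?y) = (\<lambda>h. J q (Y' h) + der ?j ?y h (Y q))"
    using frechet_derivative_eqI by (fastforce simp: o_def inv)
  have l: "linear X'" "linear Y'" using dX dY has_derivative_linear by blast+
  show ?thesis
    by (simp add: nijenhuis_def lie_bracket_def coord_deriv_def 1 2 frechet_derivative_eqI[OF dX] frechet_derivative_eqI[OF dY]
        coord_nijenhuis_def inv blinfun.bilinear_simps JJ algebra_simps)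
qed

locale submanifold_setting =
  fixes Mt :: "('a, 'e::euclidean_space) manifold" and Q gt n
    and M :: "('a, 'm::euclidean_space) manifold" and g
  assumes pqk: "para_quaternionic_kahler n Mt Q gt"
    and nds: "nondegenerate_submanifold Mt gt M" and ind: "induced_metric Mt gt M g"
begin

lemma submfd: "submanifold M Mt" using nds by (simp add: nondegenerate_submanifold_def)

lemma M_mfd: "smooth_manifold M" and Mt_mfd: "smooth_manifold Mt"
  using submfd by (simp_all add: submanifold_def)

lemma Mt_cover: "p \<in> topspace (mtop M) \<Longrightarrow> \<exists>C\<in>atlas Mt. p \<in> chart_dom C"
  using submfd chart_cover[OF Mt_mfd] by (auto simp: submanifold_def)

lemma overlap_open:
  assumes c: "c \<in> atlas M" and V: "openin (mtop Mt) V"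
  shows "openin (mtop M) (chart_dom c \<inter> V)"
proof -
  have "continuous_map (mtop M) (mtop Mt) id" using submfd by (simp add: submanifold_def)
  then have "openin (mtop M) {x \<in> topspace (mtop M). id x \<in> V}" using V by (rule openin_continuous_map_preimage)
  then have "openin (mtop M) (chart_dom c \<inter> {x \<in> topspace (mtop M). id x \<in> V})"
    by (intro openin_Int chart_dom_openin[OF M_mfd c])
  moreover have "chart_dom c \<inter> {x \<in> topspace (mtop M). id x \<in> V} = chart_dom c \<inter> V"
    using chart_dom_topspace[OF M_mfd c] by auto
  ultimately show ?thesis by simp
qed

lemma inclusion_smooth:
  "c \<in> atlas M \<Longrightarrow> C \<in> atlas Mt \<Longrightarrow>
    smooth_on (chart_map c ` (chart_dom c \<inter> chart_dom C)) (chart_map C \<circ> chart_inv c)"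
  using submfd by (simp add: submanifold_def smooth_in_chart_def)

lemma inclusion_differentiable:
  "c \<in> atlas M \<Longrightarrow> C \<in> atlas Mt \<Longrightarrow> p \<in> chart_dom c \<inter> chart_dom C \<Longrightarrow>
    (chart_map C \<circ> chart_inv c) differentiable (at (chart_map c p))"
  using smooth_on_differentiable[OF inclusion_smooth] by blast

lemma dcoord_der:
  "c \<in> atlas M \<Longrightarrow> C \<in> atlas Mt \<Longrightarrow> p \<in> chart_dom c \<inter> chart_dom C \<Longrightarrow>
    dcoord c C p = blinfun_apply (der (chart_map C \<circ> chart_inv c) (chart_map c p))"
  by (simp add: dcoord_def coord_deriv_def der_apply inclusion_differentiable)

lemma inj_dcoord: "c \<in> atlas M \<Longrightarrow> C \<in> atlas Mt \<Longrightarrow> p \<in> chart_dom c \<inter> chart_dom C \<Longrightarrow> inj (dcoord c C p)"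
  using submfd by (simp add: submanifold_def)

lemma chain_sub:
  assumes c: "c \<in> atlas M" "c' \<in> atlas M" "C \<in> atlas Mt" and p: "p \<in> chart_dom c" "p \<in> chart_dom c'" "p \<in> chart_dom C"
  shows "dcoord c C p u = dcoord c' C p (dcoord c c' p u)"
proof (rule dcoord_chain)
  show "open (chart_map c ` (chart_dom c \<inter> chart_dom c'))"
    by (intro chart_image_open[OF M_mfd c(1)] openin_Int chart_dom_openin[OF M_mfd] c) auto
  show "chart_map c p \<in> chart_map c ` (chart_dom c \<inter> chart_dom c')" using p by blast
  show "chart_inv c' (chart_map c' (chart_inv c z)) = chart_inv c z" if "z \<in> chart_map c ` (chart_dom c \<inter> chart_dom c')" for z
    using that by (auto simp: chart_inv_map[OF M_mfd c(1)] chart_inv_map[OF M_mfd c(2)])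
  show "chart_inv c (chart_map c p) = p" by (rule chart_inv_map[OF M_mfd c(1) p(1)])
  show "(chart_map c' \<circ> chart_inv c) differentiable (at (chart_map c p))"
    using smooth_on_differentiable[OF transition_smooth[OF M_mfd c(1,2)]] p by blast
  show "(chart_map C \<circ> chart_inv c') differentiable (at (chart_map c' p))"
    using inclusion_differentiable[OF c(2,3)] p by blast
qed

lemma chain_amb:
  assumes c: "c \<in> atlas M" "C \<in> atlas Mt" "C' \<in> atlas Mt" and p: "p \<in> chart_dom c" "p \<in> chart_dom C" "p \<in> chart_dom C'"
  shows "dcoord c C' p u = dcoord C C' p (dcoord c C p u)"
proof (rule dcoord_chain)
  show "open (chart_map c ` (chart_dom c \<inter> chart_dom C))"
    by (intro chart_image_open[OF M_mfd c(1)] overlap_open chart_dom_openin[OF Mt_mfd] c) auto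
  show "chart_map c p \<in> chart_map c ` (chart_dom c \<inter> chart_dom C)" using p by blast
  show "chart_inv C (chart_map C (chart_inv c z)) = chart_inv c z" if "z \<in> chart_map c ` (chart_dom c \<inter> chart_dom C)" for z
    using that by (auto simp: chart_inv_map[OF M_mfd c(1)] chart_inv_map[OF Mt_mfd c(2)])
  show "chart_inv c (chart_map c p) = p" by (rule chart_inv_map[OF M_mfd c(1) p(1)])
  show "(chart_map C \<circ> chart_inv c) differentiable (at (chart_map c p))"
    using inclusion_differentiable[OF c(1,2)] p by blast
  show "(chart_map C' \<circ> chart_inv C) differentiable (at (chart_map C p))"
    using smooth_on_differentiable[OF transition_smooth[OF Mt_mfd c(2,3)]] p by blast
qed

lemma transition_chain:
  assumes N: "smooth_manifold N" and c: "c \<in> atlas N" "c' \<in> atlas N" and p: "p \<in> chart_dom c" "p \<in> chart_dom c'"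
  shows "dcoord c' c p (dcoord c c' p u) = u"
proof -
  have "dcoord c c p u = dcoord c' c p (dcoord c c' p u)"
  proof (rule dcoord_chain)
    show "open (chart_map c ` (chart_dom c \<inter> chart_dom c'))"
      by (intro chart_image_open[OF N c(1)] openin_Int chart_dom_openin[OF N] c) auto
    show "chart_map c p \<in> chart_map c ` (chart_dom c \<inter> chart_dom c')" using p by blast
    show "chart_inv c' (chart_map c' (chart_inv c z)) = chart_inv c z" if "z \<in> chart_map c ` (chart_dom c \<inter> chart_dom c')" for z
      using that by (auto simp: chart_inv_map[OF N c(1)] chart_inv_map[OF N c(2)])
    show "chart_inv c (chart_map c p) = p" by (rule chart_inv_map[OF N c(1) p(1)])
    show "(chart_map c' \<circ> chart_inv c) differentiable (at (chart_map c p))"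
      using smooth_on_differentiable[OF transition_smooth[OF N c(1,2)]] p by blast
    show "(chart_map c \<circ> chart_inv c') differentiable (at (chart_map c' p))"
      using smooth_on_differentiable[OF transition_smooth[OF N c(2,1)]] p by blast
  qed
  then show ?thesis by (simp add: dcoord_self[OF N c(1) p(1)])
qed

lemma transition_der:
  assumes N: "smooth_manifold N" and c: "c \<in> atlas N" "c' \<in> atlas N" and p: "p \<in> chart_dom c" "p \<in> chart_dom c'"
  shows "dcoord c c' p = blinfun_apply (der (chart_map c' \<circ> chart_inv c) (chart_map c p))"
proof -
  have "(chart_map c' \<circ> chart_inv c) differentiable (at (chart_map c p))"
    using smooth_on_differentiable[OF transition_smooth[OF N c(1,2)]] p by blast
  then show ?thesis by (simp add: dcoord_def coord_deriv_def der_apply)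
qed

lemma tangent_range:
  assumes c: "c \<in> atlas M" "C \<in> atlas Mt" and p: "p \<in> chart_dom c" "p \<in> chart_dom C"
  shows "tangent_subspace M C p = range (dcoord c C p)"
proof -
  have "dcoord c' C p u \<in> range (dcoord c C p)" if "c' \<in> atlas M" "p \<in> chart_dom c'" for c' u
    using chain_sub[OF that(1) c that(2) p, of u] by simp
  then show ?thesis using c p unfolding tangent_subspace_def by blast
qed

end

text \<open>
  A chart c of the submanifold and a chart C of the ambient manifold, with a domain V in C that carries a frame of the
  bundle. In these coordinates the inclusion is an immersed patch.
\<close>

locale submanifold_charts = submanifold_setting Mt Q gt n M g
  for Mt :: "('a, 'e::euclidean_space) manifold" and Q gt n
    and M :: "('a, 'm::euclidean_space) manifold" and g +
  fixes c C V e1 e2 e3 I1 I2 I3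
  assumes c: "c \<in> atlas M" and C: "C \<in> atlas Mt"
    and V: "openin (mtop Mt) V" "V \<subseteq> chart_dom C"
    and qp: "quaternionic_patch (chart_map C ` V) (gt C \<circ> chart_inv C) e1 e2 e3 I1 I2 I3"
    and QI: "\<And>q. q \<in> V \<Longrightarrow> Q C q = span {I1 (chart_map C q), I2 (chart_map C q), I3 (chart_map C q)}"
begin

abbreviation "S \<equiv> chart_map c ` (chart_dom c \<inter> V)"

abbreviation "f \<equiv> chart_map C \<circ> chart_inv c"

lemma in_S: "q \<in> chart_dom c \<Longrightarrow> q \<in> V \<Longrightarrow> chart_map c q \<in> S" by blast

lemma c_inv: "q \<in> chart_dom c \<Longrightarrow> chart_inv c (chart_map c q) = q"
  by (rule chart_inv_map[OF M_mfd c])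

lemma C_inv: "q \<in> V \<Longrightarrow> chart_inv C (chart_map C q) = q"
  using chart_inv_map[OF Mt_mfd C] V by blast

lemma in_top: "q \<in> chart_dom c \<Longrightarrow> q \<in> topspace (mtop M)"
  using chart_dom_topspace[OF M_mfd c] by blast

lemma D_coord: "q \<in> chart_dom c \<Longrightarrow> q \<in> V \<Longrightarrow> dcoord c C q = blinfun_apply (der f (chart_map c q))"
  using dcoord_der[OF c C] V(2) by blast

lemma tangent_D: "q \<in> chart_dom c \<Longrightarrow> q \<in> V \<Longrightarrow> tangent_subspace M C q = range (der f (chart_map c q))"
  using tangent_range[OF c C] D_coord V(2) by auto

sublocale P: immersed_patch "chart_map C ` V" "gt C \<circ> chart_inv C" e1 e2 e3 I1 I2 I3 S f
proof -
  interpret quaternionic_patch "chart_map C ` V" "gt C \<circ> chart_inv C" e1 e2 e3 I1 I2 I3 by (rule qp)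
  show "immersed_patch (chart_map C ` V) (gt C \<circ> chart_inv C) e1 e2 e3 I1 I2 I3 S f"
  proof
    show "open S" by (rule chart_image_open[OF M_mfd c overlap_open[OF c V(1)]]) blast
    show "smooth_on S f" by (rule smooth_on_subset[OF inclusion_smooth[OF c C]]) (use V(2) in blast)
    fix y assume "y \<in> S"
    then obtain q where q: "q \<in> chart_dom c" "q \<in> V" "y = chart_map c q" by blast
    then have qC: "q \<in> chart_dom C" using V(2) by blast
    show "f y \<in> chart_map C ` V" using q by (simp add: c_inv)
    show "inj (blinfun_apply (der f y))" using inj_dcoord[OF c C, of q] q qC D_coord[OF q(1,2)] by auto
    have "nondegenerate_on (gt C q) (tangent_subspace M C q)"
      using nds C qC in_top[OF q(1)] unfolding nondegenerate_submanifold_def by blast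
    then show "nondegenerate_on ((gt C \<circ> chart_inv C) (f y)) (range (blinfun_apply (der f y)))"
      using q by (simp add: tangent_D c_inv C_inv)
  qed
qed

lemma Q_coord: "q \<in> chart_dom c \<Longrightarrow> q \<in> V \<Longrightarrow> Q C q = P.Q (f (chart_map c q))"
  by (simp add: QI c_inv)

end

context submanifold_setting
begin

lemma charts_at:
  assumes c: "c \<in> atlas M" and C: "C \<in> atlas Mt" and p: "p \<in> chart_dom c" "p \<in> chart_dom C"
  obtains V e1 e2 e3 I1 I2 I3 where "submanifold_charts Mt Q gt n M g c C V e1 e2 e3 I1 I2 I3" "p \<in> V"
proof -
  obtain V e1 e2 e3 I1 I2 I3 where "openin (mtop Mt) V" "p \<in> V" "V \<subseteq> chart_dom C"
    "quaternionic_patch (chart_map C ` V) (gt C \<circ> chart_inv C) e1 e2 e3 I1 I2 I3"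
    "\<And>q. q \<in> V \<Longrightarrow> Q C q = span {I1 (chart_map C q), I2 (chart_map C q), I3 (chart_map C q)}"
    using quaternionic_patch_exists[OF pqk C p(2)] by metis
  then show thesis
    by (intro that[of V e1 e2 e3 I1 I2 I3] submanifold_charts.intro submanifold_charts_axioms.intro
        submanifold_setting_axioms c C)
qed

text \<open>
  The chart in which the Nijenhuis tensor is nonzero comes with the point; the resulting invariance of the
  tangent space is independent of the chart.
\<close>

lemma invariant_where_nijenhuis_nonzero:
  fixes J :: "('a, 'm) chart \<Rightarrow> 'a \<Rightarrow> 'm \<Rightarrow>\<^sub>L 'm"
  assumes eps: "eps \<in> {-1, 1}" and dim: "DIM('m) = 4 * k"
    and ah: "almost_eps_hermitian_submanifold eps Mt Q gt M J g"
    and q: "q \<in> nijenhuis_nonzero_set eps M J" and C: "C \<in> atlas Mt" "q \<in> chart_dom C"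
    and nd: "nondegenerate_on (gt C q) (maximal_invariant_subspace (Q C q) (tangent_subspace M C q))"
    and A: "A \<in> Q C q"
  shows "blinfun_apply A ` tangent_subspace M C q \<subseteq> tangent_subspace M C q"
proof -
  from ah[unfolded almost_eps_hermitian_submanifold_def, THEN conjunct2, THEN conjunct2]
  obtain Js :: "('a, 'e) chart \<Rightarrow> 'a \<Rightarrow> 'e \<Rightarrow>\<^sub>L 'e" where Js:
    "(\<forall>c\<in>atlas M. \<forall>C\<in>atlas Mt. smooth_in_chart c (chart_dom c \<inter> chart_dom C) (Js C)) \<and>
        (\<forall>C\<in>atlas Mt. \<forall>C'\<in>atlas Mt. \<forall>p\<in>topspace (mtop M) \<inter> chart_dom C \<inter> chart_dom C'. \<forall>u.
           blinfun_apply (Js C' p) (dcoord C C' p u) = dcoord C C' p (blinfun_apply (Js C p) u)) \<and>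
        (\<forall>C\<in>atlas Mt. \<forall>p\<in>topspace (mtop M) \<inter> chart_dom C.
           Js C p \<in> Q C p \<and> Js C p o\<^sub>L Js C p = eps *\<^sub>R id_blinfun \<and>
           blinfun_apply (Js C p) ` tangent_subspace M C p = tangent_subspace M C p) \<and>
        (\<forall>c\<in>atlas M. \<forall>C\<in>atlas Mt. \<forall>p\<in>chart_dom c \<inter> chart_dom C. \<forall>u.
           dcoord c C p (J c p u) = blinfun_apply (Js C p) (dcoord c C p u))"
    by (rule exE)
  note J1 = Js[THEN conjunct1] and J2 = Js[THEN conjunct2, THEN conjunct2, THEN conjunct1]
    and J3 = Js[THEN conjunct2, THEN conjunct2, THEN conjunct2]
  have Jsm: "smooth_in_chart c (chart_dom c \<inter> chart_dom C) (Js C)" if "c \<in> atlas M" "C \<in> atlas Mt" for c C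
    using J1 that by blast
  have JQ: "Js C p \<in> Q C p" and JJ: "Js C p o\<^sub>L Js C p = eps *\<^sub>R id_blinfun"
    if "C \<in> atlas Mt" "p \<in> topspace (mtop M) \<inter> chart_dom C" for C p
    using J2 that by blast+
  have Jj: "dcoord c C p (J c p u) = blinfun_apply (Js C p) (dcoord c C p u)"
    if "c \<in> atlas M" "C \<in> atlas Mt" "p \<in> chart_dom c \<inter> chart_dom C" for c C p u
    using J3 that by blast
  obtain c V0 X Y where c: "c \<in> atlas M" and V0: "openin (mtop M) V0" "q \<in> V0" "V0 \<subseteq> chart_dom c"
    and sX: "smooth_in_chart c V0 X" and sY: "smooth_in_chart c V0 Y" and N: "nijenhuis eps c (J c) X Y q \<noteq> 0"
    using q unfolding nijenhuis_nonzero_set_def by blast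
  have qc: "q \<in> chart_dom c" using V0 by blast
  obtain V e1 e2 e3 I1 I2 I3 where "submanifold_charts Mt Q gt n M g c C V e1 e2 e3 I1 I2 I3" and qV: "q \<in> V"
    using charts_at[OF c C(1) qc C(2)] by metis
  then interpret A: submanifold_charts Mt Q gt n M g c C V e1 e2 e3 I1 I2 I3 by blast
  let ?y = "chart_map c q"
  let ?j = "J c \<circ> chart_inv c" and ?Js = "Js C \<circ> chart_inv c"
  note y = A.in_S[OF qc qV] and inv = A.c_inv and VC = A.V(2)
  have Jsm': "smooth_on A.S ?Js"
    using Jsm[OF c C(1)] VC unfolding smooth_in_chart_def by (elim smooth_on_subset) blast
  have JQ': "?Js z \<in> A.P.Q (A.f z)" if z: "z \<in> A.S" for z
  proof -
    obtain p where p: "p \<in> chart_dom c" "p \<in> V" "z = chart_map c p" using z by blast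
    then have "Js C p \<in> Q C p" using JQ[OF C(1), of p] VC A.in_top by blast
    then show ?thesis unfolding A.Q_coord[OF p(1,2)] using p by (simp add: inv)
  qed
  have JJ': "?Js z (?Js z x) = eps *\<^sub>R x" if z: "z \<in> A.S" for z x
  proof -
    obtain p where p: "p \<in> chart_dom c" "p \<in> V" "z = chart_map c p" using z by blast
    have "Js C p o\<^sub>L Js C p = eps *\<^sub>R id_blinfun" using JJ[OF C(1)] A.in_top p VC by blast
    then have "(Js C p o\<^sub>L Js C p) x = (eps *\<^sub>R id_blinfun) x" by simp
    then show ?thesis using p by (simp add: inv blinfun.bilinear_simps)
  qed
  have Jj': "?Js z (A.P.D z u) = A.P.D z (?j z u)" if z: "z \<in> A.S" for z u
  proof -
    obtain p where p: "p \<in> chart_dom c" "p \<in> V" "z = chart_map c p" using z by blast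
    then show ?thesis using Jj[OF c C(1), of p u] VC A.D_coord[OF p(1,2)] by (auto simp: inv)
  qed
  have jj: "J c q (J c q v) = eps *\<^sub>R v" for v
  proof -
    have "A.P.D ?y (?j ?y (?j ?y v)) = A.P.D ?y (eps *\<^sub>R v)"
      by (simp only: Jj'[OF y, symmetric] JJ'[OF y] blinfun.scaleR_right)
    then show ?thesis using A.P.D_eq_iff[OF y] by (simp add: inv[OF qc])
  qed
  have dj: "(?j has_derivative blinfun_apply (der ?j ?y)) (at ?y)"
    by (rule smooth_on_has_derivative[OF A.P.smooth_restricted[OF Jsm' Jj'] y])
  have dXY: "((X \<circ> chart_inv c) has_derivative blinfun_apply (der (X \<circ> chart_inv c) ?y)) (at ?y)"
    "((Y \<circ> chart_inv c) has_derivative blinfun_apply (der (Y \<circ> chart_inv c) ?y)) (at ?y)"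
    using sX sY V0(2) unfolding smooth_in_chart_def by (auto intro: smooth_on_has_derivative)
  have N': "coord_nijenhuis ?j ?y (X q) (Y q) \<noteq> 0"
    using N nijenhuis_coord[OF inv[OF qc] dj dXY jj] by simp
  note Tq = A.tangent_D[OF qc qV] and Qq = A.Q_coord[OF qc qV]
  have sT: "subspace (range (A.P.D ?y))"
    by (rule linear_subspace_image) (simp_all add: bounded_linear.linear blinfun.bounded_linear_right)
  have nd': "nondegenerate_on ((gt C \<circ> chart_inv C) (A.f ?y)) {v \<in> range (A.P.D ?y). \<forall>A\<in>A.P.Q (A.f ?y). A v \<in> range (A.P.D ?y)}"
    using nd unfolding Tq Qq maximal_invariant_subspace_eq[OF A.P.triple[OF A.P.f_U[OF y]] sT]
    by (simp add: inv[OF qc] A.C_inv[OF qV])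
  show ?thesis
    using A.P.invariant_where_nijenhuis_nonzero[OF y Jsm' JQ' JJ' eps Jj' dim N' nd'] A unfolding Tq Qq by blast
qed

lemma invariant_by_density:
  assumes dense: "mtop M closure_of N = topspace (mtop M)"
    and inv: "\<And>q C A. q \<in> N \<Longrightarrow> C \<in> atlas Mt \<Longrightarrow> q \<in> chart_dom C \<Longrightarrow> A \<in> Q C q \<Longrightarrow>
      blinfun_apply A ` tangent_subspace M C q \<subseteq> tangent_subspace M C q"
    and C: "C \<in> atlas Mt" and p: "p \<in> topspace (mtop M) \<inter> chart_dom C" and A: "A \<in> Q C p"
  shows "blinfun_apply A ` tangent_subspace M C p \<subseteq> tangent_subspace M C p"
proof -
  obtain c where c: "c \<in> atlas M" "p \<in> chart_dom c" using chart_cover[OF M_mfd] p by blast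
  obtain V e1 e2 e3 I1 I2 I3 where "submanifold_charts Mt Q gt n M g c C V e1 e2 e3 I1 I2 I3" and pV: "p \<in> V"
    using charts_at[OF c(1) C c(2)] p by blast
  then interpret A: submanifold_charts Mt Q gt n M g c C V e1 e2 e3 I1 I2 I3 by blast
  have d: "\<exists>y\<in>W. \<forall>A\<in>A.P.Q (A.f y). blinfun_apply A ` range (A.P.D y) \<subseteq> range (A.P.D y)"
    if W: "open W" "W \<subseteq> A.S" "W \<noteq> {}" for W
  proof -
    have WS: "W \<subseteq> chart_map c ` chart_dom c" using W(2) by blast
    have oW: "openin (mtop M) (chart_inv c ` W)" by (rule chart_preimage_open[OF M_mfd c(1) W(1) WS])
    obtain z where z: "z \<in> W" using W(3) by blast
    have "chart_inv c z \<in> mtop M closure_of N"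
      using z oW openin_subset unfolding dense by blast
    then have "\<exists>q\<in>N. q \<in> chart_inv c ` W"
      using oW z unfolding in_closure_of by blast
    then obtain q w where q: "q \<in> N" "w \<in> W" "q = chart_inv c w" by blast
    obtain r where r: "r \<in> chart_dom c" "r \<in> V" "w = chart_map c r" using q(2) W(2) by blast
    have rq: "r = q" using q r A.c_inv by simp
    have "\<forall>A\<in>Q C q. blinfun_apply A ` tangent_subspace M C q \<subseteq> tangent_subspace M C q"
      using inv[OF q(1) C] r A.V(2) unfolding rq by blast
    then show ?thesis using A.tangent_D[OF r(1,2)] A.Q_coord[OF r(1,2)] q(2) r(3) unfolding rq by auto
  qed
  have "A (A.P.D (chart_map c p) u) \<in> range (A.P.D (chart_map c p))" for u
    using A.P.invariant_by_density[OF d, of "chart_map c p" A u] c(2) pV A A.Q_coord[OF c(2) pV] by blast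
  then show ?thesis unfolding A.tangent_D[OF c(2) pV] by blast
qed

end

section \<open>The induced structure\<close>

text \<open>
  The Ricci tensor of W vanishes, so the Ricci operator is nu times that of R0. In dimension 4 this is 3 nu times
  the identity.
\<close>

lemma reduced_scal_eq:
  fixes c :: "('a, 'm::euclidean_space) chart"
  assumes nd: "nondegenerate_on (g c p) UNIV"
    and st: "skew_triple (g c p) s1 s2 s3 K1 K2 K3" and dim: "DIM('m) = 4"
    and W: "trace_free W"
    and R: "\<And>X Y Z. curvature g c p X Y Z = \<nu> *\<^sub>R R0 (g c p) s1 s2 s3 K1 K2 K3 X Y Z + W X Y Z"
  shows "reduced_scal 1 g c p = \<nu>"
proof -
  interpret skew_triple "g c p" s1 s2 s3 K1 K2 K3 by (rule st)
  have ric: "ricci g c p Y Z = g c p ((3 * \<nu>) *\<^sub>R Y) Z" for Y Z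
    using W by (simp add: ricci_def R endo_trace_add endo_trace_scaleR ricci_R0 dim trace_free_def blinfun.bilinear_simps)
  have "(THE A :: 'm \<Rightarrow>\<^sub>L 'm. \<forall>Y Z. g c p (A Y) Z = ricci g c p Y Z) = (3 * \<nu>) *\<^sub>R id_blinfun"
  proof (rule the_equality)
    show "\<forall>Y Z. g c p (((3 * \<nu>) *\<^sub>R id_blinfun) Y) Z = ricci g c p Y Z"
      by (simp add: ric blinfun.bilinear_simps)
    fix A :: "'m \<Rightarrow>\<^sub>L 'm" assume A: "\<forall>Y Z. g c p (A Y) Z = ricci g c p Y Z"
    show "A = (3 * \<nu>) *\<^sub>R id_blinfun"
    proof (rule blinfun_eqI)
      fix Y
      have "g c p (A Y - (3 * \<nu>) *\<^sub>R Y) Z = 0" for Z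
        using A ric by (simp add: blinfun.bilinear_simps)
      then have "A Y - (3 * \<nu>) *\<^sub>R Y = 0" using nd unfolding nondegenerate_on_def by blast
      then show "A Y = ((3 * \<nu>) *\<^sub>R id_blinfun) Y" by (simp add: blinfun.bilinear_simps)
    qed
  qed
  moreover have "blinfun_apply ((3 * \<nu>) *\<^sub>R id_blinfun) = (\<lambda>x :: 'm. (3 * \<nu>) *\<^sub>R x)"
    by (rule ext) (simp add: blinfun.scaleR_left)
  ultimately have "scal g c p = 12 * \<nu>"
    by (simp add: scal_def endo_trace_scaleR endo_trace_id dim)
  then show ?thesis by (simp add: reduced_scal_def)
qed

locale invariant_submanifold = submanifold_setting Mt Q gt n M g
  for Mt :: "('a, 'e::euclidean_space) manifold" and Q gt n
    and M :: "('a, 'm::euclidean_space) manifold" and g +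
  fixes k :: nat
  assumes dim: "DIM('m) = 4 * k"
    and invariant: "\<And>C p A. C \<in> atlas Mt \<Longrightarrow> p \<in> topspace (mtop M) \<inter> chart_dom C \<Longrightarrow> A \<in> Q C p \<Longrightarrow>
      blinfun_apply A ` tangent_subspace M C p \<subseteq> tangent_subspace M C p"
begin

abbreviation "QM \<equiv> induced_endo_bundle Mt Q"

lemma topI: "c \<in> atlas M \<Longrightarrow> p \<in> chart_dom c \<Longrightarrow> p \<in> topspace (mtop M)"
  using chart_dom_topspace[OF M_mfd] by blast

text \<open>
  The definition of the induced bundle allows any ambient chart around the point; by the transformation law of
  the bundle one fixed chart suffices.
\<close>

lemma induced_iff:
  assumes c: "c \<in> atlas M" and C: "C \<in> atlas Mt" and p: "p \<in> chart_dom c" "p \<in> chart_dom C"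
  shows "B \<in> QM c p \<longleftrightarrow> (\<exists>A\<in>Q C p. \<forall>u. dcoord c C p (B u) = A (dcoord c C p u))"
proof
  assume "\<exists>A\<in>Q C p. \<forall>u. dcoord c C p (B u) = A (dcoord c C p u)"
  then show "B \<in> QM c p" using C p unfolding induced_endo_bundle_def by blast
next
  assume "B \<in> QM c p"
  then obtain C' A' where C': "C' \<in> atlas Mt" "p \<in> chart_dom C'" and A': "A' \<in> Q C' p"
    and B: "\<And>u. dcoord c C' p (B u) = A' (dcoord c C' p u)"
    unfolding induced_endo_bundle_def by blast
  have "almost_para_quaternionic Mt Q" using pqk by (simp add: para_quaternionic_kahler_def)
  then obtain A where A: "A \<in> Q C p" "\<And>u. A' (dcoord C C' p u) = dcoord C C' p (A u)"
    using A' C C' p unfolding almost_para_quaternionic_def by blast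
  have "dcoord c C p (B u) = A (dcoord c C p u)" for u
  proof -
    have "dcoord C C' p (dcoord c C p (B u)) = dcoord C C' p (A (dcoord c C p u))"
      using B[of u] A(2)[of "dcoord c C p u"] chain_amb[OF c C C'(1) p C'(2)] by simp
    then show ?thesis using transition_chain[OF Mt_mfd C C'(1) p(2) C'(2)] by metis
  qed
  then show "\<exists>A\<in>Q C p. \<forall>u. dcoord c C p (B u) = A (dcoord c C p u)" using A(1) by blast
qed

end

text \<open>
  Coordinates in which the inclusion is an invariant patch, so that everything about the induced structure can
  be read off there.
\<close>

locale adapted_charts =
  invariant_submanifold Mt Q gt n M g k + submanifold_charts Mt Q gt n M g c C V e1 e2 e3 I1 I2 I3
  for Mt :: "('a, 'e::euclidean_space) manifold" and Q gt n
    and M :: "('a, 'm::euclidean_space) manifold" and g k c C V e1 e2 e3 I1 I2 I3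
begin

sublocale P: invariant_patch "chart_map C ` V" "gt C \<circ> chart_inv C" e1 e2 e3 I1 I2 I3 S f
proof
  fix y A u assume "y \<in> S" and A: "A \<in> P.Q (f y)"
  then obtain q where q: "q \<in> chart_dom c" "q \<in> V" "y = chart_map c q" by blast
  have "A \<in> Q C q" using A q by (simp add: Q_coord)
  then show "A (P.D y u) \<in> range (P.D y)"
    using invariant[OF C, of q A] in_top[OF q(1)] q V(2) tangent_D[OF q(1,2)] by blast
qed

lemma metric_coord: "z \<in> S \<Longrightarrow> (g c \<circ> chart_inv c) z = P.g z"
proof -
  assume "z \<in> S"
  then obtain q where q: "q \<in> chart_dom c" "q \<in> V" "z = chart_map c q" by blast
  have "g c q u v = gt C q (dcoord c C q u) (dcoord c C q v)" for u v
    using ind c C q V(2) unfolding induced_metric_def by blast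
  then show ?thesis
    by (intro blinfun_eqI) (simp add: q c_inv C_inv P.g_apply D_coord)
qed

lemma QM_coord:
  assumes q: "q \<in> chart_dom c" "q \<in> V"
  shows "QM c q = P.q (chart_map c q)"
proof (intro set_eqI iffI)
  have qC: "q \<in> chart_dom C" using q V by blast
  note y = in_S[OF q]
  note iff = induced_iff[OF c C q(1) qC, unfolded D_coord[OF q] Q_coord[OF q]]
  fix B
  show "B \<in> QM c q" if B: "B \<in> P.q (chart_map c q)"
  proof -
    obtain A where "A \<in> P.Q (f (chart_map c q))"
      "\<And>u. A (P.D (chart_map c q) u) = P.D (chart_map c q) (B u)"
      by (rule P.lift_section[OF y B]) blast
    then show ?thesis unfolding iff by (intro bexI[of _ A]) simp_all
  qed
  show "B \<in> P.q (chart_map c q)" if "B \<in> QM c q"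
  proof -
    obtain A where A: "A \<in> P.Q (f (chart_map c q))"
      "\<And>u. P.D (chart_map c q) (B u) = A (P.D (chart_map c q) u)"
      using \<open>B \<in> QM c q\<close> unfolding iff by blast
    obtain b where b: "b \<in> P.q (chart_map c q)" "\<And>u. A (P.D (chart_map c q) u) = P.D (chart_map c q) (b u)"
      by (rule P.restrict_section[OF y A(1)]) blast
    have "B = b" by (rule blinfun_eqI, rule P.D_eqI[OF y]) (simp add: A b)
    then show ?thesis using b by simp
  qed
qed

lemma christoffel_coord: "z \<in> S \<Longrightarrow> christoffel (g c \<circ> chart_inv c) z = P.M.\<Gamma> z"
  by (rule christoffel_cong[OF P.open_S _ metric_coord])

lemma ambient_christoffel: "q \<in> V \<Longrightarrow> levi_civita gt C q = christoffel (gt C \<circ> chart_inv C) (chart_map C q)"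
  using levi_civita_christoffel[OF Mt_mfd C] V(2) by blast

text \<open>
  In coordinates the ambient covariant derivative of D Y is D applied to the derivative of Y plus a value of the
  hessian, which is tangent.
\<close>

lemma totally_geodesic_coord:
  assumes W: "openin (mtop M) W" "W \<subseteq> chart_dom c \<inter> chart_dom C" and Y: "smooth_in_chart c W Y"
    and p: "p \<in> W" "p \<in> V"
  shows "ambient_cov_deriv gt c C Y p X \<in> tangent_subspace M C p"
proof -
  have pc: "p \<in> chart_dom c" using p W by blast
  let ?y = "chart_map c p"
  note y = in_S[OF pc p(2)]
  have oW: "open (chart_map c ` (W \<inter> (chart_dom c \<inter> V)))"
    by (rule chart_image_open[OF M_mfd c]) (use W overlap_open[OF c V(1)] in auto)
  have dY: "((Y \<circ> chart_inv c) has_derivative blinfun_apply (der (Y \<circ> chart_inv c) ?y)) (at ?y)"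
    using Y p unfolding smooth_in_chart_def by (auto intro: smooth_on_has_derivative)
  have "frechet_derivative ((\<lambda>q. dcoord c C q (Y q)) \<circ> chart_inv c) (at ?y)
     = frechet_derivative (\<lambda>z. P.D z ((Y \<circ> chart_inv c) z)) (at ?y)"
  proof (rule frechet_derivative_cong_open[OF oW])
    show "?y \<in> chart_map c ` (W \<inter> (chart_dom c \<inter> V))" using p pc by blast
    show "((\<lambda>q. dcoord c C q (Y q)) \<circ> chart_inv c) z = P.D z ((Y \<circ> chart_inv c) z)"
      if "z \<in> chart_map c ` (W \<inter> (chart_dom c \<inter> V))" for z
      using that by (auto simp: c_inv D_coord)
  qed
  also have "\<dots> = (\<lambda>h. P.D ?y (der (Y \<circ> chart_inv c) ?y h) + der P.D ?y h ((Y \<circ> chart_inv c) ?y))"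
    by (rule frechet_derivative_eqI[OF has_derivative_blinfun_apply[OF P.dD[OF y] dY]])
  finally have "ambient_cov_deriv gt c C Y p X = P.D ?y (der (Y \<circ> chart_inv c) ?y X) + P.hessian ?y X (Y p)"
    by (simp add: ambient_cov_deriv_def coord_deriv_def P.hessian_def ambient_christoffel[OF p(2)] c_inv[OF pc] D_coord[OF pc p(2)])
  also have "\<dots> \<in> range (P.D ?y)"
    by (intro subspace_add P.range_D P.hessian_tangent[OF y]) simp
  finally show ?thesis unfolding tangent_D[OF pc p(2)] .
qed

lemma smooth_metric_coord: "smooth_on S (g c \<circ> chart_inv c)"
  using smooth_on_cong[OF P.open_S, of "g c \<circ> chart_inv c" P.g] metric_coord P.smooth_g by blast

lemma metric_at:
  assumes q: "q \<in> chart_dom c" "q \<in> V"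
  shows "g c q = P.g (chart_map c q)"
  using metric_coord[OF in_S[OF q]] by (simp add: c_inv[OF q(1)])

lemma metric_props:
  assumes q: "q \<in> chart_dom c" "q \<in> V"
  shows "g c q u v = g c q v u" "nondegenerate_on (g c q) UNIV"
  unfolding metric_at[OF q] using P.M.G_sym P.M.G_nondeg in_S[OF q] by blast+

lemma QM_skew:
  assumes q: "q \<in> chart_dom c" "q \<in> V" and A: "A \<in> QM c q"
  shows "g c q (A X) Y = - g c q X (A Y)"
  using P.q_skew[OF in_S[OF q]] A unfolding metric_at[OF q] QM_coord[OF q] by blast

lemma neutral_signature_coord:
  assumes q: "q \<in> chart_dom c" "q \<in> V"
  shows "has_signature (g c q) (2 * k) (2 * k)"
proof -
  let ?y = "chart_map c q"
  note y = in_S[OF q]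
  note t = P.b_triple[OF y]
  have ex: "has_signature (g c q) (2 * k) (2 * k)" if J: "J \<in> P.q ?y" and JJ: "\<And>v. J (J v) = v" for J
  proof (rule neutral_signature[OF metric_props(2)[OF q] metric_props(1)[OF q] JJ])
    show "g c q (J u) v = - g c q u (J v)" for u v
      using QM_skew[OF q] J unfolding QM_coord[OF q] by blast
    show "DIM('m) = 2 * (2 * k)" using dim by simp
  qed
  have "e1 = 1 \<or> e2 = 1" using t by (auto simp: para_hypercomplex_triple_def para_quaternionic_signs_def)
  then show ?thesis
  proof
    assume "e1 = 1"
    then show ?thesis by (intro ex[of "P.b1 ?y"]) (auto simp: P.b_table[OF y] intro: span_base)
  next
    assume "e2 = 1"
    then show ?thesis by (intro ex[of "P.b2 ?y"]) (auto simp: P.b_table[OF y] intro: span_base)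
  qed
qed

lemma local_frame:
  "\<exists>W e1 e2 e3 J1 J2 J3. openin (mtop M) W \<and> W = chart_dom c \<inter> V \<and>
     smooth_in_chart c W J1 \<and> smooth_in_chart c W J2 \<and> smooth_in_chart c W J3 \<and>
     (\<forall>q\<in>W. para_hypercomplex_triple e1 e2 e3 (J1 q) (J2 q) (J3 q) \<and> QM c q = span {J1 q, J2 q, J3 q})"
proof -
  have sm: "smooth_in_chart c (chart_dom c \<inter> V) (b \<circ> chart_map c)" if b: "smooth_on S b" for b :: "'m \<Rightarrow> 'm \<Rightarrow>\<^sub>L 'm"
  proof -
    have "smooth_on S ((b \<circ> chart_map c) \<circ> chart_inv c) \<longleftrightarrow> smooth_on S b"
      by (rule smooth_on_cong[OF P.open_S]) (auto simp: c_inv)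
    then show ?thesis using b by (simp add: smooth_in_chart_def)
  qed
  show ?thesis
    by (rule exI[of _ "chart_dom c \<inter> V"], rule exI[of _ e1], rule exI[of _ e2], rule exI[of _ e3],
        rule exI[of _ "P.b1 \<circ> chart_map c"], rule exI[of _ "P.b2 \<circ> chart_map c"], rule exI[of _ "P.b3 \<circ> chart_map c"])
       (auto intro!: overlap_open[OF c V(1)] sm P.smooth_b simp: QM_coord P.b_triple)
qed

lemma parallel_coord:
  assumes W: "openin (mtop M) W" "W \<subseteq> chart_dom c" and A: "smooth_in_chart c W A" and AQ: "\<And>q. q \<in> W \<Longrightarrow> A q \<in> QM c q"
    and p: "p \<in> W" "p \<in> V"
  shows "cov_deriv_endo g c A p X \<in> QM c p"
proof -
  have pc: "p \<in> chart_dom c" using p W by blast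
  let ?y = "chart_map c p" and ?W = "chart_map c ` (W \<inter> (chart_dom c \<inter> V))"
  note y = in_S[OF pc p(2)]
  have oW: "open ?W"
    by (rule chart_image_open[OF M_mfd c]) (use W overlap_open[OF c V(1)] in auto)
  have dA: "((A \<circ> chart_inv c) has_derivative blinfun_apply (der (A \<circ> chart_inv c) ?y)) (at ?y)"
    using A p unfolding smooth_in_chart_def by (auto intro: smooth_on_has_derivative)
  have "cov_endo (P.M.\<Gamma> ?y X) ((A \<circ> chart_inv c) ?y) (der (A \<circ> chart_inv c) ?y X) \<in> P.q ?y"
  proof (rule P.cov_in_q[OF oW])
    show "?W \<subseteq> S" by blast
    show "?y \<in> ?W" using p pc by blast
    show "(A \<circ> chart_inv c) z \<in> P.q z" if "z \<in> ?W" for z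
    proof -
      obtain q where q: "q \<in> W" "q \<in> chart_dom c" "q \<in> V" "z = chart_map c q" using \<open>z \<in> ?W\<close> by blast
      show ?thesis using AQ[OF q(1)] unfolding QM_coord[OF q(2,3)] by (simp add: q c_inv)
    qed
  qed (rule dA)
  moreover have "cov_deriv_endo g c A p X = cov_endo (P.M.\<Gamma> ?y X) ((A \<circ> chart_inv c) ?y) (der (A \<circ> chart_inv c) ?y X)"
    by (simp add: cov_deriv_endo_def cov_endo_def coord_deriv_def frechet_derivative_eqI[OF dA]
        levi_civita_christoffel[OF M_mfd c pc] christoffel_coord[OF y] c_inv[OF pc])
  ultimately show ?thesis by (simp add: QM_coord[OF pc p(2)])
qed

lemma curvature_coord_patch:
  assumes g: "pseudo_riemannian M g" and q: "q \<in> chart_dom c" "q \<in> V"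
  shows "curvature g c q X Y = P.M.R (chart_map c q) X Y"
proof -
  have "coord_curvature (christoffel (g c \<circ> chart_inv c)) (chart_map c q) = P.M.R (chart_map c q)"
    by (rule coord_curvature_cong[OF P.open_S in_S[OF q]], rule christoffel_coord)
  then show ?thesis unfolding curvature_coord[OF g c q(1)] by simp
qed

text \<open>
  For n = 1 the decomposition is part of the ambient structure, and for larger n the ambient dimension is at least 8.
  In both cases the factor of R0 is then identified by taking the trace.
\<close>

lemma decomposes_coord:
  assumes g: "pseudo_riemannian M g" and q: "q \<in> chart_dom c" "q \<in> V" and k: "k = 1"
    and K: "para_hypercomplex_triple s1 s2 s3 K1 K2 K3" and sp: "QM c q = span {K1, K2, K3}"
  shows "\<exists>W. algebraic_curvature (g c q) W \<and> trace_free W \<and> Q_invariant_curvature (QM c q) W \<and>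
     (\<forall>X Y Z. curvature g c q X Y Z = reduced_scal k g c q *\<^sub>R R0 (g c q) s1 s2 s3 K1 K2 K3 X Y Z + W X Y Z)"
proof -
  let ?y = "chart_map c q"
  note y = in_S[OF q]
  have qC: "q \<in> chart_dom C" using q V by blast
  have fy: "f ?y = chart_map C q" by (simp add: c_inv[OF q(1)])
  have dime: "DIM('e) = 4 * n" using pqk by (simp add: para_quaternionic_kahler_def)
  then have n0: "n \<noteq> 0" using DIM_positive[where 'a = 'e] by simp
  have prt: "pseudo_riemannian Mt gt" using pqk by (simp add: para_quaternionic_kahler_def)
  have sp': "P.q ?y = span {K1, K2, K3}" using sp by (simp add: QM_coord[OF q])
  have "\<exists>\<nu> W. algebraic_curvature (P.g ?y) W \<and> trace_free W \<and> Q_invariant_curvature (P.q ?y) W \<and>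
     (\<forall>X Y Z. P.M.R ?y X Y Z = \<nu> *\<^sub>R R0 (P.g ?y) s1 s2 s3 K1 K2 K3 X Y Z + W X Y Z)"
  proof (cases "n = 1")
    case True
    have dec: "curvature_decomposes n Mt Q gt" using pqk True by (simp add: para_quaternionic_kahler_def)
    show ?thesis
    proof (rule P.curvature_decomposition_transport[OF y K sp'])
      show "DIM('e) = DIM('m)" using dime dim True k by simp
      fix A1 A2 A3 assume A: "para_hypercomplex_triple s1 s2 s3 A1 A2 A3" "P.Q (f ?y) = span {A1, A2, A3}"
      have "Q C q = span {A1, A2, A3}" using A(2) Q_coord[OF q] by simp
      then obtain W where W: "algebraic_curvature (gt C q) W" "trace_free W" "Q_invariant_curvature (Q C q) W"
        "\<And>X Y Z. curvature gt C q X Y Z = reduced_scal n gt C q *\<^sub>R R0 (gt C q) s1 s2 s3 A1 A2 A3 X Y Z + W X Y Z"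
        using dec C qC A(1) unfolding curvature_decomposes_def by blast
      have G: "(gt C \<circ> chart_inv C) (f ?y) = gt C q" by (simp add: c_inv[OF q(1)] C_inv[OF q(2)])
      have "P.R (f ?y) X Y Z = curvature gt C q X Y Z" for X Y Z
        unfolding curvature_coord[OF prt C qC] fy ..
      then show "\<exists>\<nu> W. algebraic_curvature ((gt C \<circ> chart_inv C) (f ?y)) W \<and> trace_free W \<and>
          Q_invariant_curvature (P.Q (f ?y)) W \<and>
         (\<forall>X Y Z. P.R (f ?y) X Y Z = \<nu> *\<^sub>R R0 ((gt C \<circ> chart_inv C) (f ?y)) s1 s2 s3 A1 A2 A3 X Y Z + W X Y Z)"
        unfolding G using W unfolding Q_coord[OF q] by metis
    qed
  next
    case False
    then have "DIM('e) \<ge> 8" using n0 dime by simp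
    then show ?thesis by (rule P.curvature_decomposition_large_ambient[OF y K sp'])
  qed
  then obtain \<nu> W where W: "algebraic_curvature (g c q) W" "trace_free W" "Q_invariant_curvature (QM c q) W"
    and R: "\<And>X Y Z. curvature g c q X Y Z = \<nu> *\<^sub>R R0 (g c q) s1 s2 s3 K1 K2 K3 X Y Z + W X Y Z"
    unfolding curvature_coord_patch[OF g q] metric_at[OF q] QM_coord[OF q] by blast
  have in_Q: "K1 \<in> QM c q" "K2 \<in> QM c q" "K3 \<in> QM c q" unfolding sp by (auto intro: span_base)
  have "skew_triple (g c q) s1 s2 s3 K1 K2 K3"
  proof
    show "g c q u v = g c q v u" for u v by (rule metric_props(1)[OF q])
  qed (rule metric_props(2)[OF q] K QM_skew[OF q] in_Q)+
  then have "reduced_scal 1 g c q = \<nu>"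
    by (rule reduced_scal_eq[OF metric_props(2)[OF q] _ _ W(2) R]) (simp add: dim k)
  then show ?thesis using W R k by blast
qed

end

context invariant_submanifold
begin

lemma adapted_charts_at:
  assumes c: "c \<in> atlas M" and C: "C \<in> atlas Mt" and p: "p \<in> chart_dom c" "p \<in> chart_dom C"
  obtains V e1 e2 e3 I1 I2 I3 where "adapted_charts Mt Q gt n M g k c C V e1 e2 e3 I1 I2 I3" "p \<in> V"
  using charts_at[OF assms] invariant_submanifold_axioms unfolding adapted_charts_def by metis

lemma adapted_chart:
  assumes "c \<in> atlas M" "p \<in> chart_dom c"
  obtains C V e1 e2 e3 I1 I2 I3 where "adapted_charts Mt Q gt n M g k c C V e1 e2 e3 I1 I2 I3" "p \<in> V"
  using Mt_cover topI[OF assms] adapted_charts_at[OF assms(1) _ assms(2)] by metis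

lemma totally_geodesic_submanifold: "totally_geodesic Mt gt M"
  unfolding totally_geodesic_def
proof (intro ballI allI impI)
  fix c C W p X and Y :: "'a \<Rightarrow> 'm"
  assume c: "c \<in> atlas M" and C: "C \<in> atlas Mt" and W: "openin (mtop M) W" "W \<subseteq> chart_dom c \<inter> chart_dom C"
    and Y: "smooth_in_chart c W Y" and p: "p \<in> W"
  have pc: "p \<in> chart_dom c" "p \<in> chart_dom C" using W p by blast+
  obtain V e1 e2 e3 I1 I2 I3 where "adapted_charts Mt Q gt n M g k c C V e1 e2 e3 I1 I2 I3" and pV: "p \<in> V"
    using adapted_charts_at[OF c C pc] by metis
  then interpret A: adapted_charts Mt Q gt n M g k c C V e1 e2 e3 I1 I2 I3 by blast
  show "ambient_cov_deriv gt c C Y p X \<in> tangent_subspace M C p"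
    by (rule A.totally_geodesic_coord[OF W Y p pV])
qed

lemma induced_pseudo_riemannian: "pseudo_riemannian M g"
  unfolding pseudo_riemannian_def
proof (intro conjI ballI allI)
  show "smooth_manifold M" by (rule M_mfd)
  show "smooth_in_chart c (chart_dom c) (g c)" if c: "c \<in> atlas M" for c
    unfolding smooth_in_chart_def
  proof (rule smooth_on_local)
    fix y assume "y \<in> chart_map c ` chart_dom c"
    then obtain p where p: "p \<in> chart_dom c" "y = chart_map c p" by blast
    obtain C V e1 e2 e3 I1 I2 I3 where "adapted_charts Mt Q gt n M g k c C V e1 e2 e3 I1 I2 I3" and pV: "p \<in> V"
      using adapted_chart[OF c p(1)] by metis
    then interpret A: adapted_charts Mt Q gt n M g k c C V e1 e2 e3 I1 I2 I3 by blast
    show "\<exists>T. open T \<and> y \<in> T \<and> smooth_on T (g c \<circ> chart_inv c)"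
      using A.smooth_metric_coord A.P.open_S p pV by blast
  qed
  show "g c p u v = g c p v u" if c: "c \<in> atlas M" and p: "p \<in> chart_dom c" for c p u v
    by (rule adapted_chart[OF c p]) (rule adapted_charts.metric_props(1)[OF _ p])
  show "nondegenerate_on (g c p) UNIV" if c: "c \<in> atlas M" and p: "p \<in> chart_dom c" for c p
    by (rule adapted_chart[OF c p]) (rule adapted_charts.metric_props(2)[OF _ p])
  show "g c p u v = g c' p (dcoord c c' p u) (dcoord c c' p v)"
    if c: "c \<in> atlas M" "c' \<in> atlas M" and p: "p \<in> chart_dom c \<inter> chart_dom c'" for c c' p u v
  proof -
    obtain C where C: "C \<in> atlas Mt" "p \<in> chart_dom C" using Mt_cover topI[OF c(1)] p by blast
    have "g c p u v = gt C p (dcoord c C p u) (dcoord c C p v)"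
      "g c' p (dcoord c c' p u) (dcoord c c' p v) = gt C p (dcoord c' C p (dcoord c c' p u)) (dcoord c' C p (dcoord c c' p v))"
      using ind c C p unfolding induced_metric_def by blast+
    then show ?thesis using chain_sub[OF c C(1)] p C(2) by simp
  qed
qed

lemma induced_almost_para_quaternionic: "almost_para_quaternionic M QM"
  unfolding almost_para_quaternionic_def
proof (intro conjI ballI allI)
  fix c c' p B assume c: "c \<in> atlas M" "c' \<in> atlas M" and p: "p \<in> chart_dom c \<inter> chart_dom c'"
  obtain C where C: "C \<in> atlas Mt" "p \<in> chart_dom C" using Mt_cover topI[OF c(1)] p by blast
  have pc: "p \<in> chart_dom c" "p \<in> chart_dom c'" using p by auto
  define T where "T = der (chart_map c' \<circ> chart_inv c) (chart_map c p)"
  define T' where "T' = der (chart_map c \<circ> chart_inv c') (chart_map c' p)"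
  have T: "dcoord c c' p = blinfun_apply T" "dcoord c' c p = blinfun_apply T'"
    using transition_der[OF M_mfd c pc] transition_der[OF M_mfd c(2,1) pc(2,1)] by (simp_all add: T_def T'_def)
  have T'T: "T' (T u) = u" and TT': "T (T' u) = u" for u
    using transition_chain[OF M_mfd c pc, of u] transition_chain[OF M_mfd c(2,1) pc(2,1), of u] by (simp_all add: T)
  have ch: "dcoord c C p u = dcoord c' C p (T u)" for u
    using chain_sub[OF c C(1) pc C(2)] by (simp add: T)
  show "B \<in> QM c' p \<longleftrightarrow> (\<exists>A\<in>QM c p. \<forall>u. B (dcoord c c' p u) = dcoord c c' p (A u))"
    unfolding T
  proof
    assume "B \<in> QM c' p"
    then obtain A0 where A0: "A0 \<in> Q C p" "\<And>u. dcoord c' C p (B u) = A0 (dcoord c' C p u)"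
      using induced_iff[OF c(2) C(1) pc(2) C(2)] by blast
    have "T' o\<^sub>L B o\<^sub>L T \<in> QM c p"
      unfolding induced_iff[OF c(1) C(1) pc(1) C(2)] using A0 by (intro bexI[of _ A0]) (simp_all add: ch TT')
    moreover have "B (T u) = T ((T' o\<^sub>L B o\<^sub>L T) u)" for u by (simp add: TT')
    ultimately show "\<exists>A\<in>QM c p. \<forall>u. B (T u) = T (A u)" by blast
  next
    assume "\<exists>A\<in>QM c p. \<forall>u. B (T u) = T (A u)"
    then obtain A where A: "A \<in> QM c p" "\<And>u. B (T u) = T (A u)" by blast
    obtain A0 where A0: "A0 \<in> Q C p" "\<And>u. dcoord c C p (A u) = A0 (dcoord c C p u)"
      using A(1) induced_iff[OF c(1) C(1) pc(1) C(2)] by blast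
    have "dcoord c' C p (B v) = A0 (dcoord c' C p v)" for v
      using A0(2)[of "T' v"] A(2)[of "T' v"] by (simp add: ch TT')
    then show "B \<in> QM c' p" unfolding induced_iff[OF c(2) C(1) pc(2) C(2)] using A0(1) by blast
  qed
next
  fix c p assume c: "c \<in> atlas M" and p: "p \<in> chart_dom c"
  obtain C V e1 e2 e3 I1 I2 I3 where "adapted_charts Mt Q gt n M g k c C V e1 e2 e3 I1 I2 I3" and pV: "p \<in> V"
    using adapted_chart[OF c p] by metis
  then interpret A: adapted_charts Mt Q gt n M g k c C V e1 e2 e3 I1 I2 I3 by blast
  obtain W e1 e2 e3 J1 J2 J3 where *: "openin (mtop M) W" "W = chart_dom c \<inter> V"
     "smooth_in_chart c W J1" "smooth_in_chart c W J2" "smooth_in_chart c W J3"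
     "\<forall>q\<in>W. para_hypercomplex_triple e1 e2 e3 (J1 q) (J2 q) (J3 q) \<and> QM c q = span {J1 q, J2 q, J3 q}"
    using A.local_frame by metis
  have "p \<in> W" "W \<subseteq> chart_dom c" using *(2) p pV by auto
  then show "\<exists>V e1 e2 e3 J1 J2 J3. openin (mtop M) V \<and> p \<in> V \<and> V \<subseteq> chart_dom c \<and>
      smooth_in_chart c V J1 \<and> smooth_in_chart c V J2 \<and> smooth_in_chart c V J3 \<and>
      (\<forall>q\<in>V. para_hypercomplex_triple e1 e2 e3 (J1 q) (J2 q) (J3 q) \<and> QM c q = span {J1 q, J2 q, J3 q})"
    using * by metis
qed

lemma induced_parallel: "levi_civita_preserves M g QM"
  unfolding levi_civita_preserves_def
proof (intro ballI allI impI)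
  fix c W p X and A :: "'a \<Rightarrow> 'm \<Rightarrow>\<^sub>L 'm"
  assume c: "c \<in> atlas M" and W: "openin (mtop M) W" "W \<subseteq> chart_dom c" and A: "smooth_in_chart c W A"
    and AQ: "\<forall>q\<in>W. A q \<in> QM c q" and p: "p \<in> W"
  have pc: "p \<in> chart_dom c" using p W by blast
  obtain C V e1 e2 e3 I1 I2 I3 where "adapted_charts Mt Q gt n M g k c C V e1 e2 e3 I1 I2 I3" and pV: "p \<in> V"
    using adapted_chart[OF c pc] by metis
  then interpret A: adapted_charts Mt Q gt n M g k c C V e1 e2 e3 I1 I2 I3 by blast
  show "cov_deriv_endo g c A p X \<in> QM c p"
    by (rule A.parallel_coord[OF W A _ p pV]) (use AQ in blast)
qed

theorem induced_para_quaternionic_kahler: "para_quaternionic_kahler k M QM g"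
  unfolding para_quaternionic_kahler_def
proof (intro conjI ballI allI impI)
  show "DIM('m) = 4 * k" by (rule dim)
  show "pseudo_riemannian M g" by (rule induced_pseudo_riemannian)
  show "almost_para_quaternionic M QM" by (rule induced_almost_para_quaternionic)
  show "levi_civita_preserves M g QM" by (rule induced_parallel)
  show "has_signature (g c p) (2 * k) (2 * k)" if c: "c \<in> atlas M" and p: "p \<in> chart_dom c" for c p
    by (rule adapted_chart[OF c p]) (rule adapted_charts.neutral_signature_coord[OF _ p])
  show "g c p (A X) Y = - g c p X (A Y)" if c: "c \<in> atlas M" and p: "p \<in> chart_dom c" and A: "A \<in> QM c p" for c p A X Y
    by (rule adapted_chart[OF c p]) (rule adapted_charts.QM_skew[OF _ p _ A])
  show "curvature_decomposes k M QM g" if k: "k = 1"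
    unfolding curvature_decomposes_def
  proof (intro ballI allI impI)
    fix c p s1 s2 s3 K1 K2 K3
    assume c: "c \<in> atlas M" and p: "p \<in> chart_dom c"
      and K: "para_hypercomplex_triple s1 s2 s3 K1 K2 K3" "QM c p = span {K1, K2, K3}"
    show "\<exists>W. algebraic_curvature (g c p) W \<and> trace_free W \<and> Q_invariant_curvature (QM c p) W \<and>
     (\<forall>X Y Z. curvature g c p X Y Z = reduced_scal k g c p *\<^sub>R R0 (g c p) s1 s2 s3 K1 K2 K3 X Y Z + W X Y Z)"
      by (rule adapted_chart[OF c p]) (rule adapted_charts.decomposes_coord[OF _ induced_pseudo_riemannian p _ k K])
  qed
qed

end

theorem corollary3p9:
  fixes Mt :: "('a, 'e::euclidean_space) manifold"
    and Q :: "('a, 'e) endo_bundle"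
    and gt :: "('a, 'e) metric"
    and M :: "('a, 'm::euclidean_space) manifold"
    and J :: "('a, 'm) chart \<Rightarrow> 'a \<Rightarrow> 'm \<Rightarrow>\<^sub>L 'm"
    and g :: "('a, 'm) metric"
    and eps :: real
    and n k :: nat
  assumes "para_quaternionic_kahler n Mt Q gt"
    and "\<forall>C\<in>atlas Mt. \<forall>p\<in>chart_dom C. reduced_scal n gt C p \<noteq> 0"
    and "eps \<in> {-1, 1}"
    and "DIM('m) = 4 * k"
    and "almost_eps_hermitian_submanifold eps Mt Q gt M J g"
    and "openin (mtop M) (nijenhuis_nonzero_set eps M J)"
    and "mtop M closure_of nijenhuis_nonzero_set eps M J = topspace (mtop M)"
    and "\<forall>x\<in>nijenhuis_nonzero_set eps M J. \<forall>C\<in>atlas Mt. x \<in> chart_dom C \<longrightarrow>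
           nondegenerate_on (gt C x) (maximal_invariant_subspace (Q C x) (tangent_subspace M C x))"
  shows "totally_geodesic Mt gt M \<and> para_quaternionic_kahler_submanifold k Mt Q gt M g"
proof -
  have nds: "nondegenerate_submanifold Mt gt M" and ind: "induced_metric Mt gt M g"
    using assms(5) by (simp_all add: almost_eps_hermitian_submanifold_def)
  interpret s: submanifold_setting Mt Q gt n M g
    by unfold_locales (rule assms(1) nds ind)+
  have inv: "blinfun_apply A ` tangent_subspace M C p \<subseteq> tangent_subspace M C p"
    if C: "C \<in> atlas Mt" and p: "p \<in> topspace (mtop M) \<inter> chart_dom C" and A: "A \<in> Q C p" for C p A
  proof (rule s.invariant_by_density[OF assms(7) _ C p A])
    fix q C A assume q: "q \<in> nijenhuis_nonzero_set eps M J" and C: "C \<in> atlas Mt" "q \<in> chart_dom C" and A: "A \<in> Q C q"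
    show "blinfun_apply A ` tangent_subspace M C q \<subseteq> tangent_subspace M C q"
      by (rule s.invariant_where_nijenhuis_nonzero[OF assms(3,4,5) q C _ A]) (use assms(8) q C in blast)
  qed
  interpret i: invariant_submanifold Mt Q gt n M g k
    by unfold_locales (rule assms(4), rule inv)
  show ?thesis
    unfolding para_quaternionic_kahler_submanifold_def
    using i.totally_geodesic_submanifold i.induced_para_quaternionic_kahler nds ind inv by blast
qed

end
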